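(* There is an absolute constant $c>0$ such that for every positive integer $n$, if $A\subseteq A_n$ is product-free and $100$-global then $\mu(A)<e^{-cn^{1/3}}$.
   Context: $A_n$ is the alternating group on $[n]$ and $\mu(A)=|A|/|A_n|$. $A$ is product-free if there are no $a,b,c\in A$ with $ab=c$. Globalness: let $[n]_t$ be the set of $t$-tuples of distinct elements of $[n]$. For $I,J\in[n]_t$ let $U_{I\to J}=\{\sigma\in S_n:\sigma(I_s)=J_s \text{ for all } s\}$. A set $A\subseteq S_n$ (in particular a subset of $A_n\subseteq S_n$) is $r$-global if its indicator function $1_A$ satisfies $\|(1_A)_{I\to J}\|_2\le r^t\|1_A\|_2$ for every $t$ and all $I,J\in[n]_t$, where $(1_A)_{I\to J}$ is the restriction to $U_{I\to J}$, and $\|\cdot\|_2$ is with respect to the uniform probability measure on $U_{I\to J}$, respectively on $S_n$. *)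

theory Defs
  imports
    Complex_Main
    "HOL-Algebra.Sym_Groups"
    "HOL-Library.Indicator_Function"
begin

definition product_free :: "('a, 'b) monoid_scheme \<Rightarrow> 'a set \<Rightarrow> bool" where
  "product_free G A \<longleftrightarrow> \<not> (\<exists>a\<in>A. \<exists>b\<in>A. \<exists>c\<in>A. a \<otimes>\<^bsub>G\<^esub> b = c)"

(* The L2 norm of f restricted to the finite nonempty set U, with respect to the
   uniform probability measure on U. *)
definition l2norm_on :: "'a set \<Rightarrow> ('a \<Rightarrow> real) \<Rightarrow> real" where
  "l2norm_on U f = sqrt ((\<Sum>x\<in>U. \<bar>f x\<bar>\<^sup>2) / real (card U))"

(* [n]_t; tuples are lists, so their entries are indexed by s < t. *)
definition distinct_tuples :: "nat \<Rightarrow> nat \<Rightarrow> nat list set" where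
  "distinct_tuples n t = {I. length I = t \<and> distinct I \<and> set I \<subseteq> {1..n}}"

definition umvirate :: "nat \<Rightarrow> nat list \<Rightarrow> nat list \<Rightarrow> (nat \<Rightarrow> nat) set" where
  "umvirate n I J = {\<sigma> \<in> carrier (sym_group n). \<forall>s<length I. \<sigma> (I ! s) = J ! s}"

(* The norm on the right-hand side is taken over the whole symmetric group, also
   when A consists of even permutations only. *)
definition global_set :: "nat \<Rightarrow> real \<Rightarrow> (nat \<Rightarrow> nat) set \<Rightarrow> bool" where
  "global_set n r A \<longleftrightarrow>
    (\<forall>t. \<forall>I\<in>distinct_tuples n t. \<forall>J\<in>distinct_tuples n t.
      l2norm_on (umvirate n I J) (indicator A)
        \<le> r ^ t * l2norm_on (carrier (sym_group n)) (indicator A))"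

definition alt_density :: "nat \<Rightarrow> (nat \<Rightarrow> nat) set \<Rightarrow> real" where
  "alt_density n A = real (card A) / real (card (carrier (alt_group n)))"

end

(*
  Let f be the indicator function of A, mu its density in S_n, and suppose that mu >= exp(-a) with
  a of order n^(1/3). If A is product-free then <f*f, f> = 0. Write f = 2 mu 1_{A_n} + F_1 + ... + F_D + h
  with D = 32 a, where F_d lies in the span of the indicators of the cosets of the pointwise stabilisers
  in A_n of d points and is orthogonal to the corresponding span for d - 1 points, and h is orthogonal to
  all these spans up to D. Convolution preserves the levels, so <f*f, f> is the sum of the main term
  2 mu^3 n!^2, the terms <F_d*F_d, F_d>, and <f*h, h>.

  The level terms are controlled by averages of F_d over cosets of the stabiliser of d points. These are
  dominated by iterated differences of the corresponding averages of f along transpositions of paired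
  points. Globalness bounds the restrictions of these differences, and Bonami's inequality on the cube
  of products of such transpositions turns this into a level inequality of strength (const a / n)^d.

  For h, take 8a disjoint quadruples of points. Each carries a Klein four-group, and a
  nontrivial character of their product has 2^(8a) different conjugates under transpositions inside the
  quadruples; Bessel's inequality then gains a factor 2^(8a) in the squared norm of f*h. Every function orthogonal
  to the low levels is a combination of functions with such characters.
*)
theory Submission
  imports Defs "HOL-Analysis.Convex"
begin

section \<open>Averages and moment inequalities\<close>

text \<open>The exponent 1/3 comes from the level terms. The level inequality enters cubed, which
  gains \<kappa>^(3d) with \<kappa> of order a/n, while passing from a function of level d to its
  averages over stabilisers costs n!/(n-d)!, at most n^d, twice. The square of a level term relative
  to the main term is thus about (n^2 \<kappa>^3)^d, which is geometrically small once a^3 is a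
  small multiple of n. The symmetric group is not a product space; the commuting transpositions
  supply the cube that hypercontractivity needs. Averages are kept as kernels in two permutations
  \<open>z\<close>, \<open>w\<close>, one for each side of a coset: the kernel of a convolution is
  the matrix product of the kernels, so Hilbert-Schmidt norms replace representation theory. Levels
  refer to alternating stabilisers, so that the indicator of the even permutations has level 0,
  whereas globalness and differences refer to the symmetric group; a factor 2 reconciles them. The
  8a quadruples are needed because 2^(8a) has to beat \<open>\<mu>\<close> to the power -3, at most
  e^(3a); they occupy 32a points, which dictates D.\<close>

definition avg :: "'a set \<Rightarrow> ('a \<Rightarrow> real) \<Rightarrow> real" where
  "avg A f = (\<Sum>x\<in>A. f x) / real (card A)"

lemma avg_mono: "(\<And>x. x \<in> A \<Longrightarrow> f x \<le> g x) \<Longrightarrow> avg A f \<le> avg A g"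
  unfolding avg_def by (intro divide_right_mono sum_mono) auto

lemma avg_nonneg: "(\<And>x. x \<in> A \<Longrightarrow> 0 \<le> f x) \<Longrightarrow> 0 \<le> avg A f"
  unfolding avg_def by (intro divide_nonneg_nonneg sum_nonneg) auto

lemma avg_cong: "(\<And>x. x \<in> A \<Longrightarrow> f x = g x) \<Longrightarrow> avg A f = avg A g"
  unfolding avg_def by (simp cong: sum.cong)

lemma avg_const: "finite A \<Longrightarrow> A \<noteq> {} \<Longrightarrow> avg A (\<lambda>_. c) = c"
  unfolding avg_def by simp

lemma avg_cmult: "avg A (\<lambda>x. c * f x) = c * avg A f"
  unfolding avg_def by (simp flip: sum_distrib_left)

lemma avg_cmult_right: "avg A (\<lambda>x. f x * c) = avg A f * c"
  unfolding avg_def by (simp flip: sum_distrib_right)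

lemma avg_add: "avg A (\<lambda>x. f x + g x) = avg A f + avg A g"
  unfolding avg_def by (simp add: sum.distrib add_divide_distrib)

lemma avg_sum: "avg A (\<lambda>x. \<Sum>i\<in>I. f i x) = (\<Sum>i\<in>I. avg A (f i))"
  unfolding avg_def by (subst sum.swap) (simp add: sum_divide_distrib)

lemma avg_swap: "avg A (\<lambda>x. avg B (f x)) = avg B (\<lambda>y. avg A (\<lambda>x. f x y))"
proof -
  have "(\<Sum>x\<in>A. (\<Sum>y\<in>B. f x y) / real (card B)) = (\<Sum>y\<in>B. \<Sum>x\<in>A. f x y) / real (card B)"
    by (subst sum.swap) (simp flip: sum_divide_distrib)
  moreover have "(\<Sum>y\<in>B. (\<Sum>x\<in>A. f x y) / real (card A)) = (\<Sum>y\<in>B. \<Sum>x\<in>A. f x y) / real (card A)"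
    by (simp flip: sum_divide_distrib)
  ultimately show ?thesis unfolding avg_def by simp
qed

lemma weighted_power_mean:
  fixes u v :: real
  assumes "0 \<le> u" "0 \<le> v" "j \<le> p" "0 < p"
  shows "u ^ (p - j) * v ^ j \<le> (real (p - j) / p) * u ^ p + (real j / p) * v ^ p"
proof (cases "u = 0 \<or> v = 0")
  case True
  have nn: "0 \<le> (real (p - j) / p) * u ^ p" "0 \<le> (real j / p) * v ^ p"
    by (intro mult_nonneg_nonneg divide_nonneg_nonneg zero_le_power assms of_nat_0_le_iff)+
  consider "j = 0" | "j = p" | "0 < j" "j < p" using assms by linarith
  then show ?thesis
  proof cases
    case 3
    then have "u ^ (p - j) * v ^ j = 0" using True by auto
    then show ?thesis using nn by linarith
  qed (use assms in auto)
next
  case False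
  then have pos: "u > 0" "v > 0" using assms by auto
  have 1: "(u ^ p) powr (real (p - j) / p) = u ^ (p - j)"
    using pos assms by (simp add: powr_powr powr_realpow[symmetric] del: of_nat_diff)
  have 2: "(v ^ p) powr (real j / p) = v ^ j"
    using pos assms by (simp add: powr_powr powr_realpow[symmetric])
  have "real (p - j) / p + real j / p = 1" using assms by (simp add: field_simps of_nat_diff)
  then have "(u ^ p) powr (real (p - j) / p) * (v ^ p) powr (real j / p) \<le> (real (p - j) / p) * u ^ p + (real j / p) * v ^ p"
    using pos by (intro Youngs_inequality_0) auto
  then show ?thesis unfolding 1 2 .
qed

text \<open>After division by \<open>a\<close> and \<open>b\<close>, Young's inequality holds
  pointwise and is averaged. The hypotheses are upper bounds instead of exact moments, so that an
  induction can feed in its own bounds; a zero bound makes the function vanish on \<open>A\<close>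
  and is treated apart because of the division.\<close>

lemma avg_Holder:
  fixes x y :: "'a \<Rightarrow> real"
  assumes A: "finite A" "A \<noteq> {}" and "0 \<le> a" "0 \<le> b" "j \<le> p" "0 < p"
    and x: "\<And>i. i \<in> A \<Longrightarrow> 0 \<le> x i" and y: "\<And>i. i \<in> A \<Longrightarrow> 0 \<le> y i"
    and xa: "avg A (\<lambda>i. x i ^ p) \<le> a ^ p" and yb: "avg A (\<lambda>i. y i ^ p) \<le> b ^ p"
  shows "avg A (\<lambda>i. x i ^ (p - j) * y i ^ j) \<le> a ^ (p - j) * b ^ j"
proof -
  have zero: "\<forall>i\<in>A. z i = 0" if "avg A (\<lambda>i. z i ^ p) \<le> 0" "\<And>i. i \<in> A \<Longrightarrow> 0 \<le> z i" for z :: "'a \<Rightarrow> real"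
  proof -
    have "(\<Sum>i\<in>A. z i ^ p) \<le> 0"
      using that A by (simp add: avg_def divide_le_0_iff)
    moreover have "0 \<le> (\<Sum>i\<in>A. z i ^ p)" using that(2) by (intro sum_nonneg) auto
    ultimately have "(\<Sum>i\<in>A. z i ^ p) = 0" by linarith
    then have "\<forall>i\<in>A. z i ^ p = 0" using sum_nonneg_eq_0_iff[OF A(1), of "\<lambda>i. z i ^ p"] that(2) by auto
    then show ?thesis by auto
  qed
  consider "j = 0" | "j = p" | "0 < j" "j < p" "a = 0" | "0 < j" "j < p" "b = 0" | "a > 0" "b > 0"
    using assms by (metis less_eq_real_def nat_less_le neq0_conv)
  then show ?thesis
  proof cases
    case 3
    then have "avg A (\<lambda>i. x i ^ p) \<le> 0" using xa \<open>0 < p\<close> by (simp add: power_0_left)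
    then have "\<forall>i\<in>A. x i = 0" using zero[of x] x by blast
    then show ?thesis using 3 by (simp add: avg_def power_0_left)
  next
    case 4
    then have "avg A (\<lambda>i. y i ^ p) \<le> 0" using yb \<open>0 < p\<close> by (simp add: power_0_left)
    then have "\<forall>i\<in>A. y i = 0" using zero[of y] y by blast
    then show ?thesis using 4 by (simp add: avg_def power_0_left)
  next
    case 5
    have "avg A (\<lambda>i. x i ^ (p - j) * y i ^ j)
        \<le> avg A (\<lambda>i. (a ^ (p - j) * b ^ j) * ((real (p - j) / p) * (x i / a) ^ p + (real j / p) * (y i / b) ^ p))"
    proof (intro avg_mono)
      fix i assume i: "i \<in> A"
      have "x i ^ (p - j) * y i ^ j = (a ^ (p - j) * b ^ j) * ((x i / a) ^ (p - j) * (y i / b) ^ j)"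
        using 5 by (simp add: power_divide)
      also have "\<dots> \<le> (a ^ (p - j) * b ^ j) * ((real (p - j) / p) * (x i / a) ^ p + (real j / p) * (y i / b) ^ p)"
        using weighted_power_mean[of "x i / a" "y i / b" j p] x[OF i] y[OF i] 5 assms
        by (intro mult_left_mono) auto
      finally show "x i ^ (p - j) * y i ^ j \<le> (a ^ (p - j) * b ^ j) * ((real (p - j) / p) * (x i / a) ^ p + (real j / p) * (y i / b) ^ p)" .
    qed
    also have "\<dots> = (a ^ (p - j) * b ^ j) * ((real (p - j) / p) * (avg A (\<lambda>i. x i ^ p) / a ^ p) + (real j / p) * (avg A (\<lambda>i. y i ^ p) / b ^ p))"
      by (simp add: avg_cmult avg_add power_divide avg_cmult_right[of A _ "inverse _", folded divide_inverse])
    also have "\<dots> \<le> (a ^ (p - j) * b ^ j) * ((real (p - j) / p) * 1 + (real j / p) * 1)"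
      using 5 xa yb by (intro mult_left_mono add_mono) auto
    also have "(real (p - j) / p) * 1 + (real j / p) * 1 = (1::real)"
      using assms by (simp add: field_simps of_nat_diff)
    finally show ?thesis by simp
  qed (use xa yb in auto)
qed

section \<open>Bonami's inequality on the discrete cube\<close>

lemma binomial_double_le:
  "j \<le> p \<Longrightarrow> real ((2 * p) choose (2 * j)) \<le> real (p choose j) * (2 * real p - 1) ^ j"
proof (induction j)
  case 0
  then show ?case by simp
next
  case (Suc j)
  have B: "real (Suc k) * real (n choose Suc k) = (real n - real k) * real (n choose k)" if "k < n" for n k
  proof -
    have "Suc k * (n choose Suc k) = (n - k) * (n choose k)"
      using binomial_absorb_comp[of n k] binomial_absorption[of k n] by simp
    then have "real (Suc k * (n choose Suc k)) = real ((n - k) * (n choose k))" by simp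
    then show ?thesis using that by (simp only: of_nat_mult of_nat_diff less_imp_le)
  qed
  have j: "j < p" using Suc by simp
  let ?P = "real p" and ?J = "real j"
  have e1: "real (Suc (2*j)) * real (2*p choose Suc (2*j)) = (2*?P - 2*?J) * real (2*p choose (2*j))"
    using B[of "2*j" "2*p"] j by simp
  have e2: "real (Suc (Suc (2*j))) * real (2*p choose Suc (Suc (2*j))) = (2*?P - 2*?J - 1) * real (2*p choose Suc (2*j))"
    using B[of "Suc (2*j)" "2*p"] j by simp
  have e3: "real (Suc j) * real (p choose Suc j) = (?P - ?J) * real (p choose j)"
    using B[of j p] j by simp
  then have e3': "(?P - ?J) * real (p choose j) = (?J + 1) * real (p choose Suc j)" by (simp add: add.commute)
  have "(2*?J+2) * (2*?J+1) * real (2*p choose Suc (Suc (2*j))) = (2*?P - 2*?J - 1) * (2*?P - 2*?J) * real (2*p choose (2*j))"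
  proof -
    have "(2*?J+2) * (2*?J+1) * real (2*p choose Suc (Suc (2*j)))
        = (2*?J+1) * (real (Suc (Suc (2*j))) * real (2*p choose Suc (Suc (2*j))))" by (simp add: algebra_simps)
    also have "\<dots> = (2*?P - 2*?J - 1) * (real (Suc (2*j)) * real (2*p choose Suc (2*j)))"
      unfolding e2 by (simp add: algebra_simps)
    also have "\<dots> = (2*?P - 2*?J - 1) * (2*?P - 2*?J) * real (2*p choose (2*j))"
      unfolding e1 by (simp add: algebra_simps)
    finally show ?thesis .
  qed
  also have "\<dots> \<le> (2*?P - 2*?J - 1) * (2*?P - 2*?J) * (real (p choose j) * (2 * ?P - 1) ^ j)"
    using Suc j by (intro mult_left_mono) auto
  also have "\<dots> = 2 * (2*?P - 2*?J - 1) * (2*?P-1)^j * ((?P - ?J) * real (p choose j))"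
    by (simp add: algebra_simps)
  also have "\<dots> = 2 * (2*?P - 2*?J - 1) * (2*?P-1)^j * ((?J+1) * real (p choose Suc j))"
    unfolding e3' by (rule refl)
  also have "\<dots> \<le> 2 * ((2*?P-1)*(2*?J+1)) * (2*?P-1)^j * ((?J+1) * real (p choose Suc j))"
  proof -
    \<comment> \<open>Comparison of consecutive quotients: the left coefficient grows by
      (p-j)(2p-2j-1)/((j+1)(2j+1)), the right one by (p-j)(2p-1)/(j+1).\<close>
    have "2*?P - 2*?J - 1 \<le> (2*?P-1)*(2*?J+1)"
      using j by (simp add: algebra_simps)
    then show ?thesis using j by (intro mult_right_mono mult_left_mono) auto
  qed
  finally have "((2*?J+2) * (2*?J+1)) * real (2*p choose Suc (Suc (2*j))) \<le> ((2*?J+2) * (2*?J+1)) * (real (p choose Suc j) * (2*?P-1)^Suc j)"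
    by (simp add: algebra_simps)
  then have "real (2*p choose Suc (Suc (2*j))) \<le> (real (p choose Suc j) * (2*?P-1)^Suc j)"
    by (subst (asm) mult_le_cancel_left_pos) (auto intro!: mult_pos_pos)
  then show ?case by simp
qed

lemma sum_even_powers:
  fixes x y :: real
  shows "((x + y) ^ (2 * p) + (x - y) ^ (2 * p)) / 2
       = (\<Sum>j\<le>p. real ((2 * p) choose (2 * j)) * (x\<^sup>2) ^ (p - j) * (y\<^sup>2) ^ j)"
proof -
  have e: "(x + s * y) ^ (2 * p) = (\<Sum>k\<le>2*p. real (2*p choose k) * (s*y) ^ k * x ^ (2*p-k))" for s
    using binomial_ring[of "s*y" x "2*p"] by (simp add: add.commute)
  have "((x + y) ^ (2 * p) + (x - y) ^ (2 * p)) / 2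
     = (\<Sum>k\<le>2*p. real (2*p choose k) * y ^ k * x ^ (2*p-k) * ((1 + (-1)^k)/2))"
    using e[of 1] e[of "-1"]
    by (simp add: sum.distrib[symmetric] sum_divide_distrib power_minus[of y] algebra_simps add_divide_distrib
        cong: sum.cong)
  also have "\<dots> = (\<Sum>k\<in>(\<lambda>j. 2*j) ` {..p}. real (2*p choose k) * y ^ k * x ^ (2*p-k) * ((1 + (-1)^k)/2))"
  proof (rule sum.mono_neutral_right)
    show "\<forall>k\<in>{..2*p} - (*) 2 ` {..p}. real (2*p choose k) * y ^ k * x ^ (2*p-k) * ((1 + (-1)^k)/2) = 0"
    proof
      fix k assume k: "k \<in> {..2*p} - (*) 2 ` {..p}"
      have "odd k"
      proof
        assume "even k" then obtain j where "k = 2*j" by blast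
        then show False using k by auto
      qed
      then show "real (2*p choose k) * y ^ k * x ^ (2*p-k) * ((1 + (-1)^k)/2) = 0" by simp
    qed
  qed auto
  also have "\<dots> = (\<Sum>j\<le>p. real ((2 * p) choose (2 * j)) * (x\<^sup>2) ^ (p - j) * (y\<^sup>2) ^ j)"
    by (subst sum.reindex) (auto simp: inj_on_def power_mult[symmetric] right_diff_distrib' intro!: sum.cong)
  finally show ?thesis .
qed

text \<open>One new coordinate in Bonami's inequality: averaging over its sign removes the odd
  powers, Hoelder bounds the mixed moments, and \<open>binomial_double_le\<close> fits the
  coefficients to a binomial expansion. The number 2p-1 is the usual hypercontractive
  factor.\<close>

lemma avg_even_moment_step:
  fixes x y :: "'a \<Rightarrow> real"
  assumes A: "finite A" "A \<noteq> {}" and ab: "0 \<le> a" "0 \<le> b" and p: "0 < p"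
    and xa: "avg A (\<lambda>i. x i ^ (2 * p)) \<le> a ^ p" and yb: "avg A (\<lambda>i. y i ^ (2 * p)) \<le> b ^ p"
  shows "avg A (\<lambda>i. ((x i + y i) ^ (2 * p) + (x i - y i) ^ (2 * p)) / 2) \<le> (a + (2 * real p - 1) * b) ^ p"
proof -
  have "avg A (\<lambda>i. ((x i + y i) ^ (2 * p) + (x i - y i) ^ (2 * p)) / 2)
      = (\<Sum>j\<le>p. real ((2 * p) choose (2 * j)) * avg A (\<lambda>i. ((x i)\<^sup>2) ^ (p - j) * ((y i)\<^sup>2) ^ j))"
    by (simp add: sum_even_powers avg_sum avg_cmult mult.assoc)
  also have "\<dots> \<le> (\<Sum>j\<le>p. real (p choose j) * (2 * real p - 1) ^ j * (a ^ (p - j) * b ^ j))"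
  proof (intro sum_mono mult_mono)
    fix j assume j: "j \<in> {..p}"
    show "real ((2 * p) choose (2 * j)) \<le> real (p choose j) * (2 * real p - 1) ^ j"
      using binomial_double_le j by auto
    show "avg A (\<lambda>i. ((x i)\<^sup>2) ^ (p - j) * ((y i)\<^sup>2) ^ j) \<le> a ^ (p - j) * b ^ j"
      by (rule avg_Holder) (use assms j in \<open>auto simp: power_mult\<close>)
  qed (use p ab in \<open>auto intro!: avg_nonneg\<close>)
  also have "\<dots> = (a + (2 * real p - 1) * b) ^ p"
    using binomial_ring[of "(2 * real p - 1) * b" a p] by (simp add: add.commute power_mult_distrib mult_ac)
  finally show ?thesis .
qed

lemma sum_Pow_insert:
  assumes "finite B" "x \<notin> B"
  shows "(\<Sum>V\<in>Pow (insert x B). F V) = (\<Sum>V\<in>Pow B. F V + F (insert x V))"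
proof -
  have "(\<Sum>V\<in>Pow (insert x B). F V) = (\<Sum>V\<in>Pow B. F V) + (\<Sum>V\<in>insert x ` Pow B. F V)"
    unfolding Pow_insert using assms by (intro sum.union_disjoint) auto
  also have "(\<Sum>V\<in>insert x ` Pow B. F V) = (\<Sum>V\<in>Pow B. F (insert x V))"
  proof -
    have "inj_on (insert x) (Pow B)" using assms by (auto simp: inj_on_def)
    then show ?thesis by (simp add: sum.reindex)
  qed
  finally show ?thesis by (simp add: sum.distrib)
qed

text \<open>\<open>Pow B\<close> is the cube, and the sign is the character of \<open>K\<close> at
  the point \<open>V\<close>. Splitting off a coordinate writes the function as \<open>P + Q\<close>
  on one face and \<open>P - Q\<close> on the opposite one. Degrees are weighted instead of fixed,
  because the splitting mixes two degrees.\<close>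

lemma Bonami:
  fixes c :: "'a set \<Rightarrow> real"
  assumes "finite B" "0 < p"
  shows "avg (Pow B) (\<lambda>V. (\<Sum>K\<in>Pow B. c K * (-1) ^ card (V \<inter> K)) ^ (2 * p))
       \<le> (\<Sum>K\<in>Pow B. (2 * real p - 1) ^ card K * (c K)\<^sup>2) ^ p"
  using assms(1)
proof (induction B arbitrary: c)
  case empty
  then show ?case by (simp add: avg_def power_mult)
next
  case (insert x B)
  define P where "P V = (\<Sum>K\<in>Pow B. c K * (-1) ^ card (V \<inter> K))" for V
  define Q where "Q V = (\<Sum>K\<in>Pow B. c (insert x K) * (-1) ^ card (V \<inter> K))" for V
  let ?q = "2 * real p - 1"
  have fin: "finite K" if "K \<in> Pow B" for K using that insert.hyps finite_subset by auto
  have nx: "x \<notin> K" if "K \<in> Pow B" for K using that insert.hyps by auto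
  have 1: "(\<Sum>K\<in>Pow (insert x B). c K * (-1) ^ card (V \<inter> K)) = P V + Q V" if V: "V \<in> Pow B" for V
  proof -
    have "V \<inter> insert x K = V \<inter> K" for K using nx[OF V] by auto
    then show ?thesis using insert.hyps unfolding P_def Q_def by (simp add: sum_Pow_insert sum.distrib)
  qed
  have 2: "(\<Sum>K\<in>Pow (insert x B). c K * (-1) ^ card (insert x V \<inter> K)) = P V - Q V" if V: "V \<in> Pow B" for V
  proof -
    have "insert x V \<inter> K = V \<inter> K" "card (insert x V \<inter> insert x K) = Suc (card (V \<inter> K))" if "K \<in> Pow B" for K
    proof -
      show "insert x V \<inter> K = V \<inter> K" using nx[OF that] by auto
      have "insert x V \<inter> insert x K = insert x (V \<inter> K)" by auto
      then show "card (insert x V \<inter> insert x K) = Suc (card (V \<inter> K))"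
        using nx[OF V] fin[OF that] by simp
    qed
    then have "(\<Sum>K\<in>Pow B. c K * (-1) ^ card (insert x V \<inter> K) + c (insert x K) * (-1) ^ card (insert x V \<inter> insert x K))
        = (\<Sum>K\<in>Pow B. c K * (-1) ^ card (V \<inter> K) - c (insert x K) * (-1) ^ card (V \<inter> K))"
      by (intro sum.cong) simp_all
    then show ?thesis using insert.hyps unfolding P_def Q_def by (simp add: sum_Pow_insert sum_subtractf)
  qed
  have card2: "card (Pow (insert x B)) = 2 * card (Pow B)" using insert.hyps by (simp add: card_Pow)
  have "avg (Pow (insert x B)) (\<lambda>V. (\<Sum>K\<in>Pow (insert x B). c K * (-1) ^ card (V \<inter> K)) ^ (2 * p))
      = avg (Pow B) (\<lambda>V. ((P V + Q V) ^ (2*p) + (P V - Q V) ^ (2*p)) / 2)"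
    unfolding avg_def card2 sum_Pow_insert[OF insert.hyps, of "\<lambda>V. (\<Sum>K\<in>Pow (insert x B). c K * (-1) ^ card (V \<inter> K)) ^ (2 * p)"]
    by (simp add: 1 2 flip: sum_divide_distrib)
  also have "\<dots> \<le> ((\<Sum>K\<in>Pow B. ?q ^ card K * (c K)\<^sup>2) + ?q * (\<Sum>K\<in>Pow B. ?q ^ card K * (c (insert x K))\<^sup>2)) ^ p"
  proof (rule avg_even_moment_step)
    show "avg (Pow B) (\<lambda>i. P i ^ (2 * p)) \<le> (\<Sum>K\<in>Pow B. ?q ^ card K * (c K)\<^sup>2) ^ p"
      unfolding P_def using insert.IH by blast
    show "avg (Pow B) (\<lambda>i. Q i ^ (2 * p)) \<le> (\<Sum>K\<in>Pow B. ?q ^ card K * (c (insert x K))\<^sup>2) ^ p"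
      unfolding Q_def using insert.IH[of "\<lambda>K. c (insert x K)"] by blast
  qed (use assms insert in \<open>auto intro!: sum_nonneg\<close>)
  also have "(\<Sum>K\<in>Pow B. ?q ^ card K * (c K)\<^sup>2) + ?q * (\<Sum>K\<in>Pow B. ?q ^ card K * (c (insert x K))\<^sup>2)
     = (\<Sum>K\<in>Pow (insert x B). ?q ^ card K * (c K)\<^sup>2)"
    using insert.hyps by (simp add: sum_Pow_insert sum.distrib sum_distrib_left) (intro sum.cong, auto simp: fin nx)
  finally show ?case .
qed

text \<open>Jensen for weights normalised to total one. The power 2p-1 of the total weight is the
  point: with weight \<open>f\<close> it keeps nearly 2p factors of the density in the level
  inequality.\<close>

lemma weighted_Jensen_even:
  fixes w x :: "'a \<Rightarrow> real"
  assumes "finite A" "\<And>i. i \<in> A \<Longrightarrow> 0 \<le> w i" "0 < p"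
  shows "(\<Sum>i\<in>A. w i * x i) ^ (2 * p) \<le> (\<Sum>i\<in>A. w i) ^ (2 * p - 1) * (\<Sum>i\<in>A. w i * x i ^ (2 * p))"
proof (cases "(\<Sum>i\<in>A. w i) = 0")
  case True
  then have "\<forall>i\<in>A. w i = 0" using sum_nonneg_eq_0_iff[OF assms(1), of w] assms(2) by blast
  then show ?thesis using assms(3) by (simp add: power_0_left)
next
  case False
  define W where "W = (\<Sum>i\<in>A. w i)"
  have "W \<ge> 0" unfolding W_def using assms(2) by (intro sum_nonneg) auto
  then have W: "W > 0" using False unfolding W_def by linarith
  have "A \<noteq> {}" using False by auto
  have 1: "(\<Sum>i\<in>A. w i / W) = 1"
    unfolding sum_divide_distrib[symmetric] W_def[symmetric] using W by simp
  have 2: "0 \<le> w i / W" if "i \<in> A" for i using W assms(2)[OF that] by simp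
  have "(\<Sum>i\<in>A. (w i / W) *\<^sub>R x i) ^ (2*p) \<le> (\<Sum>i\<in>A. (w i / W) * (x i ^ (2*p)))"
    using convex_on_sum[OF assms(1) \<open>A \<noteq> {}\<close> convex_power_even[of "2*p"] 1 2, of x] by simp
  moreover have "(\<Sum>i\<in>A. (w i / W) *\<^sub>R x i) = (\<Sum>i\<in>A. w i * x i) / W"
    by (simp add: sum_divide_distrib)
  moreover have "(\<Sum>i\<in>A. (w i / W) * (x i ^ (2*p))) = (\<Sum>i\<in>A. w i * x i ^ (2*p)) / W"
    by (simp add: sum_divide_distrib)
  ultimately have "(\<Sum>i\<in>A. w i * x i) ^ (2*p) / W ^ (2*p) \<le> (\<Sum>i\<in>A. w i * x i ^ (2*p)) / W"
    by (simp add: power_divide)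
  then have "(\<Sum>i\<in>A. w i * x i) ^ (2*p) \<le> ((\<Sum>i\<in>A. w i * x i ^ (2*p)) / W) * W ^ (2*p)"
    using W by (simp only: pos_divide_le_eq zero_less_power)
  also have "W ^ (2*p) = W ^ (2*p-1) * W" using assms(3) by (simp flip: power_Suc2)
  finally show ?thesis using W by (simp add: W_def mult.commute)
qed

section \<open>Averages over symmetric groups\<close>

abbreviation perms :: "'a set \<Rightarrow> ('a \<Rightarrow> 'a) set" where
  "perms X \<equiv> {p. p permutes X}"

lemma perms_nonempty [simp]: "perms X \<noteq> {}"
  using permutes_id[of X] by blast

lemma avg_perms_left: "g permutes X \<Longrightarrow> avg (perms X) (\<lambda>p. F (g \<circ> p)) = avg (perms X) F"
  unfolding avg_def using setum_permutations_compose_left[of g X F] by simp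

lemma avg_perms_right: "g permutes X \<Longrightarrow> avg (perms X) (\<lambda>p. F (p \<circ> g)) = avg (perms X) F"
  unfolding avg_def using sum_permutations_compose_right[of g X F] by simp

lemma avg_perms_const: "finite X \<Longrightarrow> avg (perms X) (\<lambda>_. c) = c"
  by (rule avg_const[OF finite_permutations perms_nonempty])

lemma avg_perms_subgroup_right:
  assumes "finite X" "Z \<subseteq> X"
  shows "avg (perms X) (\<lambda>w. avg (perms Z) (\<lambda>\<beta>. F (w \<circ> \<beta>))) = avg (perms X) F"
proof -
  have "avg (perms X) (\<lambda>w. avg (perms Z) (\<lambda>\<beta>. F (w \<circ> \<beta>))) = avg (perms Z) (\<lambda>\<beta>. avg (perms X) F)"
    unfolding avg_swap[of "perms X"]
    by (rule avg_cong) (use avg_perms_right permutes_subset[OF _ assms(2)] in auto)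
  then show ?thesis using finite_subset[OF assms(2,1)] by (simp add: avg_perms_const)
qed

lemma avg_perms_subgroup_left:
  assumes "finite X" "Z \<subseteq> X"
  shows "avg (perms X) (\<lambda>w. avg (perms Z) (\<lambda>\<beta>. F (\<beta> \<circ> w))) = avg (perms X) F"
proof -
  have "avg (perms X) (\<lambda>w. avg (perms Z) (\<lambda>\<beta>. F (\<beta> \<circ> w))) = avg (perms Z) (\<lambda>\<beta>. avg (perms X) F)"
    unfolding avg_swap[of "perms X"]
    by (rule avg_cong) (use avg_perms_left permutes_subset[OF _ assms(2)] in auto)
  then show ?thesis using finite_subset[OF assms(2,1)] by (simp add: avg_perms_const)
qed

lemma permutes_disjoint_commute:
  assumes "p permutes Y" "q permutes Z" "Y \<inter> Z = {}"
  shows "p \<circ> q = q \<circ> p"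
proof
  fix x
  show "(p \<circ> q) x = (q \<circ> p) x"
    using assms permutes_not_in[OF assms(1)] permutes_not_in[OF assms(2)]
      permutes_in_image[OF assms(1)] permutes_in_image[OF assms(2)]
    by (metis comp_apply disjoint_iff)
qed

section \<open>Comparison of averages over nested symmetric groups\<close>

lemma fact_ratio:
  assumes "q \<le> b" "b \<le> a" "real a \<le> r * real (b - q)" "0 \<le> r"
  shows "fact a * fact (b - q) \<le> r ^ q * (fact b * fact (a - q))"
  using assms
proof (induction q)
  case (Suc q)
  let ?A = "fact (a - Suc q) :: real" and ?B = "fact (b - Suc q) :: real"
  have "real (b - Suc q) \<le> real (b - q)" by simp
  then have le: "real a \<le> r * real (b - q)"
    using Suc.prems by (meson mult_left_mono order_trans)
  have A: "(fact (a - q) :: real) = real (a - q) * ?A" using Suc.prems fact_reduce[of "a - q"] by (simp del: of_nat_diff)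
  have B: "(fact (b - q) :: real) = real (b - q) * ?B" using Suc.prems fact_reduce[of "b - q"] by (simp del: of_nat_diff)
  have "real (b - q) * (fact a * ?B) = fact a * fact (b - q)" by (simp add: B)
  also have "\<dots> \<le> r ^ q * (fact b * fact (a - q))" using Suc le by simp
  also have "\<dots> = (r ^ q * (fact b * ?A)) * real (a - q)" by (simp add: A)
  also have "\<dots> \<le> (r ^ q * (fact b * ?A)) * (r * real (b - q))"
    using le Suc.prems by (intro mult_left_mono) auto
  finally have "real (b - q) * (fact a * ?B) \<le> real (b - q) * (r ^ Suc q * (fact b * ?A))"
    by (simp add: mult_ac)
  then show ?case using Suc.prems by (subst (asm) mult_le_cancel_left_pos) auto
qed auto

text \<open>By invariance \<open>H\<close> sees only the images of the points of \<open>Q\<close>.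
  Products of a permutation of \<open>Z\<close> with one of \<open>Z' - Q\<close> lie in
  \<open>perms Z'\<close>, and each element arises at most (|Z|-|Q|)! times: two factorisations
  differ by an element that is supported in \<open>Z\<close> and fixes \<open>Q\<close>
  pointwise.\<close>

lemma sum_perms_supergroup:
  assumes Z': "finite Z'" and Z: "Z \<subseteq> Z'" and Q: "Q \<subseteq> Z"
    and H0: "\<And>\<alpha>. \<alpha> permutes Z' \<Longrightarrow> 0 \<le> H \<alpha>"
    and H: "\<And>\<alpha> \<gamma>. \<alpha> permutes Z' \<Longrightarrow> \<gamma> permutes Z' - Q \<Longrightarrow> H (\<alpha> \<circ> \<gamma>) = H \<alpha>"
  shows "fact (card Z' - card Q) * (\<Sum>\<alpha>\<in>perms Z. H \<alpha>) \<le> fact (card Z - card Q) * (\<Sum>\<alpha>\<in>perms Z'. H \<alpha> :: real)"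
proof -
  have finZ: "finite Z" using finite_subset[OF Z Z'] .
  have finQ: "finite Q" using finite_subset[OF Q finZ] .
  define S where "S = perms Z \<times> perms (Z' - Q)"
  let ?g = "\<lambda>(\<alpha>, \<gamma>). \<alpha> \<circ> \<gamma>"
  have finS: "finite S" unfolding S_def using finZ Z' by (simp add: finite_permutations)
  have gS: "?g ` S \<subseteq> perms Z'"
  proof clarify
    fix \<alpha> \<gamma> assume "(\<alpha>, \<gamma>) \<in> S"
    then have "\<alpha> permutes Z'" "\<gamma> permutes Z'"
      unfolding S_def using permutes_subset[OF _ Z] permutes_subset[of _ "Z' - Q" Z'] by auto
    then show "\<alpha> \<circ> \<gamma> permutes Z'" by (intro permutes_compose)
  qed
  have fiber: "card {x \<in> S. ?g x = \<delta>} \<le> fact (card Z - card Q)" for \<delta>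
  proof (cases "{x \<in> S. ?g x = \<delta>} = {}")
    case False
    then obtain \<alpha>0 \<gamma>0 where 0: "\<alpha>0 permutes Z" "\<gamma>0 permutes Z' - Q" "\<alpha>0 \<circ> \<gamma>0 = \<delta>" by (auto simp: S_def)
    have "card {x \<in> S. ?g x = \<delta>} \<le> card (perms (Z - Q))"
    proof (rule card_inj_on_le[where f = "\<lambda>(\<alpha>, \<gamma>). inv' \<alpha>0 \<circ> \<alpha>"])
      show "finite (perms (Z - Q))" using finZ by (simp add: finite_permutations)
      show "inj_on (\<lambda>(\<alpha>, \<gamma>). inv' \<alpha>0 \<circ> \<alpha>) {x \<in> S. ?g x = \<delta>}"
      proof (rule inj_onI, clarify)
        fix \<alpha> \<gamma> \<alpha>' \<gamma>'
        assume s: "(\<alpha>, \<gamma>) \<in> S" "(\<alpha>', \<gamma>') \<in> S" and d: "\<alpha>' \<circ> \<gamma>' = \<alpha> \<circ> \<gamma>" "inv' \<alpha>0 \<circ> \<alpha> = inv' \<alpha>0 \<circ> \<alpha>'"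
        have "\<alpha>0 \<circ> (inv' \<alpha>0 \<circ> \<alpha>) = \<alpha>0 \<circ> (inv' \<alpha>0 \<circ> \<alpha>')" using d by simp
        then have a: "\<alpha> = \<alpha>'" using permutes_inv_o(1)[OF 0(1)] by (metis comp_assoc id_comp)
        have "\<alpha> permutes Z" using s by (auto simp: S_def)
        then have "inv' \<alpha> \<circ> (\<alpha> \<circ> \<gamma>) = \<gamma>" "inv' \<alpha> \<circ> (\<alpha> \<circ> \<gamma>') = \<gamma>'"
          using permutes_inv_o(2)[of \<alpha> Z] by (metis comp_assoc id_comp)+
        then show "\<alpha> = \<alpha>' \<and> \<gamma> = \<gamma>'" using a d by metis
      qed
      show "(\<lambda>(\<alpha>, \<gamma>). inv' \<alpha>0 \<circ> \<alpha>) ` {x \<in> S. ?g x = \<delta>} \<subseteq> perms (Z - Q)"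
      proof clarify
        fix \<alpha> \<gamma> assume "(\<alpha>, \<gamma>) \<in> S" and d: "\<delta> = \<alpha> \<circ> \<gamma>"
        then have p: "\<alpha> permutes Z" "\<gamma> permutes Z' - Q" by (auto simp: S_def)
        have "inv' \<alpha>0 \<circ> \<alpha> \<circ> \<gamma> = inv' \<alpha>0 \<circ> (\<alpha>0 \<circ> \<gamma>0)" using d 0(3) by (simp add: comp_assoc)
        also have "\<dots> = \<gamma>0" using permutes_inv_o(2)[OF 0(1)] by (metis comp_assoc id_comp)
        finally have "inv' \<alpha>0 \<circ> \<alpha> \<circ> \<gamma> \<circ> inv' \<gamma> = \<gamma>0 \<circ> inv' \<gamma>" by simp
        then have e: "inv' \<alpha>0 \<circ> \<alpha> = \<gamma>0 \<circ> inv' \<gamma>" using permutes_inv_o(1)[OF p(2)] by (simp add: comp_assoc)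
        have "\<gamma>0 \<circ> inv' \<gamma> permutes Z' - Q" by (intro permutes_compose permutes_inv 0 p)
        then have "(inv' \<alpha>0 \<circ> \<alpha>) x = x" if "x \<in> Q" for x
          unfolding e using permutes_not_in that by fastforce
        moreover have "inv' \<alpha>0 \<circ> \<alpha> permutes Z" by (intro permutes_compose permutes_inv 0 p)
        ultimately show "inv' \<alpha>0 \<circ> \<alpha> permutes Z - Q" by (auto intro: permutes_superset)
      qed
    qed
    also have "\<dots> = fact (card Z - card Q)"
      using finZ Q finQ by (subst card_permutations[OF refl]) (auto simp: card_Diff_subset)
    finally show ?thesis .
  next
    case True
    then show ?thesis by (simp only: card.empty zero_le)
  qed
  have "fact (card Z' - card Q) * (\<Sum>\<alpha>\<in>perms Z. H \<alpha>) = (\<Sum>\<alpha>\<in>perms Z. \<Sum>\<gamma>\<in>perms (Z' - Q). H (\<alpha> \<circ> \<gamma>))"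
  proof -
    have "card (perms (Z' - Q)) = fact (card Z' - card Q)"
      using Z' Z Q finQ by (subst card_permutations[OF refl]) (auto simp: card_Diff_subset)
    moreover have "H (\<alpha> \<circ> \<gamma>) = H \<alpha>" if "\<alpha> \<in> perms Z" "\<gamma> \<in> perms (Z' - Q)" for \<alpha> \<gamma>
      using that H permutes_subset[OF _ Z] by auto
    ultimately show ?thesis by (simp add: sum_distrib_left)
  qed
  also have "\<dots> = (\<Sum>x\<in>S. H (?g x))" unfolding S_def by (simp add: sum.cartesian_product split_def)
  also have "\<dots> = (\<Sum>\<delta>\<in>perms Z'. \<Sum>x\<in>{x\<in>S. ?g x = \<delta>}. H (?g x))"
    using sum.group[OF finS finite_permutations[OF Z'] gS, of "\<lambda>x. H (?g x)"] by simp
  also have "\<dots> = (\<Sum>\<delta>\<in>perms Z'. real (card {x\<in>S. ?g x = \<delta>}) * H \<delta>)"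
    by (intro sum.cong refl) simp
  also have "\<dots> \<le> (\<Sum>\<delta>\<in>perms Z'. fact (card Z - card Q) * H \<delta>)"
  proof (intro sum_mono mult_right_mono)
    fix \<delta> assume "\<delta> \<in> perms Z'"
    then show "0 \<le> H \<delta>" using H0 by blast
    have "real (card {x\<in>S. ?g x = \<delta>}) \<le> real (fact (card Z - card Q))"
      using fiber[of \<delta>] by (simp only: of_nat_le_iff)
    then show "real (card {x\<in>S. ?g x = \<delta>}) \<le> fact (card Z - card Q)" by (simp only: of_nat_fact)
  qed
  finally show ?thesis by (simp add: sum_distrib_left)
qed

text \<open>The price of averaging over the smaller group is exponential only in the number of
  points on which \<open>H\<close> depends, however many points separate \<open>Z\<close> from
  \<open>Z'\<close>.\<close>

lemma avg_perms_supergroup: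
  assumes "finite Z'" "Z \<subseteq> Z'" "Q \<subseteq> Z"
    and "\<And>\<alpha>. \<alpha> permutes Z' \<Longrightarrow> 0 \<le> H \<alpha>"
    and "\<And>\<alpha> \<gamma>. \<alpha> permutes Z' \<Longrightarrow> \<gamma> permutes Z' - Q \<Longrightarrow> H (\<alpha> \<circ> \<gamma>) = H \<alpha>"
    and r: "real (card Z') \<le> r * real (card Z - card Q)" "0 \<le> r"
  shows "avg (perms Z) H \<le> r ^ card Q * avg (perms Z') H"
proof -
  let ?A = "\<Sum>\<alpha>\<in>perms Z. H \<alpha>" and ?A' = "\<Sum>\<alpha>\<in>perms Z'. H \<alpha>"
  let ?a = "card Z'" and ?b = "card Z" and ?q = "card Q"
  have fin: "finite Z" using assms finite_subset by blast
  have le: "?q \<le> ?b" "?b \<le> ?a" using assms fin by (auto intro: card_mono)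
  have A'0: "?A' \<ge> 0" using assms(4) by (intro sum_nonneg) auto
  have "(fact (?a - ?q) * fact ?a) * ?A \<le> fact (?b - ?q) * ?A' * fact ?a"
    using mult_right_mono[OF sum_perms_supergroup[of Z' Z Q H], of "fact ?a"] assms by (simp add: mult_ac)
  also have "\<dots> = (fact ?a * fact (?b - ?q)) * ?A'" by simp
  also have "\<dots> \<le> (r ^ ?q * (fact ?b * fact (?a - ?q))) * ?A'"
    using fact_ratio[OF le r] A'0 by (intro mult_right_mono)
  finally have "fact (?a - ?q) * (fact ?a * ?A) \<le> fact (?a - ?q) * (r ^ ?q * (fact ?b * ?A'))"
    by (simp add: mult_ac)
  then have "fact ?a * ?A \<le> r ^ ?q * (fact ?b * ?A')"
    by (subst (asm) mult_le_cancel_left_pos) auto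
  then show ?thesis
    unfolding avg_def using fin assms(1) by (simp add: card_permutations field_simps)
qed

lemma avg_perms_inv: "avg (perms X) (\<lambda>p. F (inv' p)) = avg (perms X) F"
  unfolding avg_def using sum_permutations_inverse[of F X] by simp

lemma avg_perms_supergroup_left:
  assumes "finite Z'" "Z \<subseteq> Z'" "Q \<subseteq> Z"
    and "\<And>\<alpha>. \<alpha> permutes Z' \<Longrightarrow> 0 \<le> H \<alpha>"
    and H: "\<And>\<alpha> \<gamma>. \<alpha> permutes Z' \<Longrightarrow> \<gamma> permutes Z' - Q \<Longrightarrow> H (\<gamma> \<circ> \<alpha>) = H \<alpha>"
    and r: "real (card Z') \<le> r * real (card Z - card Q)" "0 \<le> r"
  shows "avg (perms Z) H \<le> r ^ card Q * avg (perms Z') H"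
proof -
  have "avg (perms Z) (\<lambda>p. H (inv' p)) \<le> r ^ card Q * avg (perms Z') (\<lambda>p. H (inv' p))"
  proof (rule avg_perms_supergroup[OF assms(1-3) _ _ r])
    fix \<alpha> assume \<alpha>: "\<alpha> permutes Z'"
    show "0 \<le> H (inv' \<alpha>)" using assms(4) permutes_inv[OF \<alpha>] by blast
    fix \<gamma> assume \<gamma>: "\<gamma> permutes Z' - Q"
    have "inv' (\<alpha> \<circ> \<gamma>) = inv' \<gamma> \<circ> inv' \<alpha>" using permutes_bij[OF \<alpha>] permutes_bij[OF \<gamma>] by (simp add: o_inv_distrib)
    then show "H (inv' (\<alpha> \<circ> \<gamma>)) = H (inv' \<alpha>)" using H permutes_inv[OF \<alpha>] permutes_inv[OF \<gamma>] by simp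
  qed
  then show ?thesis by (simp add: avg_perms_inv)
qed

section \<open>Averages over pairs of permutations\<close>

definition avg2 :: "'a set \<Rightarrow> (('a \<Rightarrow> 'a) \<Rightarrow> ('a \<Rightarrow> 'a) \<Rightarrow> real) \<Rightarrow> real" where
  "avg2 X F = avg (perms X) (\<lambda>z. avg (perms X) (F z))"

lemma avg2_mono: "(\<And>z w. z permutes X \<Longrightarrow> w permutes X \<Longrightarrow> F z w \<le> G z w) \<Longrightarrow> avg2 X F \<le> avg2 X G"
  unfolding avg2_def by (intro avg_mono) auto

lemma avg2_nonneg: "(\<And>z w. z permutes X \<Longrightarrow> w permutes X \<Longrightarrow> 0 \<le> F z w) \<Longrightarrow> 0 \<le> avg2 X F"
  unfolding avg2_def by (intro avg_nonneg) auto

lemma avg2_cong: "(\<And>z w. z permutes X \<Longrightarrow> w permutes X \<Longrightarrow> F z w = G z w) \<Longrightarrow> avg2 X F = avg2 X G"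
  unfolding avg2_def by (intro avg_cong) auto

lemma avg2_cmult: "avg2 X (\<lambda>z w. c * F z w) = c * avg2 X F"
  unfolding avg2_def by (simp add: avg_cmult)

lemma avg2_sum: "avg2 X (\<lambda>z w. \<Sum>i\<in>I. F i z w) = (\<Sum>i\<in>I. avg2 X (F i))"
  unfolding avg2_def by (simp add: avg_sum)

lemma avg2_avg: "avg2 X (\<lambda>z w. avg I (\<lambda>i. F i z w)) = avg I (\<lambda>i. avg2 X (F i))"
  unfolding avg2_def avg_swap[of "perms X" I] ..

lemma avg2_const: "finite X \<Longrightarrow> avg2 X (\<lambda>_ _. c) = c"
  unfolding avg2_def by (simp add: avg_perms_const)

lemma avg2_translate:
  assumes "a permutes X" "b permutes X"
  shows "avg2 X (\<lambda>z w. F (a \<circ> z) (w \<circ> b)) = avg2 X F"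
  unfolding avg2_def avg_perms_right[OF assms(2)] using avg_perms_left[OF assms(1), of "\<lambda>z. avg (perms X) (F z)"] .

lemma avg2_eq_sum:
  "avg2 X F = (\<Sum>x\<in>perms X \<times> perms X. F (fst x) (snd x)) / real (card (perms X \<times> perms X))"
  unfolding avg2_def avg_def
  by (simp add: card_cartesian_product sum.cartesian_product' sum_divide_distrib[symmetric])

lemma avg2_Jensen_even:
  assumes "finite X" "0 < p" "\<And>z w. z permutes X \<Longrightarrow> w permutes X \<Longrightarrow> 0 \<le> W z w"
  shows "avg2 X (\<lambda>z w. W z w * F z w) ^ (2 * p) \<le> avg2 X W ^ (2 * p - 1) * avg2 X (\<lambda>z w. W z w * F z w ^ (2 * p))"
proof -
  let ?P = "perms X \<times> perms X"
  let ?c = "real (card ?P)"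
  have fin: "finite ?P" using assms by (simp add: finite_permutations)
  have c: "?c > 0" using fin perms_nonempty[of X] by (simp add: card_gt_0_iff)
  have "(\<Sum>x\<in>?P. W (fst x) (snd x) * F (fst x) (snd x)) ^ (2 * p)
     \<le> (\<Sum>x\<in>?P. W (fst x) (snd x)) ^ (2 * p - 1) * (\<Sum>x\<in>?P. W (fst x) (snd x) * F (fst x) (snd x) ^ (2 * p))"
    by (rule weighted_Jensen_even[OF fin]) (use assms in auto)
  moreover have "?c ^ (2*p) = ?c ^ (2*p-1) * ?c" using assms by (simp flip: power_Suc2)
  ultimately show ?thesis unfolding avg2_eq_sum power_divide
    using c by (simp add: divide_right_mono)
qed

section \<open>Signed differences along a pairing\<close>

text \<open>The group law of the cube of subsets; \<open>tau\<close> turns it into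
  composition.\<close>

definition sd :: "'a set \<Rightarrow> 'a set \<Rightarrow> 'a set" where
  "sd T U = (T - U) \<union> (U - T)"

lemma sum_Pow_sd: "U \<subseteq> K \<Longrightarrow> (\<Sum>T\<in>Pow K. g (sd T U)) = (\<Sum>T\<in>Pow K. g T)"
  by (rule sum.reindex_bij_witness[where i = "\<lambda>T. sd T U" and j = "\<lambda>T. sd T U"])
     (auto simp: sd_def intro!: arg_cong[where f = g])

lemma parity_sd:
  assumes "finite T" "finite U"
  shows "(-1::real) ^ card (sd T U) = (-1) ^ card T * (-1) ^ card U"
proof -
  have "card T = card (T - U) + card (T \<inter> U)" "card U = card (U - T) + card (T \<inter> U)"
    using assms by (metis card_Int_Diff inf_commute add.commute)+
  moreover have "card (sd T U) = card (T - U) + card (U - T)"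
    unfolding sd_def using assms by (intro card_Un_disjoint) auto
  ultimately show ?thesis
    by (simp add: power_add mult.commute mult.left_commute flip: power_mult_distrib)
qed

text \<open>The signs combine to the parity of \<open>sd T U\<close>, and for fixed \<open>U\<close>
  the shift permutes \<open>Pow K\<close>; so every \<open>U\<close> contributes the same.\<close>

lemma sum_Pow_sd_parity:
  assumes "finite K"
  shows "(\<Sum>U\<in>Pow K. \<Sum>T\<in>Pow K. (-1) ^ card T * (-1) ^ card U * g (sd T U))
       = 2 ^ card K * (\<Sum>T\<in>Pow K. (-1::real) ^ card T * g T)"
proof -
  have "(\<Sum>T\<in>Pow K. (-1) ^ card T * (-1) ^ card U * g (sd T U)) = (\<Sum>T\<in>Pow K. (-1) ^ card T * g T)"
    if "U \<in> Pow K" for U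
  proof -
    have "(\<Sum>T\<in>Pow K. (-1) ^ card T * (-1) ^ card U * g (sd T U)) = (\<Sum>T\<in>Pow K. (-1) ^ card (sd T U) * g (sd T U))"
    proof (rule sum.cong[OF refl])
      fix T assume "T \<in> Pow K"
      then have "finite T" "finite U" using that assms finite_subset by auto
      then show "(-1) ^ card T * (-1) ^ card U * g (sd T U) = (-1) ^ card (sd T U) * g (sd T U)"
        by (simp add: parity_sd)
    qed
    also have "\<dots> = (\<Sum>T\<in>Pow K. (-1) ^ card T * g T)"
      using sum_Pow_sd[of U K "\<lambda>T. (-1) ^ card T * g T"] that by simp
    finally show ?thesis .
  qed
  then show ?thesis using assms by (simp add: card_Pow)
qed

lemma sum_Pow_split:
  assumes "finite K" "S \<subseteq> K"
  shows "(\<Sum>T\<in>Pow K. g T) = (\<Sum>T\<in>Pow S. \<Sum>T'\<in>Pow (K - S). g (T \<union> T'))"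
proof -
  have "(\<Sum>T\<in>Pow S. \<Sum>T'\<in>Pow (K - S). g (T \<union> T')) = (\<Sum>(T, T')\<in>Pow S \<times> Pow (K - S). g (T \<union> T'))"
    by (rule sum.cartesian_product)
  also have "\<dots> = (\<Sum>T\<in>Pow K. g T)"
    by (rule sum.reindex_bij_witness[where i = "\<lambda>T. (T \<inter> S, T - S)" and j = "\<lambda>(T, T'). T \<union> T'"])
       (use assms in \<open>auto intro!: arg_cong[where f = g]\<close>)
  finally show ?thesis ..
qed

section \<open>Commuting transpositions of paired points and differences along them\<close>

locale pairing =
  fixes \<theta> :: "'a \<Rightarrow> 'a"
  assumes \<theta>\<theta> [simp]: "\<theta> (\<theta> x) = x"
begin

text \<open>Disjointness also excludes fixed points of \<open>\<theta>\<close> from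
  \<open>B\<close>.\<close>

definition paired :: "'a set \<Rightarrow> 'a set \<Rightarrow> bool" where
  "paired X B \<longleftrightarrow> B \<union> \<theta> ` B \<subseteq> X \<and> B \<inter> \<theta> ` B = {}"

text \<open>The product of the transpositions of \<open>x\<close> and \<open>\<theta> x\<close> over
  \<open>x \<in> T\<close>, which are disjoint for \<open>T\<close> inside a paired set.\<close>

definition tau :: "'a set \<Rightarrow> 'a \<Rightarrow> 'a" where
  "tau T x = (if x \<in> T \<or> \<theta> x \<in> T then \<theta> x else x)"

text \<open>For permutations \<open>z\<close>, \<open>w\<close> of \<open>X\<close> the average runs
  over all permutations of \<open>X\<close> that take the preimage of \<open>k\<close> under
  \<open>z\<close> to \<open>w k\<close> for each \<open>k \<in> K\<close>. The two parameters allow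
  independent translations on both sides.\<close>

definition coset_avg :: "'a set \<Rightarrow> 'a set \<Rightarrow> (('a \<Rightarrow> 'a) \<Rightarrow> real) \<Rightarrow> ('a \<Rightarrow> 'a) \<Rightarrow> ('a \<Rightarrow> 'a) \<Rightarrow> real" where
  "coset_avg X K f z w = avg (perms (X - K)) (\<lambda>\<alpha>. f (w \<circ> \<alpha> \<circ> z))"

text \<open>The involutions \<open>tau T\<close> span a cube, on which \<open>diff X K f\<close> is proportional to the character of \<open>K\<close>
  in both variables; so the \<open>diff X K f\<close> for different \<open>K\<close> are the terms of a Fourier expansion.\<close>

definition diff :: "'a set \<Rightarrow> 'a set \<Rightarrow> (('a \<Rightarrow> 'a) \<Rightarrow> real) \<Rightarrow> ('a \<Rightarrow> 'a) \<Rightarrow> ('a \<Rightarrow> 'a) \<Rightarrow> real" where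
  "diff X K f z w = (\<Sum>T\<in>Pow K. \<Sum>U\<in>Pow K. (-1) ^ card T * (-1) ^ card U * coset_avg X K f (tau T \<circ> z) (w \<circ> tau U))"

lemma theta_image_iff [simp]: "x \<in> \<theta> ` A \<longleftrightarrow> \<theta> x \<in> A"
  by (metis \<theta>\<theta> image_iff)

lemma paired_mem: "paired X B \<Longrightarrow> x \<in> B \<Longrightarrow> x \<in> X" "paired X B \<Longrightarrow> x \<in> B \<Longrightarrow> \<theta> x \<in> X"
  unfolding paired_def by blast+

lemma paired_mono: "paired X B \<Longrightarrow> K \<subseteq> B \<Longrightarrow> paired X K"
  unfolding paired_def by blast

lemma paired_not_both: "paired X B \<Longrightarrow> x \<in> B \<Longrightarrow> \<theta> x \<notin> B"
  unfolding paired_def by blast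

lemma tau_permutes_self: "tau T permutes (T \<union> \<theta> ` T)"
proof (rule bij_imp_permutes)
  have inv: "tau T (tau T x) = x" for x by (simp add: tau_def)
  have "tau T x \<in> T \<union> \<theta> ` T" if "x \<in> T \<union> \<theta> ` T" for x using that by (auto simp: tau_def)
  then show "bij_betw (tau T) (T \<union> \<theta> ` T) (T \<union> \<theta> ` T)"
    by (intro bij_betwI[where g = "tau T"]) (auto simp: inv)
  show "tau T x = x" if "x \<notin> T \<union> \<theta> ` T" for x using that unfolding tau_def by (metis UnCI \<theta>\<theta> image_eqI)
qed

lemma tau_permutes: "T \<union> \<theta> ` T \<subseteq> X \<Longrightarrow> tau T permutes X"
  using tau_permutes_self permutes_subset by blast

lemma paired_tau_permutes: "paired X B \<Longrightarrow> T \<subseteq> B \<Longrightarrow> tau T permutes X"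
  by (rule tau_permutes) (auto simp: paired_def)

lemma tau_comp:
  assumes "paired X B" "T \<subseteq> B" "U \<subseteq> B"
  shows "tau T \<circ> tau U = tau (sd T U)"
proof
  fix x
  have nb: "y \<in> B \<Longrightarrow> \<theta> y \<notin> B" for y using paired_not_both[OF assms(1)] .
  consider "x \<in> B" "\<theta> x \<notin> B" | "x \<notin> B" "\<theta> x \<in> B" | "x \<notin> B" "\<theta> x \<notin> B" using nb by blast
  then show "(tau T \<circ> tau U) x = tau (sd T U) x"
    by cases (use assms(2,3) in \<open>auto simp: tau_def sd_def\<close>)
qed

lemma tau_disjoint_comp:
  assumes "paired X B" "T \<subseteq> B" "U \<subseteq> B" "T \<inter> U = {}"
  shows "tau T \<circ> tau U = tau (T \<union> U)"
proof -
  have "sd T U = T \<union> U" using assms(4) by (auto simp: sd_def)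
  then show ?thesis using tau_comp[OF assms(1-3)] by simp
qed

lemma tau_self: "tau T \<circ> tau T = id"
  by (auto simp: fun_eq_iff tau_def)

lemma tau_commute:
  assumes "\<beta> permutes Z" "Z \<inter> (T \<union> \<theta> ` T) = {}"
  shows "\<beta> \<circ> tau T = tau T \<circ> \<beta>"
  using permutes_disjoint_commute[OF assms(1) tau_permutes_self assms(2)] .

lemma coset_avg_right: "\<beta> permutes X - K \<Longrightarrow> coset_avg X K f z (w \<circ> \<beta>) = coset_avg X K f z w"
  unfolding coset_avg_def using avg_perms_left[of \<beta> "X - K" "\<lambda>\<alpha>. f (w \<circ> \<alpha> \<circ> z)"] by (simp add: comp_assoc)

lemma coset_avg_left: "\<beta> permutes X - K \<Longrightarrow> coset_avg X K f (\<beta> \<circ> z) w = coset_avg X K f z w"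
  unfolding coset_avg_def using avg_perms_right[of \<beta> "X - K" "\<lambda>\<alpha>. f (w \<circ> \<alpha> \<circ> z)"] by (simp add: comp_assoc)

text \<open>A permutation fixing both points of each pair of \<open>K\<close> commutes with every
  \<open>tau U\<close> and is then absorbed by the coset average.\<close>

lemma diff_right_invariant:
  assumes "\<beta> permutes X - (K \<union> \<theta> ` K)"
  shows "diff X K f z (w \<circ> \<beta>) = diff X K f z w"
proof -
  have "coset_avg X K f z' (w \<circ> \<beta> \<circ> tau U) = coset_avg X K f z' (w \<circ> tau U)" if "U \<in> Pow K" for U z'
  proof -
    have "w \<circ> \<beta> \<circ> tau U = w \<circ> tau U \<circ> \<beta>"
      using tau_commute[OF assms] that by (subst comp_assoc, subst tau_commute[OF assms]) (auto simp: comp_assoc)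
    moreover have "\<beta> permutes X - K" using permutes_subset[OF assms] by auto
    ultimately show ?thesis by (simp add: coset_avg_right)
  qed
  then show ?thesis unfolding diff_def by (intro sum.cong refl) auto
qed

lemma diff_left_invariant:
  assumes "\<beta> permutes X - (K \<union> \<theta> ` K)"
  shows "diff X K f (\<beta> \<circ> z) w = diff X K f z w"
proof -
  have "coset_avg X K f (tau U \<circ> (\<beta> \<circ> z)) w' = coset_avg X K f (tau U \<circ> z) w'" if "U \<in> Pow K" for U w'
  proof -
    have "tau U \<circ> (\<beta> \<circ> z) = \<beta> \<circ> (tau U \<circ> z)"
      using that by (subst (1 2) comp_assoc[symmetric], subst tau_commute[OF assms]) auto
    moreover have "\<beta> permutes X - K" using permutes_subset[OF assms] by auto
    ultimately show ?thesis by (simp add: coset_avg_left)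
  qed
  then show ?thesis unfolding diff_def by (intro sum.cong refl) auto
qed

lemma tau_permutes_diff:
  assumes B: "paired X B" and "V \<subseteq> B" "K \<subseteq> B" "V \<inter> K = {}"
  shows "tau V permutes X - (K \<union> \<theta> ` K)"
proof (rule tau_permutes, rule subsetI)
  fix y assume "y \<in> V \<union> \<theta> ` V"
  then have "y \<in> V \<or> \<theta> y \<in> V" by simp
  moreover have "y \<in> X - (K \<union> \<theta> ` K)" if "y \<in> V" for y
  proof -
    have "y \<in> B" "y \<notin> K" using that assms by auto
    then show ?thesis using paired_not_both[OF B, of y] paired_mem[OF B, of y] assms(3) by auto
  qed
  moreover have "y \<in> X - (K \<union> \<theta> ` K)" if "\<theta> y \<in> V"
  proof -
    have "\<theta> y \<in> B" "\<theta> y \<notin> K" using that assms by auto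
    then show ?thesis using paired_not_both[OF B, of "\<theta> y"] paired_mem[OF B, of "\<theta> y"] assms(3) by auto
  qed
  ultimately show "y \<in> X - (K \<union> \<theta> ` K)" by blast
qed

text \<open>The part of \<open>V\<close> outside \<open>K\<close> acts trivially by
  \<open>diff_right_invariant\<close>; the part inside \<open>K\<close> only shifts the summation
  over \<open>U\<close> and so changes all signs by a common factor.\<close>

lemma diff_tau:
  assumes B: "paired X B" and "finite B" "V \<subseteq> B" "K \<subseteq> B"
  shows "diff X K f z (w \<circ> tau V) = (-1) ^ card (V \<inter> K) * diff X K f z w"
proof -
  have fin: "finite U" if "U \<subseteq> B" for U using finite_subset[OF that assms(2)] .
  have "tau (V - K) permutes X - (K \<union> \<theta> ` K)"
    by (rule tau_permutes_diff[OF B]) (use assms in auto)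
  moreover have "w \<circ> tau V = w \<circ> tau (V \<inter> K) \<circ> tau (V - K)"
  proof -
    have "V \<inter> K \<union> (V - K) = V" by blast
    moreover have "V \<inter> K \<subseteq> B" "V - K \<subseteq> B" "V \<inter> K \<inter> (V - K) = {}" using assms(3) by auto
    ultimately show ?thesis using tau_disjoint_comp[OF B, of "V \<inter> K" "V - K"] by (simp add: comp_assoc)
  qed
  ultimately have "diff X K f z (w \<circ> tau V) = diff X K f z (w \<circ> tau (V \<inter> K))"
    by (simp add: diff_right_invariant)
  also have "\<dots> = (\<Sum>T\<in>Pow K. (-1) ^ card T * (\<Sum>U\<in>Pow K. (-1) ^ card U * coset_avg X K f (tau T \<circ> z) (w \<circ> tau (sd U (V \<inter> K)))))"
  proof -
    have "w \<circ> tau (V \<inter> K) \<circ> tau U = w \<circ> tau (sd U (V \<inter> K))" if "U \<in> Pow K" for U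
    proof -
      have "sd (V \<inter> K) U = sd U (V \<inter> K)" by (auto simp: sd_def)
      moreover have "V \<inter> K \<subseteq> B" "U \<subseteq> B" using assms that by auto
      ultimately show ?thesis using tau_comp[OF B, of "V \<inter> K" U] by (simp add: comp_assoc)
    qed
    then show ?thesis unfolding diff_def by (simp add: sum_distrib_left mult.assoc)
  qed
  also have "\<dots> = (\<Sum>T\<in>Pow K. (-1) ^ card T * ((-1) ^ card (V \<inter> K) * (\<Sum>U\<in>Pow K. (-1) ^ card U * coset_avg X K f (tau T \<circ> z) (w \<circ> tau U))))"
  proof (intro sum.cong refl arg_cong2[where f = "(*)"])
    fix T
    let ?g = "\<lambda>U. coset_avg X K f (tau T \<circ> z) (w \<circ> tau U)"
    have "(\<Sum>U\<in>Pow K. (-1) ^ card U * ?g (sd U (V \<inter> K)))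
       = (\<Sum>U\<in>Pow K. (-1) ^ card (V \<inter> K) * ((-1) ^ card (sd U (V \<inter> K)) * ?g (sd U (V \<inter> K))))"
    proof (rule sum.cong[OF refl])
      fix U assume "U \<in> Pow K"
      then have "finite U" "finite (V \<inter> K)" using fin assms by auto
      then have "(-1) ^ card (V \<inter> K) * (-1) ^ card (sd U (V \<inter> K)) = (-1::real) ^ card U"
        by (simp add: parity_sd mult.left_commute flip: power_mult_distrib)
      then show "(-1) ^ card U * ?g (sd U (V \<inter> K)) = (-1) ^ card (V \<inter> K) * ((-1) ^ card (sd U (V \<inter> K)) * ?g (sd U (V \<inter> K)))"
        by (metis mult.assoc)
    qed
    also have "\<dots> = (-1) ^ card (V \<inter> K) * (\<Sum>U\<in>Pow K. (-1) ^ card U * ?g U)"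
      unfolding sum_distrib_left[symmetric]
      by (subst sum_Pow_sd[where g = "\<lambda>U. (-1) ^ card U * ?g U"]) auto
    finally show "(\<Sum>U\<in>Pow K. (-1) ^ card U * ?g (sd U (V \<inter> K))) = (-1) ^ card (V \<inter> K) * (\<Sum>U\<in>Pow K. (-1) ^ card U * ?g U)" .
  qed
  also have "\<dots> = (-1) ^ card (V \<inter> K) * diff X K f z w"
    unfolding diff_def by (simp add: sum_distrib_left mult_ac)
  finally show ?thesis .
qed

text \<open>Let \<open>N\<close> be the signed sum over \<open>T\<close> alone. Coset averaging is
  an orthogonal projection, so the correlation of \<open>f\<close> with the difference and the
  energy of \<open>N\<close> equal the same signed sum of the correlations \<open>a T\<close>.
  Passing from \<open>N\<close> to the difference by the sum over \<open>U\<close> costs 4 ^ card K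
  by Cauchy-Schwarz.\<close>

lemma avg_diff_sq_le_correlation:
  assumes X: "finite X" and K: "paired X K"
  shows "avg2 X (\<lambda>z w. (diff X K f z w)\<^sup>2) \<le> 4 ^ card K * avg2 X (\<lambda>z w. f (w \<circ> z) * diff X K f z w)"
proof -
  let ?M = "coset_avg X K f"
  define N where "N z w = (\<Sum>T\<in>Pow K. (-1) ^ card T * ?M (tau T \<circ> z) w)" for z w
  define a where "a T = avg2 X (\<lambda>z w. f (w \<circ> z) * ?M (tau T \<circ> z) w)" for T
  have finK: "finite K" using K X finite_subset unfolding paired_def by blast
  have tp: "tau T permutes X" if "T \<in> Pow K" for T using paired_tau_permutes[OF K] that by auto
  have b: "avg2 X (\<lambda>z w. ?M z w * ?M (tau T \<circ> z) w) = a T" for T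
  proof -
    have "a T = avg (perms X) (\<lambda>z. avg (perms X) (\<lambda>w. avg (perms (X - K)) (\<lambda>\<alpha>. f (w \<circ> \<alpha> \<circ> z) * ?M (tau T \<circ> z) (w \<circ> \<alpha>))))"
      unfolding a_def avg2_def
      by (rule avg_cong, rule avg_perms_subgroup_right[OF X, of "X - K" "\<lambda>w. f (w \<circ> _) * ?M (tau T \<circ> _) w", symmetric]) auto
    also have "\<dots> = avg (perms X) (\<lambda>z. avg (perms X) (\<lambda>w. ?M z w * ?M (tau T \<circ> z) w))"
    proof (intro avg_cong)
      fix z w
      have "avg (perms (X - K)) (\<lambda>\<alpha>. f (w \<circ> \<alpha> \<circ> z) * ?M (tau T \<circ> z) (w \<circ> \<alpha>))
          = avg (perms (X - K)) (\<lambda>\<alpha>. f (w \<circ> \<alpha> \<circ> z) * ?M (tau T \<circ> z) w)"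
        by (rule avg_cong) (simp add: coset_avg_right)
      then show "avg (perms (X - K)) (\<lambda>\<alpha>. f (w \<circ> \<alpha> \<circ> z) * ?M (tau T \<circ> z) (w \<circ> \<alpha>)) = ?M z w * ?M (tau T \<circ> z) w"
        by (simp add: avg_cmult_right coset_avg_def)
    qed
    finally show ?thesis unfolding avg2_def by simp
  qed
  have corr: "avg2 X (\<lambda>z w. f (w \<circ> z) * diff X K f z w) = 2 ^ card K * (\<Sum>T\<in>Pow K. (-1) ^ card T * a T)"
  proof -
    have "avg2 X (\<lambda>z w. f (w \<circ> z) * ?M (tau T \<circ> z) (w \<circ> tau U)) = a (sd T U)" if TU: "T \<in> Pow K" "U \<in> Pow K" for T U
    proof -
      have e: "tau (sd T U) \<circ> (tau U \<circ> z) = tau T \<circ> z" "w \<circ> tau U \<circ> (tau U \<circ> z) = w \<circ> z" for z w :: "'a \<Rightarrow> 'a"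
        using tau_comp[OF K, of T U] TU tau_self[of U]
        by (auto simp: comp_assoc) (metis comp_assoc id_comp)+
      show ?thesis
        unfolding a_def
        by (subst avg2_translate[OF tp[OF TU(2)] tp[OF TU(2)], symmetric]) (simp only: e)
    qed
    then have "avg2 X (\<lambda>z w. f (w \<circ> z) * diff X K f z w)
       = (\<Sum>T\<in>Pow K. \<Sum>U\<in>Pow K. (-1) ^ card T * (-1) ^ card U * a (sd T U))"
      unfolding diff_def sum_distrib_left avg2_sum
      by (intro sum.cong refl) (simp only: mult.left_commute[of "f _"] avg2_cmult)
    also have "\<dots> = (\<Sum>U\<in>Pow K. \<Sum>T\<in>Pow K. (-1) ^ card T * (-1) ^ card U * a (sd T U))" by (rule sum.swap)
    finally show ?thesis using sum_Pow_sd_parity[OF finK, of a] by simp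
  qed
  have energy: "avg2 X (\<lambda>z w. (N z w)\<^sup>2) = 2 ^ card K * (\<Sum>T\<in>Pow K. (-1) ^ card T * a T)"
  proof -
    have e1: "avg2 X (\<lambda>z w. ?M (tau T \<circ> z) w * ?M (tau U \<circ> z) w) = a (sd T U)" if TU: "T \<in> Pow K" "U \<in> Pow K" for T U
    proof -
      have e: "tau (sd T U) \<circ> (tau U \<circ> z) = tau T \<circ> z" for z :: "'a \<Rightarrow> 'a"
        using tau_comp[OF K, of T U] TU tau_self[of U]
        by (auto simp: comp_assoc) (metis comp_assoc id_comp)+
      show ?thesis
        unfolding b[symmetric]
        by (subst avg2_translate[OF tp[OF TU(2)] permutes_id, symmetric]) (simp add: e mult.commute)
    qed
    have "avg2 X (\<lambda>z w. (N z w)\<^sup>2) = avg2 X (\<lambda>z w. \<Sum>U\<in>Pow K. \<Sum>T\<in>Pow K. (-1) ^ card T * (-1) ^ card U * (?M (tau T \<circ> z) w * ?M (tau U \<circ> z) w))"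
      unfolding N_def power2_eq_square sum_product by (subst sum.swap) (simp add: mult_ac)
    also have "\<dots> = (\<Sum>U\<in>Pow K. \<Sum>T\<in>Pow K. (-1) ^ card T * (-1) ^ card U * a (sd T U))"
      unfolding avg2_sum by (intro sum.cong refl) (simp add: avg2_cmult e1)
    finally show ?thesis using sum_Pow_sd_parity[OF finK, of a] by simp
  qed
  have "(diff X K f z w)\<^sup>2 \<le> 2 ^ card K * (\<Sum>U\<in>Pow K. (N z (w \<circ> tau U))\<^sup>2)" for z w
  proof -
    have "diff X K f z w = (\<Sum>U\<in>Pow K. (-1) ^ card U * N z (w \<circ> tau U))"
      unfolding diff_def N_def by (subst sum.swap) (simp add: sum_distrib_left mult_ac)
    then have "(diff X K f z w)\<^sup>2 \<le> (\<Sum>U\<in>Pow K. ((-1) ^ card U * N z (w \<circ> tau U))\<^sup>2) * card (Pow K)"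
      using sum_squared_le_sum_of_squares[of "\<lambda>U. (-1) ^ card U * N z (w \<circ> tau U)" "Pow K"] by simp
    then show ?thesis using finK by (simp add: power_mult_distrib card_Pow mult.commute flip: power_mult)
  qed
  then have "avg2 X (\<lambda>z w. (diff X K f z w)\<^sup>2) \<le> avg2 X (\<lambda>z w. 2 ^ card K * (\<Sum>U\<in>Pow K. (N z (w \<circ> tau U))\<^sup>2))"
    by (intro avg2_mono)
  also have "\<dots> = 2 ^ card K * (\<Sum>U\<in>Pow K. avg2 X (\<lambda>z w. (N z w)\<^sup>2))"
  proof -
    have "avg2 X (\<lambda>z w. (N z (w \<circ> tau U))\<^sup>2) = avg2 X (\<lambda>z w. (N z w)\<^sup>2)" if "U \<in> Pow K" for U
      using avg2_translate[OF permutes_id tp[OF that], of "\<lambda>z w. (N z w)\<^sup>2"] by simp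
    then show ?thesis by (simp add: avg2_cmult avg2_sum)
  qed
  also have "\<dots> = 4 ^ card K * avg2 X (\<lambda>z w. f (w \<circ> z) * diff X K f z w)"
    unfolding corr energy using finK by (simp add: card_Pow flip: power_mult_distrib)
  finally show ?thesis .
qed

text \<open>A bijection of \<open>B\<close> carrying \<open>K\<close> to \<open>K'\<close> extends
  to a permutation \<open>\<kappa>\<close> of \<open>X\<close> that commutes with
  \<open>\<theta>\<close>. Conjugation by it turns one difference into the other, and the average
  over all pairs absorbs the translations.\<close>

lemma diff_relabel:
  assumes X: "finite X" and B: "paired X B" and "K \<subseteq> B" "K' \<subseteq> B" "card K = card K'"
  shows "avg2 X (\<lambda>z w. (diff X K' f z w)\<^sup>2) = avg2 X (\<lambda>z w. (diff X K f z w)\<^sup>2)"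
proof -
  have finB: "finite B" using B X finite_subset unfolding paired_def by blast
  then have fin: "finite K" "finite K'" using assms finite_subset by blast+
  obtain g where g: "bij_betw g K K'" using finite_same_card_bij[OF fin assms(5)] by blast
  have "card (B - K) = card (B - K')" using assms fin finB by (simp add: card_Diff_subset)
  then obtain h where h: "bij_betw h (B - K) (B - K')"
    using finite_same_card_bij[of "B - K" "B - K'"] finB by blast
  define \<pi> where "\<pi> x = (if x \<in> K then g x else h x)" for x
  have "bij_betw \<pi> (K \<union> (B - K)) (K' \<union> (B - K'))"
  proof (rule bij_betw_combine)
    show "bij_betw \<pi> K K'" using g by (subst bij_betw_cong[of _ _ g]) (auto simp: \<pi>_def)
    show "bij_betw \<pi> (B - K) (B - K')" using h by (subst bij_betw_cong[of _ _ h]) (auto simp: \<pi>_def)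
  qed auto
  then have \<pi>: "bij_betw \<pi> B B" using assms by (simp add: Un_absorb1 Un_Diff_cancel)
  have \<pi>K: "\<pi> ` K = K'" using g by (auto simp: \<pi>_def bij_betw_def)
  define \<kappa> where "\<kappa> x = (if x \<in> B then \<pi> x else if \<theta> x \<in> B then \<theta> (\<pi> (\<theta> x)) else x)" for x
  have \<pi>B: "\<pi> x \<in> B" if "x \<in> B" for x using \<pi> that by (auto simp: bij_betw_def)
  have nb: "\<theta> x \<notin> B" if "x \<in> B" for x using paired_not_both[OF B that] .
  have \<kappa>\<theta>: "\<kappa> (\<theta> x) = \<theta> (\<kappa> x)" for x
    using nb[of x] by (auto simp: \<kappa>_def)
  have \<kappa>B: "\<kappa> x \<in> B \<longleftrightarrow> x \<in> B" for x
    using nb \<pi>B by (auto simp: \<kappa>_def)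
  have "inj \<kappa>"
  proof (rule injI)
    fix x y assume eq: "\<kappa> x = \<kappa> y"
    have inj: "x' = y'" if "x' \<in> B" "y' \<in> B" "\<pi> x' = \<pi> y'" for x' y'
      using \<pi> that by (auto simp: bij_betw_def inj_on_def)
    have xy: "x \<in> B \<longleftrightarrow> y \<in> B" using \<kappa>B eq by metis
    have xy': "\<theta> x \<in> B \<longleftrightarrow> \<theta> y \<in> B" using \<kappa>B[of "\<theta> x"] \<kappa>B[of "\<theta> y"] eq by (simp add: \<kappa>\<theta>)
    show "x = y"
    proof (cases "x \<in> B")
      case True then show ?thesis using inj eq xy by (simp add: \<kappa>_def)
    next
      case False
      show ?thesis
      proof (cases "\<theta> x \<in> B")
        case True
        then have "\<theta> (\<pi> (\<theta> x)) = \<theta> (\<pi> (\<theta> y))" using eq False xy xy' by (simp add: \<kappa>_def)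
        then have "\<pi> (\<theta> x) = \<pi> (\<theta> y)" by (metis \<theta>\<theta>)
        then have "\<theta> x = \<theta> y" using inj True xy' by blast
        then show ?thesis by (metis \<theta>\<theta>)
      qed (use eq False xy xy' in \<open>simp add: \<kappa>_def\<close>)
    qed
  qed
  moreover have "\<kappa> x \<in> X" if "x \<in> X" for x
    using that \<pi>B paired_mem[OF B] by (auto simp: \<kappa>_def)
  moreover have "\<kappa> x = x" if "x \<notin> X" for x
    using that paired_mem[OF B, of x] paired_mem[OF B, of "\<theta> x"] by (auto simp: \<kappa>_def)
  ultimately have \<kappa>: "\<kappa> permutes X"
    by (intro inj_imp_permutes X) (auto intro: inj_on_subset)
  have \<kappa>K: "\<kappa> ` T = \<pi> ` T" if "T \<subseteq> B" for T using that by (auto simp: \<kappa>_def image_iff)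
  have \<kappa>tau: "\<kappa> \<circ> tau T = tau (\<kappa> ` T) \<circ> \<kappa>" for T
  proof
    fix x
    have "\<kappa> y \<in> \<kappa> ` T \<longleftrightarrow> y \<in> T" for y using \<open>inj \<kappa>\<close> by (simp add: inj_image_mem_iff)
    then show "(\<kappa> \<circ> tau T) x = (tau (\<kappa> ` T) \<circ> \<kappa>) x"
      by (simp add: tau_def \<kappa>\<theta>[symmetric])
  qed
  have M: "coset_avg X K' f z w = coset_avg X K f (inv' \<kappa> \<circ> z) (w \<circ> \<kappa>)" for z w
  proof -
    have bij: "bij_betw (\<lambda>\<alpha>. \<kappa> \<circ> \<alpha> \<circ> inv' \<kappa>) (perms (X - K)) (perms (X - K'))"
    proof (rule bij_betwI[where g = "\<lambda>\<alpha>. inv' \<kappa> \<circ> \<alpha> \<circ> \<kappa>"])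
      have conj: "\<kappa>1 \<circ> \<alpha> \<circ> inv' \<kappa>1 permutes X - \<kappa>1 ` L" if "\<alpha> permutes X - L" "\<kappa>1 permutes X" for \<kappa>1 \<alpha> L
      proof (rule permutes_superset[where S = X])
        show "\<kappa>1 \<circ> \<alpha> \<circ> inv' \<kappa>1 permutes X"
          using that permutes_subset[OF that(1)] by (intro permutes_compose permutes_inv) auto
        show "(\<kappa>1 \<circ> \<alpha> \<circ> inv' \<kappa>1) x = x" if "x \<in> X - (X - \<kappa>1 ` L)" for x
        proof -
          have "inv' \<kappa>1 x \<in> L" using that permutes_inverses[OF \<open>\<kappa>1 permutes X\<close>] by auto
          then show ?thesis using permutes_not_in[OF \<open>\<alpha> permutes X - L\<close>] permutes_inverses[OF \<open>\<kappa>1 permutes X\<close>] by auto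
        qed
      qed
      have K'_eq: "\<kappa> ` K = K'" using \<kappa>K[OF assms(3)] \<pi>K by simp
      moreover have "inv' \<kappa> ` K' = K" using image_inv_f_f[OF \<open>inj \<kappa>\<close>, of K] K'_eq by simp
      ultimately show "(\<lambda>\<alpha>. \<kappa> \<circ> \<alpha> \<circ> inv' \<kappa>) \<in> perms (X - K) \<rightarrow> perms (X - K')"
        "(\<lambda>\<alpha>. inv' \<kappa> \<circ> \<alpha> \<circ> \<kappa>) \<in> perms (X - K') \<rightarrow> perms (X - K)"
        using conj[OF _ \<kappa>, of _ K] conj[OF _ permutes_inv[OF \<kappa>], of _ K'] permutes_inv_inv[OF \<kappa>] by auto
    qed (use permutes_inv_o[OF \<kappa>] in \<open>auto simp: comp_assoc\<close>, (metis comp_assoc comp_id id_comp)+)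
    have "coset_avg X K' f z w = avg (perms (X - K)) (\<lambda>\<alpha>. f (w \<circ> (\<kappa> \<circ> \<alpha> \<circ> inv' \<kappa>) \<circ> z))"
      unfolding coset_avg_def avg_def
      using sum.reindex_bij_betw[OF bij, of "\<lambda>\<alpha>. f (w \<circ> \<alpha> \<circ> z)"] bij_betw_same_card[OF bij] by simp
    then show ?thesis unfolding coset_avg_def by (simp add: comp_assoc)
  qed
  have "diff X K' f z w = diff X K f (inv' \<kappa> \<circ> z) (w \<circ> \<kappa>)" for z w
  proof -
    have img: "Pow K' = (\<lambda>T. \<kappa> ` T) ` Pow K" using \<kappa>K[OF assms(3)] \<pi>K by (simp add: image_Pow_surj)
    have inj: "inj_on (\<lambda>T. \<kappa> ` T) (Pow K)" using \<open>inj \<kappa>\<close> by (auto simp: inj_on_def inj_image_eq_iff)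
    have c: "card (\<kappa> ` T) = card T" for T using \<open>inj \<kappa>\<close> by (simp add: card_image inj_on_subset)
    have e: "inv' \<kappa> \<circ> (tau (\<kappa> ` T) \<circ> z) = tau T \<circ> (inv' \<kappa> \<circ> z)" "w \<circ> tau (\<kappa> ` T) \<circ> \<kappa> = w \<circ> \<kappa> \<circ> tau T" for T
    proof -
      show "w \<circ> tau (\<kappa> ` T) \<circ> \<kappa> = w \<circ> \<kappa> \<circ> tau T" using \<kappa>tau[of T] by (simp add: comp_assoc)
      have "inv' \<kappa> \<circ> tau (\<kappa> ` T) = inv' \<kappa> \<circ> (tau (\<kappa> ` T) \<circ> \<kappa>) \<circ> inv' \<kappa>"
        using permutes_inv_o[OF \<kappa>] by (simp add: comp_assoc)
      also have "\<dots> = inv' \<kappa> \<circ> \<kappa> \<circ> (tau T \<circ> inv' \<kappa>)" unfolding \<kappa>tau[symmetric] by (simp add: comp_assoc)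
      finally show "inv' \<kappa> \<circ> (tau (\<kappa> ` T) \<circ> z) = tau T \<circ> (inv' \<kappa> \<circ> z)"
        using permutes_inv_o[OF \<kappa>] by (simp add: comp_assoc[symmetric])
    qed
    show ?thesis unfolding diff_def img sum.reindex[OF inj] M by (simp add: c e)
  qed
  then show ?thesis using avg2_translate[OF permutes_inv[OF \<kappa>] \<kappa>, of "\<lambda>z w. (diff X K f z w)\<^sup>2"] by simp
qed

text \<open>Subsets of \<open>K\<close> split into a part inside and a part outside
  \<open>S\<close>. The inner parts commute past \<open>\<alpha>\<close> and \<open>\<beta>\<close>
  and become translations of the function; what remains is a difference along \<open>K - S\<close>
  in the smaller group.\<close>

lemma diff_restrict:
  assumes B: "paired X B" and "finite B" and K: "K \<subseteq> B" and S: "S \<subseteq> K"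
    and \<alpha>: "\<alpha> permutes X - (S \<union> \<theta> ` S)" and \<beta>: "\<beta> permutes X - (S \<union> \<theta> ` S)"
  shows "diff X K f (\<alpha> \<circ> z) (w \<circ> \<beta>)
    = (\<Sum>T\<in>Pow S. \<Sum>U\<in>Pow S. (-1) ^ card T * (-1) ^ card U *
        diff (X - S) (K - S) (\<lambda>y. f (w \<circ> tau U \<circ> y \<circ> tau T \<circ> z)) \<alpha> \<beta>)"
proof -
  have finK: "finite K" using K assms(2) finite_subset by blast
  let ?c = "\<lambda>T. (-1::real) ^ card T"
  let ?G = "\<lambda>T U T' U'. coset_avg (X - S) (K - S) (\<lambda>y. f (w \<circ> tau U \<circ> y \<circ> tau T \<circ> z)) (tau T' \<circ> \<alpha>) (\<beta> \<circ> tau U')"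
  have card: "card (T \<union> T') = card T + card T'" if "T \<in> Pow S" "T' \<in> Pow (K - S)" for T T'
    using that S finK by (intro card_Un_disjoint) (auto intro: finite_subset)
  have M: "coset_avg X K f (tau (T \<union> T') \<circ> (\<alpha> \<circ> z)) (w \<circ> \<beta> \<circ> tau (U \<union> U')) = ?G T U T' U'"
    if T: "T \<in> Pow S" "T' \<in> Pow (K - S)" and U: "U \<in> Pow S" "U' \<in> Pow (K - S)" for T T' U U'
  proof -
    have 1: "tau T' \<circ> tau T = tau (T \<union> T')"
      using tau_disjoint_comp[OF B, of T' T] T S K by (auto simp: Un_commute)
    have 2: "tau U \<circ> tau U' = tau (U \<union> U')"
      using tau_disjoint_comp[OF B, of U U'] U S K by auto
    have "(X - (S \<union> \<theta> ` S)) \<inter> (V \<union> \<theta> ` V) = {}" if "V \<in> Pow S" for V using that by auto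
    note commute = tau_commute[OF \<alpha> this[OF T(1)]] tau_commute[OF \<beta> this[OF U(1)]]
    have "tau T \<circ> \<alpha> = \<alpha> \<circ> tau T" using commute by simp
    then have 3: "tau T \<circ> (\<alpha> \<circ> x) = \<alpha> \<circ> (tau T \<circ> x)" for x :: "'a \<Rightarrow> 'a" by (metis comp_assoc)
    have "\<beta> \<circ> tau U = tau U \<circ> \<beta>" using commute by simp
    then have 4: "\<beta> \<circ> (tau U \<circ> x) = tau U \<circ> (\<beta> \<circ> x)" for x :: "'a \<Rightarrow> 'a" by (metis comp_assoc)
    have "X - S - (K - S) = X - K" using S by auto
    then show ?thesis unfolding coset_avg_def by (simp add: comp_assoc 3 4 flip: 1 2)
  qed
  have "diff X K f (\<alpha> \<circ> z) (w \<circ> \<beta>)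
     = (\<Sum>T\<in>Pow S. \<Sum>T'\<in>Pow (K - S). \<Sum>U\<in>Pow S. \<Sum>U'\<in>Pow (K - S). ?c T * ?c U * (?c T' * ?c U' * ?G T U T' U'))"
    unfolding diff_def sum_Pow_split[OF finK S]
    by (intro sum.cong refl) (simp add: card M power_add mult_ac)
  also have "\<dots> = (\<Sum>T\<in>Pow S. \<Sum>U\<in>Pow S. \<Sum>T'\<in>Pow (K - S). \<Sum>U'\<in>Pow (K - S). ?c T * ?c U * (?c T' * ?c U' * ?G T U T' U'))"
    by (intro sum.cong refl sum.swap)
  finally show ?thesis unfolding diff_def by (simp add: sum_distrib_left)
qed

end

section \<open>The level inequality\<close>

text \<open>Globalness in the mean instead of the 2-norm, which for indicators only squares the
  constant. The permutations \<open>a\<close>, \<open>b\<close> replace the two tuples, in line with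
  \<open>coset_avg\<close>.\<close>

definition globally_bounded :: "'a set \<Rightarrow> real \<Rightarrow> real \<Rightarrow> (('a \<Rightarrow> 'a) \<Rightarrow> real) \<Rightarrow> bool" where
  "globally_bounded X R \<mu> f \<longleftrightarrow>
    (\<forall>S a b. S \<subseteq> X \<longrightarrow> a permutes X \<longrightarrow> b permutes X \<longrightarrow>
       avg (perms (X - S)) (\<lambda>y. f (a \<circ> y \<circ> b)) \<le> R ^ card S * \<mu>)"

section \<open>Random subsets of given size meeting a fixed set\<close>

lemma sum_Pow_power_card: "finite U \<Longrightarrow> (\<Sum>S\<in>Pow U. x ^ card S) = (1 + x :: real) ^ card U"
proof (induction U rule: finite_induct)
  case (insert a U)
  have "card (insert a S) = Suc (card S)" if "S \<in> Pow U" for S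
    using that insert.hyps finite_subset by (subst card_insert_disjoint) auto
  then show ?case using insert by (simp add: sum_Pow_insert sum.distrib algebra_simps flip: sum_distrib_left)
qed simp

text \<open>A random \<open>d\<close>-subset of an \<open>m\<close>-set contains \<open>s\<close>
  given points with probability at most (d/m)^s, here with the denominators cleared.\<close>

lemma binomial_minus_le:
  "s \<le> d \<Longrightarrow> d \<le> m \<Longrightarrow> ((m - s) choose (d - s)) * m ^ s \<le> (m choose d) * d ^ s"
proof (induction s)
  case (Suc s)
  let ?a = "m - s" and ?b = "d - s"
  have e: "?a * ((m - Suc s) choose (d - Suc s)) = ?b * (?a choose ?b)"
    using binomial_absorption[of "?b - 1" ?a] Suc.prems by (simp add: Suc_diff_Suc)
  have "?b * m \<le> d * ?a"
    using Suc.prems by (simp add: diff_mult_distrib diff_mult_distrib2 mult.commute diff_le_mono2)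
  have "?a * (((m - Suc s) choose (d - Suc s)) * m ^ Suc s) = (?b * m) * ((?a choose ?b) * m ^ s)"
    using e by (simp add: mult_ac)
  also have "\<dots> \<le> (d * ?a) * ((m choose d) * d ^ s)"
    using mult_le_mono[OF \<open>?b * m \<le> d * ?a\<close>] Suc.IH Suc.prems by simp
  finally have "?a * (((m - Suc s) choose (d - Suc s)) * m ^ Suc s) \<le> ?a * ((m choose d) * d ^ Suc s)"
    by (simp add: mult_ac)
  then show ?case using Suc.prems by simp
qed simp

text \<open>The exponential moment of the size of the intersection is at most what independently
  chosen points would give: \<eta>^k \<le> (1+\<eta>)^k is a sum over subsets \<open>S\<close> of
  the intersection, and a random \<open>K\<close> contains \<open>S\<close> with probability at most
  (d/m)^|S|.\<close>

lemma sum_power_card_inter: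
  fixes \<eta> :: real
  assumes B: "finite B" and U: "U \<subseteq> B" and \<eta>: "0 \<le> \<eta>" and m: "d \<le> card B" "0 < card B"
  shows "(\<Sum>K\<in>{K. K \<subseteq> B \<and> card K = d}. \<eta> ^ card (K \<inter> U))
      \<le> real (card B choose d) * (1 + \<eta> * d / card B) ^ card U"
proof -
  let ?Ks = "{K. K \<subseteq> B \<and> card K = d}"
  have finU: "finite U" using finite_subset[OF U B] .
  have finK: "finite ?Ks" using B by auto
  have "(\<Sum>K\<in>?Ks. \<eta> ^ card (K \<inter> U)) \<le> (\<Sum>K\<in>?Ks. \<Sum>S\<in>Pow U. if S \<subseteq> K then \<eta> ^ card S else 0)"
  proof (rule sum_mono)
    fix K assume K: "K \<in> ?Ks"
    have "\<eta> ^ card (K \<inter> U) \<le> (1 + \<eta>) ^ card (K \<inter> U)" using \<eta> by (intro power_mono) auto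
    also have "\<dots> = (\<Sum>S\<in>Pow (K \<inter> U). \<eta> ^ card S)"
      using finU by (intro sum_Pow_power_card[symmetric]) auto
    also have "\<dots> = (\<Sum>S\<in>Pow U. if S \<subseteq> K then \<eta> ^ card S else 0)"
      using finU by (intro sum.mono_neutral_cong_left) auto
    finally show "\<eta> ^ card (K \<inter> U) \<le> (\<Sum>S\<in>Pow U. if S \<subseteq> K then \<eta> ^ card S else 0)" .
  qed
  also have "\<dots> = (\<Sum>S\<in>Pow U. \<Sum>K\<in>?Ks. if S \<subseteq> K then \<eta> ^ card S else 0)" by (rule sum.swap)
  also have "\<dots> \<le> (\<Sum>S\<in>Pow U. real (card B choose d) * (\<eta> * d / card B) ^ card S)"
  proof (rule sum_mono)
    fix S assume S: "S \<in> Pow U"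
    have finS: "finite S" and SB: "S \<subseteq> B" using S finU U finite_subset by auto
    have "(\<Sum>K\<in>?Ks. if S \<subseteq> K then \<eta> ^ card S else 0) = real (card {K \<in> ?Ks. S \<subseteq> K}) * \<eta> ^ card S"
      using finK by (subst sum.inter_filter[symmetric]) auto
    also have "\<dots> \<le> (real (card B choose d) * (d / card B) ^ card S) * \<eta> ^ card S"
    proof (intro mult_right_mono)
      show "real (card {K \<in> ?Ks. S \<subseteq> K}) \<le> real (card B choose d) * (d / card B) ^ card S"
      proof (cases "card S \<le> d")
        case True
        have "card {K \<in> ?Ks. S \<subseteq> K} = card {K. K \<subseteq> B - S \<and> card K = d - card S}"
        proof (rule bij_betw_same_card[OF bij_betwI[where f = "\<lambda>K. K - S" and g = "\<lambda>K. K \<union> S"]])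
          show "(\<lambda>K. K - S) \<in> {K \<in> ?Ks. S \<subseteq> K} \<rightarrow> {K. K \<subseteq> B - S \<and> card K = d - card S}"
            using finS by (auto simp: card_Diff_subset)
          have "card (K \<union> S) = card K + card S" if "K \<subseteq> B - S" for K
            using that finS B finite_subset[of K B] by (intro card_Un_disjoint) auto
          then show "(\<lambda>K. K \<union> S) \<in> {K. K \<subseteq> B - S \<and> card K = d - card S} \<rightarrow> {K \<in> ?Ks. S \<subseteq> K}"
            using SB True by auto
        qed auto
        also have "\<dots> = (card B - card S) choose (d - card S)"
          using B finS SB by (subst n_subsets) (auto simp: card_Diff_subset)
        finally have "card {K \<in> ?Ks. S \<subseteq> K} * card B ^ card S \<le> (card B choose d) * d ^ card S"
          using binomial_minus_le[OF True m(1)] by simp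
        then have "real (card {K \<in> ?Ks. S \<subseteq> K}) * real (card B) ^ card S \<le> real (card B choose d) * real d ^ card S"
          by (simp only: of_nat_le_iff flip: of_nat_mult of_nat_power)
        then have "real (card {K \<in> ?Ks. S \<subseteq> K}) \<le> real (card B choose d) * real d ^ card S / real (card B) ^ card S"
          using m(2) by (subst pos_le_divide_eq) auto
        then show ?thesis by (simp add: power_divide)
      next
        case False
        have "card S \<le> card K" if "K \<in> ?Ks" "S \<subseteq> K" for K
          using that B finite_subset[of K B] by (intro card_mono) auto
        then have "{K \<in> ?Ks. S \<subseteq> K} = {}" using False by fastforce
        then show ?thesis by (simp only: card.empty) simp
      qed
    qed (use \<eta> in auto)
    also have "\<dots> = real (card B choose d) * (\<eta> * d / card B) ^ card S"
      by (simp add: power_mult_distrib power_divide)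
    finally show "(\<Sum>K\<in>?Ks. if S \<subseteq> K then \<eta> ^ card S else 0) \<le> real (card B choose d) * (\<eta> * d / card B) ^ card S" .
  qed
  also have "\<dots> = real (card B choose d) * (1 + \<eta> * d / card B) ^ card U"
    using sum_Pow_power_card[OF finU, of "\<eta> * d / card B"] by (simp flip: sum_distrib_left)
  finally show ?thesis .
qed

section \<open>Moments of differences, expanded factor by factor\<close>

context pairing
begin

text \<open>Equivalently, \<open>\<Phi>\<close> depends on \<open>w\<close> and on the inverse of
  \<open>z\<close> only through their values on \<open>U\<close> and its partners.\<close>

definition inv_outside :: "'a set \<Rightarrow> 'a set \<Rightarrow> (('a \<Rightarrow> 'a) \<Rightarrow> ('a \<Rightarrow> 'a) \<Rightarrow> real) \<Rightarrow> bool" where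
  "inv_outside X U \<Phi> \<longleftrightarrow> (\<forall>\<gamma> z w. \<gamma> permutes X - (U \<union> \<theta> ` U) \<longrightarrow> z permutes X \<longrightarrow> w permutes X \<longrightarrow>
     \<Phi> (\<gamma> \<circ> z) w = \<Phi> z w \<and> \<Phi> z (w \<circ> \<gamma>) = \<Phi> z w)"

lemma inv_outside_diff: "inv_outside X K (\<lambda>z w. (diff X K f z w)\<^sup>2)"
  unfolding inv_outside_def by (simp add: diff_left_invariant diff_right_invariant)

lemma inv_outside_mult:
  assumes "inv_outside X U \<Phi>" "inv_outside X K \<Psi>"
  shows "inv_outside X (U \<union> K) (\<lambda>z w. \<Phi> z w * \<Psi> z w)"
proof -
  have "\<gamma> permutes X - (U \<union> \<theta> ` U)" "\<gamma> permutes X - (K \<union> \<theta> ` K)" if "\<gamma> permutes X - ((U \<union> K) \<union> \<theta> ` (U \<union> K))" for \<gamma>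
    by (rule permutes_subset[OF that], blast)+
  then show ?thesis using assms unfolding inv_outside_def by metis
qed

text \<open>Conditioning on the values at \<open>U\<close> and its partners, on which alone
  \<open>\<Phi>\<close> depends; \<open>E\<close> bounds every conditional average of
  \<open>H\<close>.\<close>

lemma avg2_weighted_le:
  assumes X: "finite X" and \<Phi>: "inv_outside X U \<Phi>"
    and \<Phi>0: "\<And>z w. z permutes X \<Longrightarrow> w permutes X \<Longrightarrow> 0 \<le> \<Phi> z w"
    and H: "\<And>z w. z permutes X \<Longrightarrow> w permutes X \<Longrightarrow>
       avg2 (X - (U \<union> \<theta> ` U)) (\<lambda>\<alpha> \<beta>. H (\<alpha> \<circ> z) (w \<circ> \<beta>)) \<le> E"
  shows "avg2 X (\<lambda>z w. \<Phi> z w * H z w) \<le> E * avg2 X \<Phi>"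
proof -
  let ?Z = "X - (U \<union> \<theta> ` U)"
  have "avg2 X (\<lambda>z w. \<Phi> z w * H z w)
     = avg (perms X) (\<lambda>z. avg (perms ?Z) (\<lambda>\<alpha>. avg (perms X) (\<lambda>w. avg (perms ?Z) (\<lambda>\<beta>. \<Phi> (\<alpha> \<circ> z) (w \<circ> \<beta>) * H (\<alpha> \<circ> z) (w \<circ> \<beta>)))))"
  proof -
    have 1: "avg (perms X) (\<lambda>w. avg (perms ?Z) (\<lambda>\<beta>. \<Phi> z (w \<circ> \<beta>) * H z (w \<circ> \<beta>))) = avg (perms X) (\<lambda>w. \<Phi> z w * H z w)" for z
      using avg_perms_subgroup_right[OF X, of ?Z "\<lambda>w. \<Phi> z w * H z w"] by blast
    show ?thesis unfolding avg2_def 1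
      using avg_perms_subgroup_left[OF X, of ?Z "\<lambda>z. avg (perms X) (\<lambda>w. \<Phi> z w * H z w)"] by simp
  qed
  also have "\<dots> = avg (perms X) (\<lambda>z. avg (perms ?Z) (\<lambda>\<alpha>. avg (perms X) (\<lambda>w. avg (perms ?Z) (\<lambda>\<beta>. \<Phi> z w * H (\<alpha> \<circ> z) (w \<circ> \<beta>)))))"
  proof (intro avg_cong, unfold mem_Collect_eq)
    fix z \<alpha> w \<beta> assume p: "z permutes X" "\<alpha> permutes ?Z" "w permutes X" "\<beta> permutes ?Z"
    have "w \<circ> \<beta> permutes X" using p permutes_subset[OF p(4), of X] by (intro permutes_compose) auto
    then have "\<Phi> (\<alpha> \<circ> z) (w \<circ> \<beta>) = \<Phi> z w" using p \<Phi> unfolding inv_outside_def by metis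
    then show "\<Phi> (\<alpha> \<circ> z) (w \<circ> \<beta>) * H (\<alpha> \<circ> z) (w \<circ> \<beta>) = \<Phi> z w * H (\<alpha> \<circ> z) (w \<circ> \<beta>)" by simp
  qed
  also have "\<dots> = avg (perms X) (\<lambda>z. avg (perms X) (\<lambda>w. \<Phi> z w * avg2 ?Z (\<lambda>\<alpha> \<beta>. H (\<alpha> \<circ> z) (w \<circ> \<beta>))))"
    unfolding avg2_def by (subst avg_swap[of "perms ?Z"]) (simp add: avg_cmult)
  also have "\<dots> \<le> avg (perms X) (\<lambda>z. avg (perms X) (\<lambda>w. \<Phi> z w * E))"
    by (intro avg_mono mult_left_mono) (use H \<Phi>0 in auto)
  also have "\<dots> = E * avg2 X \<Phi>" unfolding avg2_def by (simp add: avg_cmult_right)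
  finally show ?thesis .
qed

text \<open>The weight absorbs one factor \<open>D K\<close> at a time. Its set \<open>U\<close>
  then grows by at most \<open>d\<close> points while one factor fewer is left, so the budget
  \<open>l\<close> is kept. Hence \<open>step\<close> has to hold for all invariant nonnegative
  weights, not only for the constant one.\<close>

lemma avg2_power_bound:
  assumes "finite X" "finite Ks"
    and Ks: "\<And>K. K \<in> Ks \<Longrightarrow> K \<subseteq> B \<and> card K = d"
    and D: "\<And>K. K \<in> Ks \<Longrightarrow> inv_outside X K (D K)"
    and D0: "\<And>K z w. 0 \<le> D K z w"
    and step: "\<And>U \<Phi>. U \<subseteq> B \<Longrightarrow> card U + d \<le> l \<Longrightarrow> inv_outside X U \<Phi> \<Longrightarrow>
       (\<And>z w. z permutes X \<Longrightarrow> w permutes X \<Longrightarrow> 0 \<le> \<Phi> z w) \<Longrightarrow>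
       avg2 X (\<lambda>z w. \<Phi> z w * (\<Sum>K\<in>Ks. D K z w)) \<le> A * avg2 X \<Phi>"
    and "0 \<le> A"
  shows "U \<subseteq> B \<Longrightarrow> card U + j * d \<le> l \<Longrightarrow> inv_outside X U \<Phi> \<Longrightarrow>
       (\<And>z w. z permutes X \<Longrightarrow> w permutes X \<Longrightarrow> 0 \<le> \<Phi> z w) \<Longrightarrow>
       avg2 X (\<lambda>z w. \<Phi> z w * (\<Sum>K\<in>Ks. D K z w) ^ j) \<le> A ^ j * avg2 X \<Phi>"
proof (induction j arbitrary: U \<Phi>)
  case (Suc j)
  let ?Q = "\<lambda>z w. \<Sum>K\<in>Ks. D K z w"
  have "avg2 X (\<lambda>z w. \<Phi> z w * ?Q z w ^ Suc j) = (\<Sum>K\<in>Ks. avg2 X (\<lambda>z w. (\<Phi> z w * D K z w) * ?Q z w ^ j))"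
    by (simp add: sum_distrib_left sum_distrib_right mult_ac flip: avg2_sum)
  also have "\<dots> \<le> (\<Sum>K\<in>Ks. A ^ j * avg2 X (\<lambda>z w. \<Phi> z w * D K z w))"
  proof (intro sum_mono Suc.IH)
    fix K assume K: "K \<in> Ks"
    show "U \<union> K \<subseteq> B" using K Ks Suc.prems by auto
    show "card (U \<union> K) + j * d \<le> l"
      using card_Un_le[of U K] K Ks[OF K] Suc.prems(2) by auto
    show "inv_outside X (U \<union> K) (\<lambda>z w. \<Phi> z w * D K z w)"
      by (rule inv_outside_mult[OF Suc.prems(3) D[OF K]])
  qed (use Suc.prems D0 in auto)
  also have "\<dots> = A ^ j * avg2 X (\<lambda>z w. \<Phi> z w * ?Q z w)"
    by (simp only: sum_distrib_left avg2_sum)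
  also have "\<dots> \<le> A ^ j * (A * avg2 X \<Phi>)"
    using Suc.prems \<open>0 \<le> A\<close> by (intro mult_left_mono step) auto
  finally show ?case by (simp add: mult_ac)
qed simp

text \<open>Cauchy-Schwarz over the 4 ^ card S terms of \<open>diff_restrict\<close> gives 16 ^ card
  S in total. Comparing averages over \<open>Z\<close> with those over \<open>X - S\<close> costs
  one factor \<open>r\<close> for each of the two points of every pair of \<open>K - S\<close>, in
  each of the two variables.\<close>

lemma diff_restrict_avg:
  assumes X: "finite X" and B: "paired X B" and K: "K \<subseteq> B" and U: "U \<subseteq> B" and S: "S = K \<inter> U"
    and Z: "Z = X - (U \<union> \<theta> ` U)"
    and r: "real (card (X - S)) \<le> r * real (card Z - 2 * card (K - S))" "0 \<le> r"
    and E: "\<And>T T'. T \<subseteq> S \<Longrightarrow> T' \<subseteq> S \<Longrightarrow>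
       avg2 (X - S) (\<lambda>\<alpha> \<beta>. (diff (X - S) (K - S) (\<lambda>y. f (w \<circ> tau T' \<circ> y \<circ> tau T \<circ> z)) \<alpha> \<beta>)\<^sup>2) \<le> E"
  shows "avg2 Z (\<lambda>\<alpha> \<beta>. (diff X K f (\<alpha> \<circ> z) (w \<circ> \<beta>))\<^sup>2) \<le> 16 ^ card S * r ^ (4 * card (K - S)) * E"
proof -
  have finB: "finite B" using B X finite_subset unfolding paired_def by blast
  have finS: "finite S" using finite_subset[OF _ finB] S K by blast
  define Q where "Q = (K - S) \<union> \<theta> ` (K - S)"
  define G where "G T T' = diff (X - S) (K - S) (\<lambda>y. f (w \<circ> tau T' \<circ> y \<circ> tau T \<circ> z))" for T T'
  have QZ: "Q \<subseteq> Z"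
  proof
    fix y assume "y \<in> Q"
    then consider "y \<in> K - S" | "\<theta> y \<in> K - S" unfolding Q_def by auto
    then show "y \<in> Z"
    proof cases
      case 1
      then have "y \<in> B" "y \<notin> U" using K S by auto
      then show ?thesis using paired_not_both[OF B, of y] paired_mem[OF B, of y] U by (auto simp: Z)
    next
      case 2
      then have "\<theta> y \<in> B" "\<theta> y \<notin> U" using K S by auto
      then show ?thesis using paired_not_both[OF B, of "\<theta> y"] paired_mem[OF B, of "\<theta> y"] U by (auto simp: Z)
    qed
  qed
  have ZX: "Z \<subseteq> X - S" using S by (auto simp: Z)
  have finK: "finite (K - S)" using finB K finite_subset by blast
  have "inj \<theta>" by (rule injI) (metis \<theta>\<theta>)
  then have "card (\<theta> ` (K - S)) = card (K - S)" by (intro card_image) (auto intro: inj_on_subset)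
  moreover have "(K - S) \<inter> \<theta> ` (K - S) = {}" using B K unfolding paired_def by blast
  ultimately have cardQ: "card Q = 2 * card (K - S)"
    unfolding Q_def using finK by (simp add: card_Un_disjoint)
  have ratio: "avg2 Z (\<lambda>\<alpha> \<beta>. (G T T' \<alpha> \<beta>)\<^sup>2) \<le> r ^ (4 * card (K - S)) * avg2 (X - S) (\<lambda>\<alpha> \<beta>. (G T T' \<alpha> \<beta>)\<^sup>2)" for T T'
  proof -
    have XS: "finite (X - S)" using X by simp
    have r': "real (card (X - S)) \<le> r * real (card Z - card Q)" using r cardQ by simp
    have Q': "X - S - Q = X - S - ((K - S) \<union> \<theta> ` (K - S))" by (simp add: Q_def)
    have 1: "avg (perms Z) (\<lambda>\<beta>. (G T T' \<alpha> \<beta>)\<^sup>2) \<le> r ^ card Q * avg (perms (X - S)) (\<lambda>\<beta>. (G T T' \<alpha> \<beta>)\<^sup>2)" for \<alpha>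
      by (rule avg_perms_supergroup[OF XS ZX QZ _ _ r' r(2)]) (simp_all add: G_def Q' diff_right_invariant)
    have 2: "avg (perms Z) (\<lambda>\<alpha>. avg (perms (X - S)) (\<lambda>\<beta>. (G T T' \<alpha> \<beta>)\<^sup>2))
       \<le> r ^ card Q * avg (perms (X - S)) (\<lambda>\<alpha>. avg (perms (X - S)) (\<lambda>\<beta>. (G T T' \<alpha> \<beta>)\<^sup>2))"
      by (rule avg_perms_supergroup_left[OF XS ZX QZ _ _ r' r(2)])
         (simp_all add: G_def Q' diff_left_invariant avg_nonneg)
    have "avg2 Z (\<lambda>\<alpha> \<beta>. (G T T' \<alpha> \<beta>)\<^sup>2) \<le> avg (perms Z) (\<lambda>\<alpha>. r ^ card Q * avg (perms (X - S)) (\<lambda>\<beta>. (G T T' \<alpha> \<beta>)\<^sup>2))"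
      unfolding avg2_def by (intro avg_mono 1)
    also have "\<dots> \<le> r ^ card Q * (r ^ card Q * avg2 (X - S) (\<lambda>\<alpha> \<beta>. (G T T' \<alpha> \<beta>)\<^sup>2))"
      unfolding avg_cmult avg2_def using 2 r(2) by (intro mult_left_mono) auto
    also have "\<dots> = r ^ (4 * card (K - S)) * avg2 (X - S) (\<lambda>\<alpha> \<beta>. (G T T' \<alpha> \<beta>)\<^sup>2)"
      by (simp add: cardQ flip: power_add mult.assoc)
    finally show ?thesis .
  qed
  have "avg2 Z (\<lambda>\<alpha> \<beta>. (diff X K f (\<alpha> \<circ> z) (w \<circ> \<beta>))\<^sup>2)
     \<le> avg2 Z (\<lambda>\<alpha> \<beta>. 4 ^ card S * (\<Sum>T\<in>Pow S. \<Sum>T'\<in>Pow S. (G T T' \<alpha> \<beta>)\<^sup>2))"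
  proof (rule avg2_mono)
    fix \<alpha> \<beta> assume p: "\<alpha> permutes Z" "\<beta> permutes Z"
    have ZS: "Z \<subseteq> X - (S \<union> \<theta> ` S)" using S unfolding Z by auto
    note p' = permutes_subset[OF p(1) ZS] permutes_subset[OF p(2) ZS]
    let ?h = "\<lambda>T T'. (-1) ^ card T * (-1) ^ card T' * G T T' \<alpha> \<beta>"
    have "diff X K f (\<alpha> \<circ> z) (w \<circ> \<beta>) = (\<Sum>T\<in>Pow S. \<Sum>T'\<in>Pow S. ?h T T')"
      unfolding G_def using S by (intro diff_restrict[OF B finB K _ p']) auto
    also have "\<dots> = (\<Sum>x\<in>Pow S \<times> Pow S. ?h (fst x) (snd x))" by (simp add: sum.cartesian_product split_def)
    finally have "(diff X K f (\<alpha> \<circ> z) (w \<circ> \<beta>))\<^sup>2 \<le> (\<Sum>x\<in>Pow S \<times> Pow S. (?h (fst x) (snd x))\<^sup>2) * card (Pow S \<times> Pow S)"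
      by (simp only: sum_squared_le_sum_of_squares)
    also have "(\<Sum>x\<in>Pow S \<times> Pow S. (?h (fst x) (snd x))\<^sup>2) = (\<Sum>T\<in>Pow S. \<Sum>T'\<in>Pow S. (G T T' \<alpha> \<beta>)\<^sup>2)"
      by (simp add: sum.cartesian_product split_def power_mult_distrib flip: power_mult)
    also have "real (card (Pow S \<times> Pow S)) = 4 ^ card S"
      using finS by (simp add: card_cartesian_product card_Pow flip: power_mult_distrib)
    finally show "(diff X K f (\<alpha> \<circ> z) (w \<circ> \<beta>))\<^sup>2 \<le> 4 ^ card S * (\<Sum>T\<in>Pow S. \<Sum>T'\<in>Pow S. (G T T' \<alpha> \<beta>)\<^sup>2)"
      by (simp only: mult.commute)
  qed
  also have "\<dots> = 4 ^ card S * (\<Sum>T\<in>Pow S. \<Sum>T'\<in>Pow S. avg2 Z (\<lambda>\<alpha> \<beta>. (G T T' \<alpha> \<beta>)\<^sup>2))"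
    by (simp add: avg2_cmult avg2_sum)
  also have "\<dots> \<le> 4 ^ card S * (\<Sum>T\<in>Pow S. \<Sum>T'\<in>Pow S. r ^ (4 * card (K - S)) * E)"
  proof (intro mult_left_mono sum_mono)
    fix T T' assume "T \<in> Pow S" "T' \<in> Pow S"
    then have "avg2 (X - S) (\<lambda>\<alpha> \<beta>. (G T T' \<alpha> \<beta>)\<^sup>2) \<le> E" unfolding G_def by (intro E) auto
    then have "r ^ (4 * card (K - S)) * avg2 (X - S) (\<lambda>\<alpha> \<beta>. (G T T' \<alpha> \<beta>)\<^sup>2) \<le> r ^ (4 * card (K - S)) * E"
      using r(2) by (intro mult_left_mono) auto
    then show "avg2 Z (\<lambda>\<alpha> \<beta>. (G T T' \<alpha> \<beta>)\<^sup>2) \<le> r ^ (4 * card (K - S)) * E"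
      using ratio[of T T'] by linarith
  qed simp
  also have "\<dots> = 16 ^ card S * r ^ (4 * card (K - S)) * E"
    using finS by (simp add: card_Pow) (simp add: mult_ac flip: power_mult_distrib mult.assoc)
  finally show ?thesis .
qed

end

lemma sum_if_card:
  assumes "finite B"
  shows "(\<Sum>K\<in>Pow B. if card K = d then h K else 0) = (\<Sum>K\<in>{K. K \<subseteq> B \<and> card K = d}. h K)"
  using assms by (intro sum.mono_neutral_cong_right) auto

lemma avg2_translate':
  assumes "a permutes X" "b permutes X"
  shows "avg2 X (\<lambda>z w. F (z \<circ> a) (b \<circ> w)) = avg2 X F"
  unfolding avg2_def avg_perms_left[OF assms(2)] using avg_perms_right[OF assms(1), of "\<lambda>z. avg (perms X) (F z)"] .

context pairing
begin

text \<open>Translating \<open>w\<close> by \<open>tau V\<close> leaves the average unchanged and,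
  by \<open>diff_tau\<close>, displays the sum as a function of \<open>V\<close> on the cube whose
  Fourier coefficients are the differences at fixed \<open>z\<close>, \<open>w\<close>.\<close>

lemma avg2_even_moment_diff:
  assumes X: "finite X" and B: "paired X B" and p: "0 < p" "(1::nat) \<le> d"
  defines "Ks \<equiv> {K. K \<subseteq> B \<and> card K = d}"
  shows "avg2 X (\<lambda>z w. (\<Sum>K\<in>Ks. diff X K f z w) ^ (2 * p))
     \<le> (2 * real p) ^ (d * p) * avg2 X (\<lambda>z w. (\<Sum>K\<in>Ks. (diff X K f z w)\<^sup>2) ^ p)"
proof -
  have finB: "finite B" using B X finite_subset unfolding paired_def by blast
  let ?c = "\<lambda>z w K. if card K = d then diff X K f z w else 0"
  have "avg2 X (\<lambda>z w. (\<Sum>K\<in>Ks. diff X K f z w) ^ (2 * p))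
      = avg (Pow B) (\<lambda>V. avg2 X (\<lambda>z w. (\<Sum>K\<in>Ks. diff X K f z (w \<circ> tau V)) ^ (2 * p)))"
  proof -
    have "avg2 X (\<lambda>z w. (\<Sum>K\<in>Ks. diff X K f z (w \<circ> tau V)) ^ (2 * p)) = avg2 X (\<lambda>z w. (\<Sum>K\<in>Ks. diff X K f z w) ^ (2 * p))"
      if "V \<in> Pow B" for V
      using avg2_translate[OF permutes_id paired_tau_permutes[OF B], of V "\<lambda>z w. (\<Sum>K\<in>Ks. diff X K f z w) ^ (2 * p)"] that
      by simp
    then have "avg (Pow B) (\<lambda>V. avg2 X (\<lambda>z w. (\<Sum>K\<in>Ks. diff X K f z (w \<circ> tau V)) ^ (2 * p)))
        = avg (Pow B) (\<lambda>V. avg2 X (\<lambda>z w. (\<Sum>K\<in>Ks. diff X K f z w) ^ (2 * p)))"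
      by (rule avg_cong)
    also have "\<dots> = avg2 X (\<lambda>z w. (\<Sum>K\<in>Ks. diff X K f z w) ^ (2 * p))"
      using finB by (intro avg_const) auto
    finally show ?thesis ..
  qed
  also have "\<dots> = avg2 X (\<lambda>z w. avg (Pow B) (\<lambda>V. (\<Sum>K\<in>Pow B. ?c z w K * (-1) ^ card (V \<inter> K)) ^ (2 * p)))"
  proof -
    have "(\<Sum>K\<in>Ks. diff X K f z (w \<circ> tau V)) = (\<Sum>K\<in>Pow B. ?c z w K * (-1) ^ card (V \<inter> K))" if "V \<in> Pow B" for V z w
    proof -
      have "(\<Sum>K\<in>Ks. diff X K f z (w \<circ> tau V)) = (\<Sum>K\<in>Ks. diff X K f z w * (-1) ^ card (V \<inter> K))"
        using that by (intro sum.cong refl) (auto simp: Ks_def diff_tau[OF B finB])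
      also have "\<dots> = (\<Sum>K\<in>Pow B. if card K = d then diff X K f z w * (-1) ^ card (V \<inter> K) else 0)"
        unfolding Ks_def by (rule sum_if_card[OF finB, symmetric])
      also have "\<dots> = (\<Sum>K\<in>Pow B. ?c z w K * (-1) ^ card (V \<inter> K))" by (intro sum.cong) auto
      finally show ?thesis .
    qed
    then show ?thesis unfolding avg2_avg by (intro avg_cong avg2_cong) simp
  qed
  also have "\<dots> \<le> avg2 X (\<lambda>z w. (\<Sum>K\<in>Pow B. (2 * real p - 1) ^ card K * (?c z w K)\<^sup>2) ^ p)"
    by (intro avg2_mono Bonami finB p)
  also have "\<dots> \<le> avg2 X (\<lambda>z w. (2 * real p) ^ (d * p) * (\<Sum>K\<in>Ks. (diff X K f z w)\<^sup>2) ^ p)"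
  proof (rule avg2_mono)
    fix z w
    have "(\<Sum>K\<in>Pow B. (2 * real p - 1) ^ card K * (?c z w K)\<^sup>2) = (\<Sum>K\<in>Pow B. if card K = d then (2 * real p - 1) ^ d * (diff X K f z w)\<^sup>2 else 0)"
      by (intro sum.cong) auto
    also have "\<dots> = (2 * real p - 1) ^ d * (\<Sum>K\<in>Ks. (diff X K f z w)\<^sup>2)"
      unfolding Ks_def sum_if_card[OF finB] by (simp add: sum_distrib_left)
    also have "\<dots> \<le> (2 * real p) ^ d * (\<Sum>K\<in>Ks. (diff X K f z w)\<^sup>2)"
      using p by (intro mult_right_mono power_mono sum_nonneg) auto
    finally have le: "(\<Sum>K\<in>Pow B. (2 * real p - 1) ^ card K * (?c z w K)\<^sup>2) \<le> (2 * real p) ^ d * (\<Sum>K\<in>Ks. (diff X K f z w)\<^sup>2)" .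
    have "0 \<le> (\<Sum>K\<in>Pow B. (2 * real p - 1) ^ card K * (?c z w K)\<^sup>2)" using p by (intro sum_nonneg) auto
    then show "(\<Sum>K\<in>Pow B. (2 * real p - 1) ^ card K * (?c z w K)\<^sup>2) ^ p \<le> (2 * real p) ^ (d * p) * (\<Sum>K\<in>Ks. (diff X K f z w)\<^sup>2) ^ p"
      using power_mono[OF le, of p] by (simp add: power_mult_distrib power_mult)
  qed
  finally show ?thesis by (simp add: avg2_cmult)
qed

text \<open>Correlating \<open>f\<close> with the sum of \<open>diff X K f\<close> over all \<open>K \<subseteq> B\<close> of size \<open>d\<close> (all equally large in the mean)
  bounds the second moment of one of them by a high moment of the sum, and Bonami's inequality by a
  moment of the sum of squares. The moment is expanded factor by factor: a new \<open>K\<close> that meets the union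
  of the previous ones in \<open>S\<close> contributes a restriction of \<open>f\<close> to which the induction hypothesis
  applies with \<open>d - card S\<close>.\<close>

theorem level_inequality:
  fixes l m0 :: nat and R :: real
  assumes l: "0 < l" "16 * l \<le> m0" and R: "11 \<le> R"
  shows "d \<le> l \<Longrightarrow> finite X \<Longrightarrow> paired X B \<Longrightarrow> K \<subseteq> B \<Longrightarrow> card K = d \<Longrightarrow> m0 + d \<le> card B \<Longrightarrow>
    (\<And>p. 0 \<le> f p \<and> f p \<le> 1) \<Longrightarrow> globally_bounded X R \<mu> f \<Longrightarrow> exp (- real l) \<le> \<mu> \<Longrightarrow>
    avg2 X (\<lambda>z w. (diff X K f z w)\<^sup>2) \<le> \<mu>\<^sup>2 * (16 * R\<^sup>2 * l / m0) ^ d"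
proof (induction d arbitrary: X B K f \<mu> rule: less_induct)
  case (less d)
  note X = less.prems(2) and B = less.prems(3) and K = less.prems(4,5) and cB = less.prems(6)
    and f01 = less.prems(7) and glob = less.prems(8) and \<mu>l = less.prems(9)
  define \<kappa> where "\<kappa> = 16 * R\<^sup>2 * l / m0"
  have m0: "0 < m0" using l by simp
  have \<kappa>: "0 < \<kappa>" unfolding \<kappa>_def using l m0 R by auto
  have \<mu>: "0 < \<mu>" using \<mu>l exp_gt_zero less_le_trans by blast
  have finB: "finite B" using B X finite_subset unfolding paired_def by blast
  have avgf: "avg (perms X) (\<lambda>y. f (a \<circ> y \<circ> b)) \<le> \<mu>" if "a permutes X" "b permutes X" for a b
    using glob that unfolding globally_bounded_def by (metis Diff_empty card.empty empty_subsetI mult_1 power_0)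
  show ?case
  proof (cases "d = 0")
    case True
    then have "K = {}" using K finB finite_subset by fastforce
    have "(diff X K f z w)\<^sup>2 \<le> \<mu>\<^sup>2" if "z permutes X" "w permutes X" for z w
    proof -
      have "tau {} = id" by (auto simp: tau_def)
      then have "diff X K f z w = avg (perms X) (\<lambda>y. f (w \<circ> y \<circ> z))"
        unfolding diff_def coset_avg_def \<open>K = {}\<close> by simp
      moreover have "0 \<le> avg (perms X) (\<lambda>y. f (w \<circ> y \<circ> z))" using f01 by (intro avg_nonneg) auto
      ultimately show ?thesis using avgf[OF that(2,1)] by (auto intro: power_mono)
    qed
    then have "avg2 X (\<lambda>z w. (diff X K f z w)\<^sup>2) \<le> avg2 X (\<lambda>z w. \<mu>\<^sup>2)" by (rule avg2_mono)
    then show ?thesis using True X by (simp add: avg2_const)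
  next
    case False
    define Y where "Y = avg2 X (\<lambda>z w. (diff X K f z w)\<^sup>2)"
    define Ks where "Ks = {K. K \<subseteq> B \<and> card K = d}"
    define m where "m = card B"
    define C where "C = real (m choose d)"
    have d: "1 \<le> d" "d \<le> l" using False less.prems by auto
    have dm: "d \<le> m" "m0 \<le> m" "0 < m" using cB m0 unfolding m_def by auto
    have C: "0 < C" unfolding C_def using dm by simp
    have finKs: "finite Ks" unfolding Ks_def using finB by auto
    have cardKs: "card Ks = m choose d" unfolding Ks_def m_def using n_subsets[OF finB] by simp
    have XB: "2 * m \<le> card X"
    proof -
      have "inj \<theta>" by (rule injI) (metis \<theta>\<theta>)
      then have "card (\<theta> ` B) = card B" by (intro card_image) (auto intro: inj_on_subset)
      then have "card (B \<union> \<theta> ` B) = 2 * card B"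
        using B finB unfolding paired_def by (simp add: card_Un_disjoint)
      moreover have "card (B \<union> \<theta> ` B) \<le> card X" using B X unfolding paired_def by (intro card_mono) auto
      ultimately show ?thesis unfolding m_def by simp
    qed
    \<comment> \<open>By contradiction, because a failing bound lets
      \<open>\<mu>\<^sup>2 * \<kappa> ^ d\<close> in the induction hypothesis be replaced by
      \<open>Y\<close> itself. The terms of the moment expansion are then multiples of
      \<open>Y\<close>, and the resulting inequality can be solved for \<open>Y\<close>.\<close>
    have "Y \<le> \<mu>\<^sup>2 * \<kappa> ^ d"
    proof (rule ccontr)
      assume "\<not> Y \<le> \<mu>\<^sup>2 * \<kappa> ^ d"
      then have Y: "\<mu>\<^sup>2 * \<kappa> ^ d < Y" by simp
      have Y0: "0 < Y" using Y \<mu> \<kappa> by (meson less_trans mult_pos_pos zero_less_power)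
      have Ysame: "avg2 X (\<lambda>z w. (diff X K' f z w)\<^sup>2) = Y" if "K' \<in> Ks" for K'
        unfolding Y_def using that K by (intro diff_relabel[OF X B]) (auto simp: Ks_def)
      \<comment> \<open>The price of a point of \<open>K'\<close> that is already in
        \<open>U\<close>: 16 from Cauchy-Schwarz, R^2 from globalness, and one missing factor
        \<kappa> in the induction hypothesis.\<close>
      define \<eta> where "\<eta> = real m0 / real l"
      have \<eta>: "0 < \<eta>" "\<eta> = 16 * R\<^sup>2 / \<kappa>" unfolding \<eta>_def \<kappa>_def using l m0 R by auto
      \<comment> \<open>\<open>C\<close> counts the sets, 2^d pays for the comparison of group
        averages and e^d for the random intersections with \<open>U\<close>.\<close>
      define A where "A = C * (2 * exp 1) ^ d * Y"
      have A0: "0 \<le> A" unfolding A_def using C Y0 by simp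
      have step: "avg2 X (\<lambda>z w. \<Phi> z w * (\<Sum>K\<in>Ks. (diff X K f z w)\<^sup>2)) \<le> A * avg2 X \<Phi>"
        if U: "U \<subseteq> B" "card U + d \<le> l" and \<Phi>: "inv_outside X U \<Phi>"
          and \<Phi>0: "\<And>z w. z permutes X \<Longrightarrow> w permutes X \<Longrightarrow> 0 \<le> \<Phi> z w" for U \<Phi>
      proof -
        define Z where "Z = X - (U \<union> \<theta> ` U)"
        have finU: "finite U" using finite_subset[OF U(1) finB] .
        have each: "avg2 X (\<lambda>z w. \<Phi> z w * (diff X K' f z w)\<^sup>2) \<le> (2 ^ d * Y * \<eta> ^ card (K' \<inter> U)) * avg2 X \<Phi>"
          if K': "K' \<in> Ks" for K'
        proof (rule avg2_weighted_le[OF X \<Phi> \<Phi>0])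
          fix z w assume zw: "z permutes X" "w permutes X"
          define S where "S = K' \<inter> U"
          define s where "s = card S"
          define E where "E = Y * (R\<^sup>2 / \<kappa>) ^ s"
          have K'B: "K' \<subseteq> B" "card K' = d" using K' by (auto simp: Ks_def)
          have finK': "finite K'" using finite_subset[OF K'B(1) finB] .
          have SB: "S \<subseteq> B" "S \<subseteq> K'" "S \<subseteq> U" "finite S" using K'B U finU by (auto simp: S_def)
          have s: "s \<le> d" "s \<le> card U" unfolding s_def using card_mono[OF finK' SB(2)] card_mono[OF finU SB(3)] K'B by auto
          have cKS: "card (K' - S) = d - s" unfolding s_def using SB K'B by (simp add: card_Diff_subset)
          have E0: "0 \<le> E" unfolding E_def using Y0 \<kappa> by simp
          have "avg2 Z (\<lambda>\<alpha> \<beta>. (diff X K' f (\<alpha> \<circ> z) (w \<circ> \<beta>))\<^sup>2) \<le> 16 ^ card S * (16/15) ^ (4 * card (K' - S)) * E"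
          proof (rule diff_restrict_avg[OF X B K'B(1) U(1) S_def Z_def])
            have "card Z \<ge> card X - 2 * card U"
            proof -
              have "card (U \<union> \<theta> ` U) \<le> 2 * card U"
                using card_Un_le[of U "\<theta> ` U"] card_image_le[OF finU, of \<theta>] by linarith
              then show ?thesis unfolding Z_def using diff_card_le_card_Diff[of "U \<union> \<theta> ` U" X] finU by simp
            qed
            then have "card X - 2 * l \<le> card Z - 2 * card (K' - S)" using U(2) cKS by linarith
            moreover have "card X \<ge> 32 * l" using XB dm l by linarith
            moreover have "card (X - S) \<le> card X" using X by (intro card_mono) auto
            \<comment> \<open>At most 2l of at least 32l points are lost.\<close>
            ultimately show "real (card (X - S)) \<le> 16 / 15 * real (card Z - 2 * card (K' - S))" by linarith
            fix T T' assume T: "T \<subseteq> S" "T' \<subseteq> S"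
            define f' where "f' y = f (w \<circ> tau T' \<circ> y \<circ> tau T \<circ> z)" for y
            show "avg2 (X - S) (\<lambda>\<alpha> \<beta>. (diff (X - S) (K' - S) (\<lambda>y. f (w \<circ> tau T' \<circ> y \<circ> tau T \<circ> z)) \<alpha> \<beta>)\<^sup>2) \<le> E"
            proof (cases "S = {}")
              case True
              then have "T = {}" "T' = {}" using T by auto
              moreover have "tau {} = id" by (auto simp: tau_def)
              moreover have "diff X K' (\<lambda>y. f (w \<circ> (y \<circ> z))) = (\<lambda>\<alpha> \<beta>. diff X K' f (\<alpha> \<circ> z) (w \<circ> \<beta>))"
                unfolding diff_def coset_avg_def by (simp add: comp_assoc fun_eq_iff)
              ultimately show ?thesis
                using True avg2_translate'[OF zw, of "\<lambda>z w. (diff X K' f z w)\<^sup>2"] Ysame[OF K']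
                by (simp add: E_def s_def comp_assoc)
            next
              case False
              then have s1: "1 \<le> s" unfolding s_def using SB by (simp add: Suc_le_eq card_gt_0_iff)
              have "avg2 (X - S) (\<lambda>\<alpha> \<beta>. (diff (X - S) (K' - S) f' \<alpha> \<beta>)\<^sup>2) \<le> (R ^ s * \<mu>)\<^sup>2 * (16 * R\<^sup>2 * l / m0) ^ (d - s)"
              proof (rule less.IH[where B = "B - S"])
                show "d - s < d" "d - s \<le> l" "finite (X - S)" "card (K' - S) = d - s" "K' - S \<subseteq> B - S"
                  using s1 d X cKS K'B by auto
                show "paired (X - S) (B - S)"
                  using B SB paired_not_both[OF B] unfolding paired_def by auto
                \<comment> \<open>Both sides drop by \<open>s\<close>. Measuring the room in
                  \<open>B\<close> by \<open>m0 + d\<close> keeps \<open>m0\<close>, and with it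
                  \<kappa>, the same at all levels.\<close>
                show "m0 + (d - s) \<le> card (B - S)"
                  using cB SB s by (simp add: card_Diff_subset s_def)
                show "0 \<le> f' p \<and> f' p \<le> 1" for p unfolding f'_def using f01 by blast
                have t: "tau T permutes X" "tau T' permutes X" using paired_tau_permutes[OF B] T SB by auto
                show "globally_bounded (X - S) R (R ^ s * \<mu>) f'"
                  unfolding globally_bounded_def
                proof (intro allI impI)
                  fix S' a b assume S': "S' \<subseteq> X - S" and ab: "a permutes X - S" "b permutes X - S"
                  have ab': "a permutes X" "b permutes X" using permutes_subset[OF ab(1)] permutes_subset[OF ab(2)] by auto
                  have S'': "S \<union> S' \<subseteq> X" using S' SB B unfolding paired_def by auto
                  have c: "card (S \<union> S') = s + card S'" unfolding s_def
                    using S' SB finite_subset[OF S'] X by (intro card_Un_disjoint) auto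
                  have "avg (perms (X - (S \<union> S'))) (\<lambda>y. f ((w \<circ> tau T' \<circ> a) \<circ> y \<circ> (b \<circ> tau T \<circ> z))) \<le> R ^ card (S \<union> S') * \<mu>"
                    using glob S'' zw t ab' unfolding globally_bounded_def by (blast intro: permutes_compose)
                  then show "avg (perms (X - S - S')) (\<lambda>y. f' (a \<circ> y \<circ> b)) \<le> R ^ card S' * (R ^ s * \<mu>)"
                    unfolding f'_def by (simp add: comp_assoc Diff_Un set_diff_eq c power_add mult_ac conj_assoc)
                qed
                have "1 * \<mu> \<le> R ^ s * \<mu>" using R \<mu> by (intro mult_right_mono one_le_power) auto
                then show "exp (- real l) \<le> R ^ s * \<mu>" using \<mu>l by linarith
              qed
              also have "\<dots> = (R\<^sup>2) ^ s * (\<mu>\<^sup>2 * \<kappa> ^ (d - s))"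
                unfolding \<kappa>_def[symmetric] by (simp add: power_mult_distrib flip: power_mult) (simp add: mult.commute)
              also have "\<mu>\<^sup>2 * \<kappa> ^ (d - s) = \<mu>\<^sup>2 * \<kappa> ^ d / \<kappa> ^ s"
                using \<kappa> s by (simp add: power_diff)
              also have "(R\<^sup>2) ^ s * (\<mu>\<^sup>2 * \<kappa> ^ d / \<kappa> ^ s) = (\<mu>\<^sup>2 * \<kappa> ^ d) * (R\<^sup>2 / \<kappa>) ^ s" by (simp add: power_divide)
              also have "\<dots> \<le> E" unfolding E_def using Y \<kappa> by (intro mult_right_mono) auto
              finally show ?thesis unfolding f'_def .
            qed
          qed simp
          also have "\<dots> \<le> 16 ^ s * 2 ^ d * E"
          proof -
            have "(16/15 :: real) ^ (4 * card (K' - S)) = ((16/15) ^ 4) ^ (d - s)" by (simp only: cKS power_mult)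
            also have "\<dots> \<le> 2 ^ (d - s)" by (rule power_mono) (simp_all add: power_divide)
            also have "\<dots> \<le> 2 ^ d" by (intro power_increasing) auto
            finally show ?thesis using E0 unfolding s_def[symmetric] by (intro mult_right_mono mult_left_mono) auto
          qed
          also have "\<dots> = 2 ^ d * Y * \<eta> ^ card (K' \<inter> U)"
            unfolding E_def \<eta>(2) S_def[symmetric] s_def[symmetric] by (simp add: power_divide power_mult_distrib)
          finally show "avg2 (X - (U \<union> \<theta> ` U)) (\<lambda>\<alpha> \<beta>. (diff X K' f (\<alpha> \<circ> z) (w \<circ> \<beta>))\<^sup>2) \<le> 2 ^ d * Y * \<eta> ^ card (K' \<inter> U)"
            unfolding Z_def .
        qed
        have \<Phi>n: "0 \<le> avg2 X \<Phi>" using \<Phi>0 by (rule avg2_nonneg)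
        have "avg2 X (\<lambda>z w. \<Phi> z w * (\<Sum>K\<in>Ks. (diff X K f z w)\<^sup>2)) = (\<Sum>K'\<in>Ks. avg2 X (\<lambda>z w. \<Phi> z w * (diff X K' f z w)\<^sup>2))"
          by (simp only: sum_distrib_left avg2_sum)
        also have "\<dots> \<le> (\<Sum>K'\<in>Ks. (2 ^ d * Y * \<eta> ^ card (K' \<inter> U)) * avg2 X \<Phi>)"
          by (intro sum_mono each)
        also have "\<dots> = 2 ^ d * Y * avg2 X \<Phi> * (\<Sum>K'\<in>Ks. \<eta> ^ card (K' \<inter> U))"
          by (simp add: sum_distrib_left mult_ac)
        also have "\<dots> \<le> 2 ^ d * Y * avg2 X \<Phi> * (C * exp 1 ^ d)"
        proof (rule mult_left_mono)
          have "(\<Sum>K'\<in>Ks. \<eta> ^ card (K' \<inter> U)) \<le> C * (1 + \<eta> * d / m) ^ card U"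
            using sum_power_card_inter[OF finB U(1), of \<eta> d] \<eta> dm unfolding Ks_def C_def m_def by simp
          also have "(1 + \<eta> * d / m) ^ card U \<le> exp (\<eta> * d / m) ^ card U"
            using \<eta>(1) by (intro power_mono exp_ge_add_one_self) (auto intro!: add_nonneg_nonneg)
          also have "\<dots> = exp (\<eta> * d / m * card U)" by (rule exp_of_nat2_mult[symmetric])
          \<comment> \<open>With \<eta> = m0/l and at most l points in \<open>U\<close>, the
            quantity \<eta> card U / m is at most 1.\<close>
          also have "\<dots> \<le> exp (real d)"
          proof -
            have "\<eta> * d / m * card U = d * (real m0 / m * (card U / l))" unfolding \<eta>_def by (simp add: mult_ac)
            also have "\<dots> \<le> real d * ((1::real) * 1)"
              using dm U(2) l by (intro mult_left_mono mult_mono) auto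
            finally show ?thesis by simp
          qed
          also have "exp (real d) = exp 1 ^ d" by (simp add: exp_of_nat_mult[symmetric])
          finally show "(\<Sum>K'\<in>Ks. \<eta> ^ card (K' \<inter> U)) \<le> C * exp 1 ^ d" using C by simp
        qed (use Y0 \<Phi>n in auto)
        also have "\<dots> = A * avg2 X \<Phi>" unfolding A_def by (simp add: power_mult_distrib)
        finally show ?thesis .
      qed
      \<comment> \<open>The largest number of factors within the budget of \<open>l\<close> points.
        It also satisfies \<open>l \<le> 2 * (d * p)\<close>, so that a missing factor
        \<open>\<mu>\<close> costs only e^2 per level after taking the \<open>p\<close>-th
        root.\<close>
      define p where "p = l div d"
      have p: "0 < p" "p * d \<le> l" unfolding p_def using d by (auto simp: div_greater_zero_iff)
      have lp: "l \<le> 2 * (d * p)"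
      proof -
        have "l < d * (p + 1)" unfolding p_def using d dividend_less_times_div[of d l] by (simp add: algebra_simps)
        also have "d * (p + 1) \<le> 2 * (d * p)" using p by simp
        finally show ?thesis by simp
      qed
      have mom: "avg2 X (\<lambda>z w. (\<Sum>K\<in>Ks. (diff X K f z w)\<^sup>2) ^ p) \<le> A ^ p"
        using avg2_power_bound[OF X finKs, of B d "\<lambda>K z w. (diff X K f z w)\<^sup>2" l A "{}" p "\<lambda>_ _. 1"] step A0 p X
        by (auto simp: Ks_def inv_outside_diff inv_outside_def avg2_const)
      let ?G = "\<lambda>z w. \<Sum>K\<in>Ks. diff X K f z w"
      have G: "avg2 X (\<lambda>z w. ?G z w ^ (2 * p)) \<le> (2 * real p) ^ (d * p) * A ^ p"
      proof -
        have "avg2 X (\<lambda>z w. ?G z w ^ (2 * p)) \<le> (2 * real p) ^ (d * p) * avg2 X (\<lambda>z w. (\<Sum>K\<in>Ks. (diff X K f z w)\<^sup>2) ^ p)"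
          unfolding Ks_def by (rule avg2_even_moment_diff[OF X B p(1) d(1)])
        also have "\<dots> \<le> (2 * real p) ^ (d * p) * A ^ p" using mom by (intro mult_left_mono) auto
        finally show ?thesis .
      qed
      have corr: "C * Y / 4 ^ d \<le> avg2 X (\<lambda>z w. f (w \<circ> z) * ?G z w)"
      proof -
        have "Y / 4 ^ d \<le> avg2 X (\<lambda>z w. f (w \<circ> z) * diff X K' f z w)" if "K' \<in> Ks" for K'
        proof -
          have "K' \<subseteq> B" "card K' = d" using that by (auto simp: Ks_def)
          then show ?thesis
            using avg_diff_sq_le_correlation[OF X paired_mono[OF B], of K' f] Ysame[OF that] by (simp add: field_simps)
        qed
        then have "(\<Sum>K'\<in>Ks. Y / 4 ^ d) \<le> (\<Sum>K'\<in>Ks. avg2 X (\<lambda>z w. f (w \<circ> z) * diff X K' f z w))" by (rule sum_mono)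
        then show ?thesis by (simp add: cardKs C_def sum_distrib_left avg2_sum)
      qed
      have avgf2: "avg2 X (\<lambda>z w. f (w \<circ> z)) \<le> \<mu>"
      proof -
        have "avg (perms X) (\<lambda>w. f (w \<circ> z)) \<le> \<mu>" if "z \<in> perms X" for z
          using avgf[OF permutes_id, of z] that by simp
        then have "avg2 X (\<lambda>z w. f (w \<circ> z)) \<le> avg (perms X) (\<lambda>z. \<mu>)" unfolding avg2_def by (intro avg_mono)
        then show ?thesis using X by (simp add: avg_perms_const)
      qed
      have "(C * Y / 4 ^ d) ^ (2 * p) \<le> avg2 X (\<lambda>z w. f (w \<circ> z) * ?G z w) ^ (2 * p)"
        using corr C Y0 by (intro power_mono) auto
      \<comment> \<open>Jensen with weight \<open>f\<close> keeps \<open>2 * p - 1\<close> factors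
        of the density; the lower bound on \<open>\<mu>\<close> supplies the last one.\<close>
      also have "\<dots> \<le> avg2 X (\<lambda>z w. f (w \<circ> z)) ^ (2 * p - 1) * avg2 X (\<lambda>z w. f (w \<circ> z) * ?G z w ^ (2 * p))"
        using f01 by (intro avg2_Jensen_even X p) auto
      also have "\<dots> \<le> \<mu> ^ (2 * p - 1) * avg2 X (\<lambda>z w. ?G z w ^ (2 * p))"
      proof (intro mult_mono power_mono avgf2 avg2_mono avg2_nonneg)
        fix z w
        have nn: "0 \<le> ?G z w ^ (2 * p)" by (simp add: power_mult)
        have f: "0 \<le> f (w \<circ> z)" "f (w \<circ> z) \<le> 1" using f01 by blast+
        show "f (w \<circ> z) * ?G z w ^ (2 * p) \<le> ?G z w ^ (2 * p)" by (rule mult_left_le_one_le[OF nn f])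
        show "0 \<le> f (w \<circ> z) * ?G z w ^ (2 * p)" by (rule mult_nonneg_nonneg[OF f(1) nn])
      qed (use f01 \<mu> in auto)
      also have "\<dots> \<le> \<mu> ^ (2 * p - 1) * ((2 * real p) ^ (d * p) * A ^ p)"
        using G \<mu> by (intro mult_left_mono) auto
      finally have main: "(C * Y / 4 ^ d) ^ (2 * p) \<le> \<mu> ^ (2 * p - 1) * ((2 * real p) ^ (d * p) * A ^ p)" .
      have \<mu>p: "\<mu> ^ (2 * p - 1) \<le> (\<mu>\<^sup>2 * exp 2 ^ d) ^ p"
      proof -
        have "1 \<le> \<mu> * exp (real l)" using mult_right_mono[OF \<mu>l, of "exp (real l)"] by (simp flip: exp_add)
        also have "\<dots> \<le> \<mu> * exp (real (2 * (d * p)))" using \<mu> lp by (intro mult_left_mono) (auto simp del: of_nat_mult)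
        also have "exp (real (2 * (d * p))) = (exp 2 ^ d) ^ p"
          by (simp add: exp_of_nat_mult[symmetric] power_mult[symmetric] mult_ac)
        finally have "\<mu> ^ (2 * p - 1) * 1 \<le> \<mu> ^ (2 * p - 1) * (\<mu> * (exp 2 ^ d) ^ p)"
          using \<mu> by (intro mult_left_mono) auto
        also have "\<dots> = (\<mu> ^ (2 * p - 1) * \<mu>) * (exp 2 ^ d) ^ p" by simp
        also have "\<mu> ^ (2 * p - 1) * \<mu> = (\<mu>\<^sup>2) ^ p" using p by (simp flip: power_Suc2 power_mult)
        finally show ?thesis by (simp add: power_mult_distrib)
      qed
      have "((C * Y)\<^sup>2 / 16 ^ d) ^ p = (C * Y / 4 ^ d) ^ (2 * p)"
      proof -
        have "(16::real) ^ d = (4 ^ d)\<^sup>2" by (simp add: power2_eq_square flip: power_mult_distrib)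
        then show ?thesis by (simp only: power_divide power_mult)
      qed
      also have "\<dots> \<le> (\<mu>\<^sup>2 * exp 2 ^ d) ^ p * ((2 * real p) ^ (d * p) * A ^ p)"
        by (rule order_trans[OF main mult_right_mono[OF \<mu>p]]) (use A0 in simp)
      also have "\<dots> = (\<mu>\<^sup>2 * exp 2 ^ d * ((2 * real p) ^ d * A)) ^ p"
        by (simp only: power_mult_distrib power_mult)
      finally have "(C * Y)\<^sup>2 / 16 ^ d \<le> \<mu>\<^sup>2 * exp 2 ^ d * ((2 * real p) ^ d * A)"
        using p A0 by (subst (asm) power_mono_iff) auto
      also have "\<dots> = (C * Y) * (\<mu>\<^sup>2 * (exp 2 ^ d * (2 * real p) ^ d * (2 * exp 1) ^ d))"
        unfolding A_def by (simp add: mult_ac)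
      \<comment> \<open>\<open>C * Y\<close> occurs squared on the left but only once on the right,
        through \<open>A\<close>, so one factor cancels.\<close>
      finally have "(C * Y) * ((C * Y) / 16 ^ d) \<le> (C * Y) * (\<mu>\<^sup>2 * (exp 2 ^ d * (2 * real p) ^ d * (2 * exp 1) ^ d))"
        by (simp add: power2_eq_square)
      then have "C * Y / 16 ^ d \<le> \<mu>\<^sup>2 * (exp 2 ^ d * (2 * real p) ^ d * (2 * exp 1) ^ d)"
        using C Y0 by (subst (asm) mult_le_cancel_left_pos) auto
      then have "C * Y \<le> \<mu>\<^sup>2 * (exp 2 ^ d * (2 * real p) ^ d * (2 * exp 1) ^ d) * 16 ^ d"
        by (simp add: divide_le_eq)
      also have "\<dots> = \<mu>\<^sup>2 * (64 * exp 3 * p) ^ d"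
      proof -
        have "(exp 2 ^ d * (2 * real p) ^ d * (2 * exp 1) ^ d) * 16 ^ d = (exp 2 * (2 * real p) * (2 * exp 1) * 16) ^ d"
          by (simp only: power_mult_distrib)
        also have "exp 2 * (2 * real p) * (2 * exp 1) * 16 = 64 * (exp 2 * exp 1) * real p" by simp
        also have "exp 2 * exp 1 = (exp 3 :: real)" by (simp flip: exp_add)
        finally show ?thesis by simp
      qed
      finally have CY: "C * Y \<le> \<mu>\<^sup>2 * (64 * exp 3 * p) ^ d" .
      have "(real m / d) ^ d \<le> C" unfolding C_def using dm by (intro binomial_ge_n_over_k_pow_k)
      then have "(real m / d) ^ d * Y \<le> \<mu>\<^sup>2 * (64 * exp 3 * p) ^ d"
        using CY Y0 mult_right_mono[of "(real m / d) ^ d" C Y] by linarith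
      then have "Y \<le> \<mu>\<^sup>2 * (64 * exp 3 * p) ^ d / (real m / d) ^ d"
        using dm d by (subst pos_le_divide_eq) (auto simp: mult.commute)
      also have "\<dots> = \<mu>\<^sup>2 * (64 * exp 3 * (p * d) / m) ^ d"
      proof -
        have "64 * exp 3 * (p * d) / m = 64 * exp 3 * real p / (real m / d)" by simp
        then show ?thesis by (simp only: power_divide times_divide_eq_right)
      qed
      also have "\<dots> \<le> \<mu>\<^sup>2 * \<kappa> ^ d"
      proof (intro mult_left_mono power_mono)
        have "exp (1::real) \<le> 3" by (rule exp_le)
        then have "exp (1::real) ^ 3 \<le> 3 ^ 3" by (rule power_mono) simp
        then have "exp (3::real) \<le> 27" by (simp flip: exp_of_nat_mult)
        \<comment> \<open>The reason for 11 \<le> R: 64 * 27 = 1728 is at most 16 * 121 =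
          1936.\<close>
        moreover have "(121::real) \<le> R\<^sup>2" using power_mono[OF R, of 2] by simp
        ultimately have c: "64 * exp 3 \<le> 16 * R\<^sup>2" by simp
        have "real (p * d) / real m \<le> real l / real m0"
          using p(2) dm m0 by (intro frac_le) (auto simp del: of_nat_mult)
        then have "64 * exp 3 * (real (p * d) / real m) \<le> 16 * R\<^sup>2 * (real l / real m0)"
          by (rule mult_mono[OF c]) auto
        then show "64 * exp 3 * real (p * d) / real m \<le> \<kappa>" unfolding \<kappa>_def by simp
      qed auto
      finally show False using Y by simp
    qed
    then show ?thesis unfolding Y_def \<kappa>_def .
  qed
qed

end

section \<open>Functions on the symmetric group and their levels\<close>

abbreviation alts :: "'a set \<Rightarrow> ('a \<Rightarrow> 'a) set" where
  "alts Y \<equiv> {p. p permutes Y \<and> evenperm p}"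

lemma permutes_conjugate:
  assumes "\<alpha> permutes X - L" "\<kappa> permutes X"
  shows "\<kappa> \<circ> \<alpha> \<circ> inv' \<kappa> permutes X - \<kappa> ` L"
proof (rule permutes_superset[where S = X])
  show "\<kappa> \<circ> \<alpha> \<circ> inv' \<kappa> permutes X"
    using assms permutes_subset[OF assms(1)] by (intro permutes_compose permutes_inv) auto
  show "(\<kappa> \<circ> \<alpha> \<circ> inv' \<kappa>) x = x" if "x \<in> X - (X - \<kappa> ` L)" for x
  proof -
    have "inv' \<kappa> x \<in> L" using that permutes_inverses[OF assms(2)] by auto
    then show ?thesis using permutes_not_in[OF assms(1)] permutes_inverses[OF assms(2)] by auto
  qed
qed

lemma ex_permutes_image:
  assumes "finite X" "A \<subseteq> X" "B \<subseteq> X" "card A = card B"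
  shows "\<exists>p. p permutes X \<and> p ` A = B"
proof -
  have fin: "finite A" "finite B" using assms finite_subset by blast+
  obtain g where g: "bij_betw g A B" using finite_same_card_bij[OF fin assms(4)] by blast
  have "card (X - A) = card (X - B)" using assms fin by (simp add: card_Diff_subset)
  then obtain h where h: "bij_betw h (X - A) (X - B)"
    using finite_same_card_bij[of "X - A" "X - B"] assms(1) by blast
  define p where "p x = (if x \<in> A then g x else if x \<in> X then h x else x)" for x
  have "bij_betw p (A \<union> (X - A)) (B \<union> (X - B))"
  proof (rule bij_betw_combine)
    show "bij_betw p A B" using g by (subst bij_betw_cong[of _ _ g]) (auto simp: p_def)
    show "bij_betw p (X - A) (X - B)" using h by (subst bij_betw_cong[of _ _ h]) (auto simp: p_def)
  qed auto
  then have "p permutes X" using assms(2,3) by (intro bij_imp_permutes) (auto simp: p_def Un_absorb1)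
  moreover have "p ` A = B" using g by (auto simp: p_def bij_betw_def)
  ultimately show ?thesis by blast
qed

text \<open>Gram-Schmidt for a family that may be linearly dependent: \<open>F\<close> and the new
  vector \<open>b j\<close> are both reduced modulo the earlier vectors, and then one remainder is
  reduced by the other.\<close>

lemma orthogonal_projection:
  fixes b :: "'i \<Rightarrow> 'x \<Rightarrow> real"
  assumes "finite I" "finite P"
  shows "\<exists>c. \<forall>k\<in>I. (\<Sum>x\<in>P. (F x - (\<Sum>i\<in>I. c i * b i x)) * b k x) = 0"
  using assms(1)
proof (induction I arbitrary: F)
  case (insert j I)
  obtain e where e: "\<forall>k\<in>I. (\<Sum>x\<in>P. (b j x - (\<Sum>i\<in>I. e i * b i x)) * b k x) = 0" using insert.IH by blast
  obtain c where c: "\<forall>k\<in>I. (\<Sum>x\<in>P. (F x - (\<Sum>i\<in>I. c i * b i x)) * b k x) = 0" using insert.IH by blast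
  define v where "v x = b j x - (\<Sum>i\<in>I. e i * b i x)" for x
  define r where "r x = F x - (\<Sum>i\<in>I. c i * b i x)" for x
  \<comment> \<open>If \<open>v\<close> vanishes on \<open>P\<close> the quotient is 0 by
    convention; any value would serve then.\<close>
  define t where "t = (\<Sum>x\<in>P. r x * v x) / (\<Sum>x\<in>P. v x * v x)"
  have vb: "(\<Sum>x\<in>P. v x * b k x) = 0" and rb: "(\<Sum>x\<in>P. r x * b k x) = 0" if "k \<in> I" for k
    using e c that by (auto simp: v_def r_def)
  have comb: "(\<Sum>x\<in>P. G x * (\<Sum>i\<in>I. e i * b i x)) = 0" if "\<And>k. k \<in> I \<Longrightarrow> (\<Sum>x\<in>P. G x * b k x) = 0" for G
  proof -
    have "(\<Sum>x\<in>P. G x * (\<Sum>i\<in>I. e i * b i x)) = (\<Sum>i\<in>I. e i * (\<Sum>x\<in>P. G x * b i x))"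
      by (simp add: sum_distrib_left mult.left_commute) (rule sum.swap)
    then show ?thesis using that by simp
  qed
  have rv: "(\<Sum>x\<in>P. (r x - t * v x) * v x) = 0"
  proof (cases "(\<Sum>x\<in>P. v x * v x) = 0")
    case True
    then have "\<forall>x\<in>P. v x * v x = 0" using sum_nonneg_eq_0_iff[OF assms(2), of "\<lambda>x. v x * v x"] by simp
    then show ?thesis by simp
  next
    case False
    have "(\<Sum>x\<in>P. (r x - t * v x) * v x) = (\<Sum>x\<in>P. r x * v x) - t * (\<Sum>x\<in>P. v x * v x)"
      by (simp add: algebra_simps sum_subtractf sum_distrib_left)
    then show ?thesis using False by (simp add: t_def)
  qed
  define c' where "c' i = (if i = j then t else c i - t * e i)" for i
  have new: "F x - (\<Sum>i\<in>insert j I. c' i * b i x) = r x - t * v x" for x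
  proof -
    have "(\<Sum>i\<in>I. c' i * b i x) = (\<Sum>i\<in>I. (c i - t * e i) * b i x)"
      using insert.hyps by (intro sum.cong) (auto simp: c'_def)
    also have "\<dots> = (\<Sum>i\<in>I. c i * b i x) - t * (\<Sum>i\<in>I. e i * b i x)"
      by (simp add: algebra_simps sum_subtractf sum_distrib_left)
    finally show ?thesis using insert.hyps by (simp add: r_def v_def c'_def algebra_simps)
  qed
  have I0: "(\<Sum>x\<in>P. (r x - t * v x) * b k x) = 0" if "k \<in> I" for k
  proof -
    have "(\<Sum>x\<in>P. (r x - t * v x) * b k x) = (\<Sum>x\<in>P. r x * b k x) - t * (\<Sum>x\<in>P. v x * b k x)"
      by (simp add: algebra_simps sum_subtractf sum_distrib_left)
    then show ?thesis using rb[OF that] vb[OF that] by simp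
  qed
  have "(\<Sum>x\<in>P. (r x - t * v x) * b j x) = (\<Sum>x\<in>P. (r x - t * v x) * v x) + (\<Sum>x\<in>P. (r x - t * v x) * (\<Sum>i\<in>I. e i * b i x))"
    by (simp add: v_def sum.distrib[symmetric] algebra_simps)
  then have "(\<Sum>x\<in>P. (r x - t * v x) * b j x) = 0" using rv comb[of "\<lambda>x. r x - t * v x"] I0 by simp
  then show ?case using I0 new by (intro exI[of _ c']) auto
qed simp

text \<open>Log-convexity makes the quotients of consecutive terms nondecreasing. A first quotient
  \<open>q\<close> above \<open>t\<close> would force growth of order q^k, against the bound C
  t^k.\<close>

lemma log_convex_bounded:
  fixes b :: "nat \<Rightarrow> real"
  assumes nn: "\<And>k. 0 \<le> b k" and lc: "\<And>k. (b (Suc k))\<^sup>2 \<le> b k * b (Suc (Suc k))"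
    and bd: "\<And>k. b k \<le> C * t ^ k" and t: "0 \<le> t"
  shows "b 1 \<le> t * b 0"
proof (rule ccontr)
  assume "\<not> b 1 \<le> t * b 0"
  then have less: "t * b 0 < b 1" by simp
  then have b1: "0 < b 1" using nn[of 0] t by (smt (verit) mult_nonneg_nonneg)
  have b0: "0 < b 0"
  proof (rule ccontr)
    assume "\<not> 0 < b 0"
    then have "b 0 = 0" using nn[of 0] by simp
    then show False using lc[of 0] b1 by simp
  qed
  define q where "q = b 1 / b 0"
  have q: "t < q" unfolding q_def using less b0 by (simp add: less_divide_eq)
  have q0: "0 < q" unfolding q_def using b0 b1 by simp
  have ind: "0 < b k \<and> q * b k \<le> b (Suc k)" for k
  proof (induction k)
    case 0
    then show ?case using b0 by (simp add: q_def)
  next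
    case (Suc k)
    then have pos: "0 < b (Suc k)" using q0 by (smt (verit) mult_pos_pos)
    have "b k * (q * b (Suc k)) = (q * b k) * b (Suc k)" by simp
    also have "\<dots> \<le> b (Suc k) * b (Suc k)" using Suc pos by (intro mult_right_mono) auto
    also have "\<dots> \<le> b k * b (Suc (Suc k))" using lc[of k] by (simp add: power2_eq_square)
    finally show ?case using Suc pos by simp
  qed
  have ge: "q ^ k * b 0 \<le> b k" for k
  proof (induction k)
    case (Suc k)
    have "q ^ Suc k * b 0 = q * (q ^ k * b 0)" by simp
    also have "\<dots> \<le> q * b k" using Suc q0 by (intro mult_left_mono) auto
    also have "\<dots> \<le> b (Suc k)" using ind by blast
    finally show ?case .
  qed simp
  show False
  proof (cases "t = 0")
    case True
    then show False using bd[of 1] b1 by simp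
  next
    case False
    then have t0: "0 < t" using t by simp
    then have "1 < q / t" using q by simp
    then obtain k where k: "C / b 0 < (q / t) ^ k" using real_arch_pow by blast
    have "q ^ k * b 0 \<le> C * t ^ k" using ge[of k] bd[of k] by linarith
    then have "(q / t) ^ k * b 0 \<le> C" using t0 by (simp add: power_divide divide_le_eq)
    then have "(q / t) ^ k \<le> C / b 0" using b0 by (simp add: le_divide_eq)
    then show False using k by simp
  qed
qed

section \<open>Inner product and levels on the symmetric group\<close>

locale sym_space =
  fixes X :: "'a set"
  assumes finX: "finite X"
begin

abbreviation P :: "('a \<Rightarrow> 'a) set" where
  "P \<equiv> perms X"

definition ip :: "(('a \<Rightarrow> 'a) \<Rightarrow> real) \<Rightarrow> (('a \<Rightarrow> 'a) \<Rightarrow> real) \<Rightarrow> real" where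
  "ip F G = (\<Sum>x\<in>P. F x * G x)"

text \<open>Alternating stabilisers are used so that the indicator of the even permutations, and
  with it the main term, has level 0. One kind of coset suffices: conjugating a stabiliser gives
  another of equally many points, whence \<open>orth_right\<close>.\<close>

definition orth :: "nat \<Rightarrow> (('a \<Rightarrow> 'a) \<Rightarrow> real) \<Rightarrow> bool" where
  "orth d F \<longleftrightarrow> (\<forall>Q x. Q \<subseteq> X \<longrightarrow> card Q \<le> d \<longrightarrow> x permutes X \<longrightarrow> (\<Sum>\<alpha>\<in>alts (X - Q). F (x \<circ> \<alpha>)) = 0)"

text \<open>As an orthogonal complement it inherits all closure properties of \<open>orth\<close> by
  duality; \<open>low_representation\<close> identifies it with the span of the coset
  indicators.\<close>

definition low :: "nat \<Rightarrow> (('a \<Rightarrow> 'a) \<Rightarrow> real) \<Rightarrow> bool" where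
  "low d F \<longleftrightarrow> (\<forall>G. orth d G \<longrightarrow> ip F G = 0)"

definition conv :: "(('a \<Rightarrow> 'a) \<Rightarrow> real) \<Rightarrow> (('a \<Rightarrow> 'a) \<Rightarrow> real) \<Rightarrow> ('a \<Rightarrow> 'a) \<Rightarrow> real" where
  "conv f F x = (\<Sum>y\<in>P. f (x \<circ> inv' y) * F y)"

definition alt_avg :: "'a set \<Rightarrow> (('a \<Rightarrow> 'a) \<Rightarrow> real) \<Rightarrow> ('a \<Rightarrow> 'a) \<Rightarrow> ('a \<Rightarrow> 'a) \<Rightarrow> real" where
  "alt_avg D F z w = avg (alts (X - D)) (\<lambda>\<alpha>. F (w \<circ> \<alpha> \<circ> z))"

lemma finP: "finite P"
  using finX by (rule finite_permutations)

lemma cardP: "real (card P) = fact (card X)"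
  using finX by (simp add: card_permutations)

lemma ip_commute: "ip F G = ip G F"
  unfolding ip_def by (simp add: mult.commute)

lemma ip_nonneg: "0 \<le> ip F F"
  unfolding ip_def by (intro sum_nonneg) auto

lemma ip_cong: "(\<And>x. x permutes X \<Longrightarrow> F x = F' x) \<Longrightarrow> (\<And>x. x permutes X \<Longrightarrow> G x = G' x) \<Longrightarrow> ip F G = ip F' G'"
  unfolding ip_def by (intro sum.cong) auto

lemma ip_eq_0D: "ip F F = 0 \<Longrightarrow> x permutes X \<Longrightarrow> F x = 0"
  using sum_nonneg_eq_0_iff[OF finP, of "\<lambda>x. F x * F x"] unfolding ip_def by auto

lemma ip_zero_left: "(\<And>x. x permutes X \<Longrightarrow> F x = 0) \<Longrightarrow> ip F G = 0"
  unfolding ip_def by (intro sum.neutral) auto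

lemma ip_add_left: "ip (\<lambda>x. F x + G x) H = ip F H + ip G H"
  unfolding ip_def by (simp add: distrib_right sum.distrib)

lemma ip_diff_left: "ip (\<lambda>x. F x - G x) H = ip F H - ip G H"
  unfolding ip_def by (simp add: left_diff_distrib sum_subtractf)

lemma ip_cmult_left: "ip (\<lambda>x. c * F x) H = c * ip F H"
  unfolding ip_def by (simp add: sum_distrib_left mult.assoc)

lemma ip_sum_left: "ip (\<lambda>x. \<Sum>i\<in>I. F i x) H = (\<Sum>i\<in>I. ip (F i) H)"
  unfolding ip_def sum_distrib_right by (rule sum.swap)

lemma ip_Cauchy_Schwarz: "(ip F G)\<^sup>2 \<le> ip F F * ip G G"
  unfolding ip_def using Cauchy_Schwarz_ineq_sum[of F G P] by (simp add: power2_eq_square)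

lemma ip_right_translate: "g permutes X \<Longrightarrow> ip (\<lambda>x. F (x \<circ> g)) (\<lambda>x. G (x \<circ> g)) = ip F G"
  unfolding ip_def using sum_permutations_compose_right[of g X "\<lambda>x. F x * G x"] by simp

lemma ip_left_translate: "g permutes X \<Longrightarrow> ip (\<lambda>x. F (g \<circ> x)) (\<lambda>x. G (g \<circ> x)) = ip F G"
  unfolding ip_def using setum_permutations_compose_left[of g X "\<lambda>x. F x * G x"] by simp

lemma comp_inv_cancel:
  assumes "g permutes X"
  shows "x \<circ> g \<circ> inv' g = x" "x \<circ> inv' g \<circ> g = x" "g \<circ> (inv' g \<circ> y) = y" "inv' g \<circ> (g \<circ> y) = y"
  using permutes_inv_o[OF assms] by (simp_all add: comp_assoc) (simp_all add: comp_assoc[symmetric])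

lemma ip_right_move: "g permutes X \<Longrightarrow> ip (\<lambda>x. F (x \<circ> g)) G = ip F (\<lambda>x. G (x \<circ> inv' g))"
  using ip_right_translate[OF permutes_inv, of g "\<lambda>x. F (x \<circ> g)" G] by (simp add: comp_inv_cancel)

lemma ip_left_move: "g permutes X \<Longrightarrow> ip (\<lambda>x. F (g \<circ> x)) G = ip F (\<lambda>x. G (inv' g \<circ> x))"
  using ip_left_translate[OF permutes_inv, of g "\<lambda>x. F (g \<circ> x)" G] by (simp add: comp_inv_cancel)

lemma permutation_perm: "x permutes X \<Longrightarrow> permutation x"
  using finX permutes_imp_permutation by blast

lemma alts_perm: "\<alpha> \<in> alts (X - Q) \<Longrightarrow> \<alpha> permutes X"
  using permutes_subset[of \<alpha> "X - Q" X] by auto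

lemma alts_conjugate:
  assumes "g permutes X"
  shows "(\<Sum>\<alpha>\<in>alts (X - Q). H (g \<circ> \<alpha> \<circ> inv' g)) = (\<Sum>\<alpha>\<in>alts (X - g ` Q). H \<alpha>)"
proof (rule sum.reindex_bij_witness[where i = "\<lambda>\<alpha>. inv' g \<circ> \<alpha> \<circ> g" and j = "\<lambda>\<alpha>. g \<circ> \<alpha> \<circ> inv' g"])
  have ev: "evenperm (k \<circ> \<alpha> \<circ> inv' k) = evenperm \<alpha>" if "k permutes X" "\<alpha> permutes X" for k \<alpha>
    using that permutes_inv[of k X] by (auto simp: evenperm_comp evenperm_inv permutation_perm permutes_compose permutation_compose)
  have gi: "inv' g permutes X" "inv' (inv' g) = g" using permutes_inv[OF assms] permutes_inv_inv[OF assms] by auto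
  have img: "inv' g ` g ` Q = Q" using permutes_inv_o(2)[OF assms] by (simp add: image_comp)
  fix \<alpha>
  show "\<alpha> \<in> alts (X - Q) \<Longrightarrow> g \<circ> \<alpha> \<circ> inv' g \<in> alts (X - g ` Q)"
    using permutes_conjugate[OF _ assms, of \<alpha> Q] ev[OF assms alts_perm[of \<alpha> Q]] by auto
  show "\<alpha> \<in> alts (X - g ` Q) \<Longrightarrow> inv' g \<circ> \<alpha> \<circ> g \<in> alts (X - Q)"
    using permutes_conjugate[OF _ gi(1), of \<alpha> "g ` Q"] ev[OF gi(1) alts_perm[of \<alpha> "g ` Q"]] gi(2) img by auto
qed (simp_all add: comp_inv_cancel[OF assms] comp_assoc, simp_all add: comp_inv_cancel[OF assms] flip: comp_assoc)

lemma orth_mono: "orth d F \<Longrightarrow> e \<le> d \<Longrightarrow> orth e F"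
  unfolding orth_def by (meson order_trans)

lemma low_mono: "low e F \<Longrightarrow> e \<le> d \<Longrightarrow> low d F"
  unfolding low_def using orth_mono by blast

lemma orth_left: "orth d F \<Longrightarrow> g permutes X \<Longrightarrow> orth d (\<lambda>x. F (g \<circ> x))"
  unfolding orth_def by (simp add: permutes_compose flip: comp_assoc)

text \<open>Moving \<open>g\<close> to the other side of the coset conjugates the stabiliser of
  \<open>Q\<close> into that of the preimage of \<open>Q\<close> under \<open>g\<close>.\<close>

lemma orth_right:
  assumes "orth d F" "g permutes X"
  shows "orth d (\<lambda>x. F (x \<circ> g))"
  unfolding orth_def
proof (intro allI impI)
  fix Q x assume Q: "Q \<subseteq> X" "card Q \<le> d" "x permutes X"
  have gi: "inv' g permutes X" "inv' (inv' g) = g" using permutes_inv[OF assms(2)] permutes_inv_inv[OF assms(2)] by auto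
  have "(\<Sum>\<alpha>\<in>alts (X - Q). F (x \<circ> \<alpha> \<circ> g)) = (\<Sum>\<alpha>\<in>alts (X - Q). F ((x \<circ> g) \<circ> (inv' g \<circ> \<alpha> \<circ> inv' (inv' g))))"
    unfolding gi(2) by (simp add: comp_assoc comp_inv_cancel[OF assms(2)])
  also have "\<dots> = (\<Sum>\<alpha>\<in>alts (X - inv' g ` Q). F ((x \<circ> g) \<circ> \<alpha>))" by (rule alts_conjugate[OF gi(1)])
  also have "\<dots> = 0"
  proof -
    have "inv' g ` Q \<subseteq> X" using permutes_image[OF gi(1)] Q(1) by blast
    moreover have "card (inv' g ` Q) \<le> d"
      using Q(2) card_image_le[OF finite_subset[OF Q(1) finX], of "inv' g"] by linarith
    ultimately show ?thesis using assms(1) permutes_compose[OF assms(2) Q(3)] unfolding orth_def by blast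
  qed
  finally show "(\<Sum>\<alpha>\<in>alts (X - Q). F (x \<circ> \<alpha> \<circ> g)) = 0" .
qed

lemma low_left: "low d F \<Longrightarrow> g permutes X \<Longrightarrow> low d (\<lambda>x. F (g \<circ> x))"
  unfolding low_def by (simp add: ip_left_move orth_left permutes_inv)

lemma low_right: "low d F \<Longrightarrow> g permutes X \<Longrightarrow> low d (\<lambda>x. F (x \<circ> g))"
  unfolding low_def by (simp add: ip_right_move orth_right permutes_inv)

lemma orth_lincomb: "(\<And>i. i \<in> I \<Longrightarrow> orth d (F i)) \<Longrightarrow> orth d (\<lambda>x. \<Sum>i\<in>I. c i * F i x)"
  unfolding orth_def by (subst sum.swap) (simp flip: sum_distrib_left)

lemma low_lincomb: "(\<And>i. i \<in> I \<Longrightarrow> low d (F i)) \<Longrightarrow> low d (\<lambda>x. \<Sum>i\<in>I. c i * F i x)"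
  unfolding low_def by (simp add: ip_sum_left ip_cmult_left)

lemma orth_diff: "orth d F \<Longrightarrow> orth d G \<Longrightarrow> orth d (\<lambda>x. F x - G x)"
  unfolding orth_def by (simp add: sum_subtractf)

lemma low_diff: "low d F \<Longrightarrow> low d G \<Longrightarrow> low d (\<lambda>x. F x - G x)"
  unfolding low_def by (simp add: ip_diff_left)

lemma low_orth_zero: "low d F \<Longrightarrow> orth d F \<Longrightarrow> x permutes X \<Longrightarrow> F x = 0"
  unfolding low_def using ip_eq_0D by blast

lemma low_cong: "low d F \<Longrightarrow> (\<And>x. x permutes X \<Longrightarrow> F x = G x) \<Longrightarrow> low d G"
  unfolding low_def using ip_cong[of F G] by metis

lemma orth_cong:
  assumes "orth d F" "\<And>x. x permutes X \<Longrightarrow> F x = G x"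
  shows "orth d G"
  unfolding orth_def
proof (intro allI impI)
  fix Q x assume Q: "Q \<subseteq> X" "card Q \<le> d" "x permutes X"
  have "(\<Sum>\<alpha>\<in>alts (X - Q). G (x \<circ> \<alpha>)) = (\<Sum>\<alpha>\<in>alts (X - Q). F (x \<circ> \<alpha>))"
    by (rule sum.cong[OF refl], rule assms(2)[symmetric]) (metis alts_perm permutes_compose Q(3))
  then show "(\<Sum>\<alpha>\<in>alts (X - Q). G (x \<circ> \<alpha>)) = 0" using assms(1) Q unfolding orth_def by simp
qed

definition coset_ind :: "'a set \<Rightarrow> ('a \<Rightarrow> 'a) \<Rightarrow> ('a \<Rightarrow> 'a) \<Rightarrow> real" where
  "coset_ind Q x = indicator ((\<lambda>\<alpha>. x \<circ> \<alpha>) ` alts (X - Q))"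

definition cosets :: "nat \<Rightarrow> ('a set \<times> ('a \<Rightarrow> 'a)) set" where
  "cosets d = {Q. Q \<subseteq> X \<and> card Q \<le> d} \<times> P"

lemma finite_cosets: "finite (cosets d)"
  unfolding cosets_def using finX finP by auto

lemma ip_coset_ind:
  assumes "x permutes X"
  shows "ip G (coset_ind Q x) = (\<Sum>\<alpha>\<in>alts (X - Q). G (x \<circ> \<alpha>))"
proof -
  have sub: "(\<lambda>\<alpha>. x \<circ> \<alpha>) ` alts (X - Q) \<subseteq> P"
    using alts_perm permutes_compose[OF _ assms] by blast
  have inj: "inj_on (\<lambda>\<alpha>. x \<circ> \<alpha>) (alts (X - Q))"
    by (rule inj_onI) (metis comp_inv_cancel(4)[OF assms])
  have "ip G (coset_ind Q x) = (\<Sum>y\<in>(\<lambda>\<alpha>. x \<circ> \<alpha>) ` alts (X - Q). G y)"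
    unfolding ip_def coset_ind_def
    by (rule sum.mono_neutral_cong_right[OF finP sub]) auto
  then show ?thesis by (simp add: sum.reindex[OF inj])
qed

lemma low_coset_ind: "Q \<subseteq> X \<Longrightarrow> card Q \<le> d \<Longrightarrow> x permutes X \<Longrightarrow> low d (coset_ind Q x)"
  unfolding low_def orth_def by (simp add: ip_commute[of "coset_ind Q x"] ip_coset_ind)

lemma level_decomposition_coset:
  "\<exists>c. orth d (\<lambda>x. F x - (\<Sum>i\<in>cosets d. c i * coset_ind (fst i) (snd i) x))"
proof -
  obtain c where c: "\<forall>k\<in>cosets d. (\<Sum>x\<in>P. (F x - (\<Sum>i\<in>cosets d. c i * coset_ind (fst i) (snd i) x)) * coset_ind (fst k) (snd k) x) = 0"
    using orthogonal_projection[OF finite_cosets finP, where F = F and b = "\<lambda>i. coset_ind (fst i) (snd i)"] by blast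
  have "orth d (\<lambda>x. F x - (\<Sum>i\<in>cosets d. c i * coset_ind (fst i) (snd i) x))"
    unfolding orth_def
  proof (intro allI impI)
    fix Q x assume Q: "Q \<subseteq> X" "card Q \<le> d" and x: "x permutes X"
    then have "(Q, x) \<in> cosets d" by (simp add: cosets_def)
    then show "(\<Sum>\<alpha>\<in>alts (X - Q). F (x \<circ> \<alpha>) - (\<Sum>i\<in>cosets d. c i * coset_ind (fst i) (snd i) (x \<circ> \<alpha>))) = 0"
      using c ip_coset_ind[OF x, of "\<lambda>x. F x - (\<Sum>i\<in>cosets d. c i * coset_ind (fst i) (snd i) x)" Q]
      unfolding ip_def by fastforce
  qed
  then show ?thesis by blast
qed

lemma low_coset_comb: "low d (\<lambda>x. \<Sum>i\<in>cosets d. c i * coset_ind (fst i) (snd i) x)"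
  by (rule low_lincomb) (auto simp: cosets_def low_coset_ind)

text \<open>The remainder after projecting to the span of the coset indicators is both low and
  orthogonal to low functions, hence zero.\<close>

lemma low_representation:
  assumes "low d F"
  shows "\<exists>c. \<forall>x. x permutes X \<longrightarrow> F x = (\<Sum>i\<in>cosets d. c i * coset_ind (fst i) (snd i) x)"
proof -
  obtain c where c: "orth d (\<lambda>x. F x - (\<Sum>i\<in>cosets d. c i * coset_ind (fst i) (snd i) x))"
    using level_decomposition_coset by blast
  have "F x - (\<Sum>i\<in>cosets d. c i * coset_ind (fst i) (snd i) x) = 0" if "x permutes X" for x
    by (rule low_orth_zero[OF low_diff[OF assms low_coset_comb] c that])
  then show ?thesis by (intro exI[of _ c]) simp
qed

text \<open>Cutting off at the even permutations is self-adjoint and preserves \<open>orth\<close>,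
  since every coset of an alternating stabiliser has constant parity; so it may be applied to the
  projection. The vanishing on odd permutations is what \<open>alt_avg_norm_le\<close> asks
  for.\<close>

lemma level_decomposition:
  assumes "\<And>x. x permutes X \<Longrightarrow> \<not> evenperm x \<Longrightarrow> F x = 0"
  shows "\<exists>G. low d G \<and> orth d (\<lambda>x. F x - G x) \<and> (\<forall>x. x permutes X \<longrightarrow> \<not> evenperm x \<longrightarrow> G x = 0)"
proof -
  obtain c where c: "orth d (\<lambda>x. F x - (\<Sum>i\<in>cosets d. c i * coset_ind (fst i) (snd i) x))"
    using level_decomposition_coset by blast
  define E where "E H x = (if evenperm x then H x else 0)" for H :: "('a \<Rightarrow> 'a) \<Rightarrow> real" and x
  let ?G = "\<lambda>x. \<Sum>i\<in>cosets d. c i * coset_ind (fst i) (snd i) x"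
  have orthE: "orth d (E H)" if "orth d H" for H
    unfolding orth_def
  proof (intro allI impI)
    fix Q x assume Q: "Q \<subseteq> X" "card Q \<le> d" and x: "x permutes X"
    have "E H (x \<circ> \<alpha>) = (if evenperm x then H (x \<circ> \<alpha>) else 0)" if "\<alpha> \<in> alts (X - Q)" for \<alpha>
      using that x alts_perm[OF that] by (simp add: E_def evenperm_comp permutation_perm)
    then have "(\<Sum>\<alpha>\<in>alts (X - Q). E H (x \<circ> \<alpha>)) = (if evenperm x then (\<Sum>\<alpha>\<in>alts (X - Q). H (x \<circ> \<alpha>)) else 0)"
      by simp
    then show "(\<Sum>\<alpha>\<in>alts (X - Q). E H (x \<circ> \<alpha>)) = 0" using that Q x unfolding orth_def by simp
  qed
  have "ip (E ?G) H = ip ?G (E H)" for H unfolding ip_def E_def by (intro sum.cong) auto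
  then have "low d (E ?G)" using low_coset_comb orthE unfolding low_def by simp
  moreover have "orth d (\<lambda>x. F x - E ?G x)"
  proof -
    have "E (\<lambda>x. F x - ?G x) x = F x - E ?G x" if "x permutes X" for x
      using assms[OF that] by (simp add: E_def)
    then show ?thesis by (rule orth_cong[OF orthE[OF c]])
  qed
  ultimately show ?thesis by (intro exI[of _ "E ?G"]) (simp add: E_def)
qed

end

section \<open>Contraction on linear combinations through the growth of powers\<close>

context sym_space
begin

text \<open>Functions live on all maps, but norms see only the permutations of \<open>X\<close>; the
  second clause makes the operator well defined on their restrictions.\<close>

definition linop :: "((('a \<Rightarrow> 'a) \<Rightarrow> real) \<Rightarrow> (('a \<Rightarrow> 'a) \<Rightarrow> real)) \<Rightarrow> bool" where
  "linop T \<longleftrightarrow> (\<forall>a b u v x. x permutes X \<longrightarrow> T (\<lambda>x. a * u x + b * v x) x = a * T u x + b * T v x) \<and>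
     (\<forall>u v. (\<forall>x. x permutes X \<longrightarrow> u x = v x) \<longrightarrow> (\<forall>x. x permutes X \<longrightarrow> T u x = T v x))"

lemma linop_add: "linop T \<Longrightarrow> x permutes X \<Longrightarrow> T (\<lambda>x. a * u x + b * v x) x = a * T u x + b * T v x"
  unfolding linop_def by simp

lemma linop_cong: "linop T \<Longrightarrow> (\<And>x. x permutes X \<Longrightarrow> u x = v x) \<Longrightarrow> x permutes X \<Longrightarrow> T u x = T v x"
  unfolding linop_def by simp

definition power_bounded :: "((('a \<Rightarrow> 'a) \<Rightarrow> real) \<Rightarrow> (('a \<Rightarrow> 'a) \<Rightarrow> real)) \<Rightarrow> real \<Rightarrow> (('a \<Rightarrow> 'a) \<Rightarrow> real) \<Rightarrow> bool" where
  "power_bounded T t v \<longleftrightarrow> (\<exists>C. \<forall>k. ip ((T ^^ k) v) ((T ^^ k) v) \<le> C * t ^ k)"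

text \<open>The numbers \<open>\<parallel>T\<^sup>k v\<parallel>\<^sup>2\<close> are log-convex in \<open>k\<close>, so an exponential bound on their growth
  already holds for \<open>k = 1\<close>. This replaces the spectral theorem.\<close>

lemma power_bounded_norm:
  assumes sa: "\<And>u v. ip (T u) v = ip u (T v)" and v: "power_bounded T t v" and "0 \<le> t"
  shows "ip (T v) (T v) \<le> t * ip v v"
proof -
  define b where "b k = ip ((T ^^ k) v) ((T ^^ k) v)" for k
  obtain C where C: "\<And>k. b k \<le> C * t ^ k" using v unfolding power_bounded_def b_def by blast
  have "(b (Suc k))\<^sup>2 \<le> b k * b (Suc (Suc k))" for k
  proof -
    have "b (Suc k) = ip ((T ^^ k) v) ((T ^^ Suc (Suc k)) v)"
      unfolding b_def using sa[of "(T ^^ k) v" "(T ^^ Suc k) v"] by simp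
    then show ?thesis unfolding b_def using ip_Cauchy_Schwarz[of "(T ^^ k) v" "(T ^^ Suc (Suc k)) v"] by simp
  qed
  then have "b 1 \<le> t * b 0" by (intro log_convex_bounded[OF _ _ C assms(3)]) (auto simp: b_def ip_nonneg)
  then show ?thesis by (simp add: b_def)
qed

text \<open>The contraction is checked on an invariant class \<open>S\<close>, such as the functions
  invariant under one stabiliser; different summands of a function may use different
  classes.\<close>

lemma power_bounded_invariant:
  assumes S: "\<And>u. S u \<Longrightarrow> S (T u) \<and> ip (T u) (T u) \<le> t * ip u u" and "S v" "0 \<le> t"
  shows "power_bounded T t v"
proof -
  have "S ((T ^^ k) v) \<and> ip ((T ^^ k) v) ((T ^^ k) v) \<le> ip v v * t ^ k" for k
  proof (induction k)
    case (Suc k)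
    then have "ip ((T ^^ Suc k) v) ((T ^^ Suc k) v) \<le> t * ip ((T ^^ k) v) ((T ^^ k) v)" using S by simp
    also have "\<dots> \<le> t * (ip v v * t ^ k)" using Suc assms(3) by (intro mult_left_mono) auto
    finally show ?case using Suc S by (simp add: mult_ac)
  qed (use assms in auto)
  then show ?thesis unfolding power_bounded_def by blast
qed

lemma ip_sq_add_le: "ip (\<lambda>x. a * u x + b * v x) (\<lambda>x. a * u x + b * v x) \<le> 2 * a\<^sup>2 * ip u u + 2 * b\<^sup>2 * ip v v"
proof -
  have "ip (\<lambda>x. a * u x + b * v x) (\<lambda>x. a * u x + b * v x) \<le> (\<Sum>x\<in>P. 2 * a\<^sup>2 * (u x * u x) + 2 * b\<^sup>2 * (v x * v x))"
    unfolding ip_def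
  proof (rule sum_mono)
    fix x
    have "0 \<le> (a * u x - b * v x)\<^sup>2" by simp
    then show "(a * u x + b * v x) * (a * u x + b * v x) \<le> 2 * a\<^sup>2 * (u x * u x) + 2 * b\<^sup>2 * (v x * v x)"
      by (simp add: power2_eq_square algebra_simps)
  qed
  then show ?thesis unfolding ip_def by (simp add: sum.distrib sum_distrib_left)
qed

text \<open>The constant in \<open>power_bounded\<close> is left free, so the property survives sums
  of functions from different invariant classes, where a norm bound with a sharp factor would not.
  \<open>power_bounded_norm\<close> recovers the sharp factor afterwards.\<close>

lemma power_bounded_add:
  assumes T: "linop T" and u: "power_bounded T t u" and v: "power_bounded T t v" and "0 \<le> t"
  shows "power_bounded T t (\<lambda>x. a * u x + b * v x)"
proof -
  obtain C where C: "\<And>k. ip ((T ^^ k) u) ((T ^^ k) u) \<le> C * t ^ k" using u unfolding power_bounded_def by blast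
  obtain D where D: "\<And>k. ip ((T ^^ k) v) ((T ^^ k) v) \<le> D * t ^ k" using v unfolding power_bounded_def by blast
  have lin: "(T ^^ k) (\<lambda>x. a * u x + b * v x) x = a * (T ^^ k) u x + b * (T ^^ k) v x" if "x permutes X" for k x
    using that
  proof (induction k arbitrary: x)
    case (Suc k)
    have "T ((T ^^ k) (\<lambda>x. a * u x + b * v x)) x = T (\<lambda>x. a * (T ^^ k) u x + b * (T ^^ k) v x) x"
      by (rule linop_cong[OF T Suc.IH Suc.prems])
    then show ?case using linop_add[OF T Suc.prems] by simp
  qed simp
  have "ip ((T ^^ k) (\<lambda>x. a * u x + b * v x)) ((T ^^ k) (\<lambda>x. a * u x + b * v x)) \<le> (2 * a\<^sup>2 * C + 2 * b\<^sup>2 * D) * t ^ k" for k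
  proof -
    have "ip ((T ^^ k) (\<lambda>x. a * u x + b * v x)) ((T ^^ k) (\<lambda>x. a * u x + b * v x))
        = ip (\<lambda>x. a * (T ^^ k) u x + b * (T ^^ k) v x) (\<lambda>x. a * (T ^^ k) u x + b * (T ^^ k) v x)"
      by (rule ip_cong) (simp_all add: lin)
    also have "\<dots> \<le> 2 * a\<^sup>2 * ip ((T ^^ k) u) ((T ^^ k) u) + 2 * b\<^sup>2 * ip ((T ^^ k) v) ((T ^^ k) v)" by (rule ip_sq_add_le)
    also have "\<dots> \<le> 2 * a\<^sup>2 * (C * t ^ k) + 2 * b\<^sup>2 * (D * t ^ k)" using C D by (intro add_mono mult_left_mono) auto
    finally show ?thesis by (simp add: algebra_simps)
  qed
  then show ?thesis unfolding power_bounded_def by blast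
qed

lemma power_bounded_sum:
  assumes T: "linop T" and "finite I" "0 \<le> t" and u: "\<And>i. i \<in> I \<Longrightarrow> power_bounded T t (u i)"
  shows "power_bounded T t (\<lambda>x. \<Sum>i\<in>I. c i * u i x)"
  using assms(2) u
proof (induction I rule: finite_induct)
  case empty
  have "S (T v) \<and> ip (T v) (T v) \<le> t * ip v v" if "S v" "S = (\<lambda>v. \<forall>x. x permutes X \<longrightarrow> v x = 0)" for S v
  proof -
    have v0: "\<forall>x. x permutes X \<longrightarrow> v x = 0 * v x + 0 * v x" using that by simp
    have "T v x = 0" if x: "x permutes X" for x
    proof -
      have "T v x = T (\<lambda>x. 0 * v x + 0 * v x) x" by (rule linop_cong[OF T _ x]) (use v0 in blast)
      also have "\<dots> = 0 * T v x + 0 * T v x" by (rule linop_add[OF T x])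
      finally show ?thesis by simp
    qed
    then show ?thesis using that assms(3) by (simp add: ip_zero_left ip_nonneg)
  qed
  then show ?case by (intro power_bounded_invariant[where S = "\<lambda>v. \<forall>x. x permutes X \<longrightarrow> v x = 0"] assms(3)) auto
next
  case (insert i I)
  have "power_bounded T t (\<lambda>x. c i * u i x + 1 * (\<Sum>i\<in>I. c i * u i x))"
    using insert by (intro power_bounded_add[OF T _ _ assms(3)]) auto
  then show ?case using insert.hyps by simp
qed

lemma power_bounded_cong:
  assumes T: "linop T" and "power_bounded T t u" "\<And>x. x permutes X \<Longrightarrow> u x = v x"
  shows "power_bounded T t v"
proof -
  have "(T ^^ k) u x = (T ^^ k) v x" if "x permutes X" for k x
    using that
  proof (induction k arbitrary: x)
    case (Suc k)
    then show ?case using linop_cong[OF T Suc.IH] by simp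
  qed (simp add: assms(3))
  then have "ip ((T ^^ k) u) ((T ^^ k) u) = ip ((T ^^ k) v) ((T ^^ k) v)" for k by (intro ip_cong)
  then show ?thesis using assms(2) unfolding power_bounded_def by simp
qed

section \<open>Averages over alternating stabilisers and the averaged projection\<close>

lemma finite_alts: "finite (alts (X - D))"
  using finX by (intro finite_subset[OF _ finite_permutations[of "X - D"]]) auto

lemma alts_nonempty: "alts (X - D) \<noteq> {}"
  using evenperm_id permutes_id by blast

lemma alts_comp: "\<alpha> \<in> alts (X - D) \<Longrightarrow> \<beta> \<in> alts (X - D) \<Longrightarrow> \<alpha> \<circ> \<beta> \<in> alts (X - D)"
  using alts_perm[of \<alpha> D] alts_perm[of \<beta> D] by (auto simp: permutes_compose evenperm_comp permutation_perm)

lemma alts_inv: "\<alpha> \<in> alts (X - D) \<Longrightarrow> inv' \<alpha> \<in> alts (X - D)"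
  using alts_perm[of \<alpha> D] by (auto simp: permutes_inv evenperm_inv permutation_perm)

lemma avg_alts_left:
  assumes "\<alpha> \<in> alts (X - D)"
  shows "avg (alts (X - D)) (\<lambda>\<beta>. H (\<alpha> \<circ> \<beta>)) = avg (alts (X - D)) H"
  unfolding avg_def
  by (rule arg_cong[where f = "\<lambda>s. s / _"], rule sum.reindex_bij_witness[where i = "\<lambda>\<beta>. inv' \<alpha> \<circ> \<beta>" and j = "\<lambda>\<beta>. \<alpha> \<circ> \<beta>"])
     (use alts_comp[OF assms] alts_comp[OF alts_inv[OF assms]] comp_inv_cancel[OF alts_perm[OF assms]] in auto)

lemma avg_alts_right:
  assumes "\<alpha> \<in> alts (X - D)"
  shows "avg (alts (X - D)) (\<lambda>\<beta>. H (\<beta> \<circ> \<alpha>)) = avg (alts (X - D)) H"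
  unfolding avg_def
  by (rule arg_cong[where f = "\<lambda>s. s / _"], rule sum.reindex_bij_witness[where i = "\<lambda>\<beta>. \<beta> \<circ> inv' \<alpha>" and j = "\<lambda>\<beta>. \<beta> \<circ> \<alpha>"])
     (use alts_comp[OF _ assms] alts_comp[OF _ alts_inv[OF assms]] comp_inv_cancel[OF alts_perm[OF assms]] in auto)

lemma alt_avg_right: "\<alpha> \<in> alts (X - D) \<Longrightarrow> alt_avg D F z (w \<circ> \<alpha>) = alt_avg D F z w"
  unfolding alt_avg_def using avg_alts_left[of \<alpha> D "\<lambda>\<beta>. F (w \<circ> \<beta> \<circ> z)"] by (simp add: comp_assoc)

lemma alt_avg_left: "\<alpha> \<in> alts (X - D) \<Longrightarrow> alt_avg D F (\<alpha> \<circ> z) w = alt_avg D F z w"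
  unfolding alt_avg_def using avg_alts_right[of \<alpha> D "\<lambda>\<beta>. F (w \<circ> \<beta> \<circ> z)"] by (simp add: comp_assoc)

text \<open>Averaging over the subgroup is self-adjoint and fixes the invariant
  \<open>\<Psi>\<close>.\<close>

lemma sum_alt_avg:
  assumes \<Psi>: "\<And>u \<alpha>. u permutes X \<Longrightarrow> \<alpha> \<in> alts (X - D) \<Longrightarrow> \<Psi> (u \<circ> \<alpha>) = \<Psi> u"
  shows "(\<Sum>u\<in>P. \<Psi> u * F (u \<circ> z)) = (\<Sum>u\<in>P. \<Psi> u * alt_avg D F z u)"
proof -
  have "(\<Sum>u\<in>P. \<Psi> u * alt_avg D F z u) = avg (alts (X - D)) (\<lambda>\<alpha>. \<Sum>u\<in>P. \<Psi> u * F (u \<circ> \<alpha> \<circ> z))"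
    unfolding alt_avg_def avg_sum by (simp add: avg_cmult)
  also have "\<dots> = avg (alts (X - D)) (\<lambda>\<alpha>. \<Sum>u\<in>P. \<Psi> u * F (u \<circ> z))"
  proof (rule avg_cong)
    fix \<alpha> assume \<alpha>: "\<alpha> \<in> alts (X - D)"
    have "(\<Sum>u\<in>P. \<Psi> u * F (u \<circ> \<alpha> \<circ> z)) = (\<Sum>u\<in>P. \<Psi> (u \<circ> \<alpha>) * F (u \<circ> \<alpha> \<circ> z))"
      by (intro sum.cong refl) (use \<Psi> \<alpha> in auto)
    also have "\<dots> = (\<Sum>u\<in>P. \<Psi> u * F (u \<circ> z))"
      by (rule sum_permutations_compose_right[OF alts_perm[OF \<alpha>], of "\<lambda>u. \<Psi> u * F (u \<circ> z)", symmetric])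
    finally show "(\<Sum>u\<in>P. \<Psi> u * F (u \<circ> \<alpha> \<circ> z)) = (\<Sum>u\<in>P. \<Psi> u * F (u \<circ> z))" .
  qed
  also have "\<dots> = (\<Sum>u\<in>P. \<Psi> u * F (u \<circ> z))"
    by (rule avg_const[OF finite_alts alts_nonempty])
  finally show ?thesis ..
qed

text \<open>For \<open>z\<close> permuting \<open>X\<close>, the orthogonal projection onto the
  functions invariant on the right under the alternating stabiliser of the preimage of
  \<open>D\<close> under \<open>z\<close>.\<close>

definition proj :: "'a set \<Rightarrow> (('a \<Rightarrow> 'a) \<Rightarrow> real) \<Rightarrow> ('a \<Rightarrow> 'a) \<Rightarrow> ('a \<Rightarrow> 'a) \<Rightarrow> real" where
  "proj D F z x = alt_avg D F z (x \<circ> inv' z)"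

lemma ip_proj: "z permutes X \<Longrightarrow> ip (proj D F z) G = (\<Sum>w\<in>P. alt_avg D F z w * alt_avg D G z w)"
proof -
  assume z: "z permutes X"
  have "ip (proj D F z) G = (\<Sum>w\<in>P. alt_avg D F z (w \<circ> z \<circ> inv' z) * G (w \<circ> z))"
    unfolding ip_def proj_def by (rule sum_permutations_compose_right[OF z])
  also have "\<dots> = (\<Sum>w\<in>P. alt_avg D F z w * G (w \<circ> z))" by (simp add: comp_inv_cancel[OF z])
  also have "\<dots> = (\<Sum>w\<in>P. alt_avg D F z w * alt_avg D G z w)" by (rule sum_alt_avg) (rule alt_avg_right)
  finally show ?thesis .
qed

lemma ip_proj_proj:
  assumes z: "z permutes X"
  shows "ip (proj D F z) (proj D F z) = (\<Sum>w\<in>P. (alt_avg D F z w)\<^sup>2)"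
proof -
  have "ip (proj D F z) (proj D F z) = (\<Sum>w\<in>P. alt_avg D F z (w \<circ> z \<circ> inv' z) * alt_avg D F z (w \<circ> z \<circ> inv' z))"
    unfolding ip_def proj_def by (rule sum_permutations_compose_right[OF z])
  then show ?thesis by (simp add: comp_inv_cancel[OF z] power2_eq_square)
qed

lemma proj_complement_norm:
  assumes z: "z permutes X"
  shows "ip (\<lambda>x. u x - proj D u z x) (\<lambda>x. u x - proj D u z x) \<le> ip u u"
proof -
  let ?e = "proj D u z"
  have "ip (\<lambda>x. u x - ?e x) (\<lambda>x. u x - ?e x) = ip u u - 2 * ip ?e u + ip ?e ?e"
    unfolding ip_def by (simp add: algebra_simps sum.distrib sum_subtractf sum_distrib_left)
  also have "ip ?e u = ip ?e ?e" using ip_proj[OF z] ip_proj_proj[OF z] by (simp add: power2_eq_square)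
  finally show ?thesis using ip_nonneg[of ?e] by simp
qed

definition avg_proj :: "'a set \<Rightarrow> (('a \<Rightarrow> 'a) \<Rightarrow> real) \<Rightarrow> ('a \<Rightarrow> 'a) \<Rightarrow> real" where
  "avg_proj D F x = avg P (\<lambda>z. proj D F z x)"

lemma ip_avg_proj: "ip (avg_proj D F) G = (\<Sum>z\<in>P. \<Sum>w\<in>P. alt_avg D F z w * alt_avg D G z w) / fact (card X)"
proof -
  have "ip (avg_proj D F) G = (\<Sum>z\<in>P. ip (proj D F z) G) / fact (card X)"
    unfolding ip_def avg_proj_def avg_def cardP
    by (subst sum.swap) (simp add: sum_divide_distrib sum_distrib_right)
  then show ?thesis using ip_proj by simp
qed

lemma linop_avg_proj_complement: "linop (\<lambda>F x. F x - avg_proj D F x)"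
  unfolding linop_def
proof (intro conjI allI impI)
  fix a b :: real and u v :: "('a \<Rightarrow> 'a) \<Rightarrow> real" and x :: "'a \<Rightarrow> 'a" assume "x permutes X"
  have "avg_proj D (\<lambda>x. a * u x + b * v x) x = a * avg_proj D u x + b * avg_proj D v x"
    unfolding avg_proj_def proj_def alt_avg_def by (simp add: avg_add avg_cmult)
  then show "a * u x + b * v x - avg_proj D (\<lambda>x. a * u x + b * v x) x = a * (u x - avg_proj D u x) + b * (v x - avg_proj D v x)"
    by (simp add: algebra_simps)
next
  fix u v :: "('a \<Rightarrow> 'a) \<Rightarrow> real" and x :: "'a \<Rightarrow> 'a" assume uv: "\<forall>x. x permutes X \<longrightarrow> u x = v x" and x: "x permutes X"
  have "avg_proj D u x = avg_proj D v x"
    unfolding avg_proj_def proj_def alt_avg_def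
  proof (intro avg_cong)
    fix z \<alpha> assume "z \<in> P" and \<alpha>: "\<alpha> \<in> alts (X - D)"
    then have "x \<circ> inv' z \<circ> \<alpha> \<circ> z permutes X"
      by (intro permutes_compose permutes_inv x alts_perm[OF \<alpha>]) auto
    then show "u (x \<circ> inv' z \<circ> \<alpha> \<circ> z) = v (x \<circ> inv' z \<circ> \<alpha> \<circ> z)" using uv by blast
  qed
  then show "u x - avg_proj D u x = v x - avg_proj D v x" using uv x by simp
qed

lemma inverse_comp: "g permutes X \<Longrightarrow> h permutes X \<Longrightarrow> inv' (g \<circ> h) = inv' h \<circ> inv' g"
  by (rule o_inv_distrib[OF permutes_bij permutes_bij])

text \<open>The mean over all \<open>z\<close> commutes with right translations, so the invariance
  of \<open>u\<close> survives. A projection belonging to some \<open>z\<close> that carries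
  \<open>Q\<close> to \<open>D\<close> fixes \<open>u\<close>. A whole coset of (n-d)! such
  \<open>z\<close> drops out of the complement, and each remaining term has norm at most that of
  \<open>u\<close>.\<close>

lemma avg_proj_complement_bound:
  assumes D: "D \<subseteq> X" and Q: "Q \<subseteq> X" "card Q = card D"
    and u: "\<And>x \<alpha>. x permutes X \<Longrightarrow> \<alpha> \<in> alts (X - Q) \<Longrightarrow> u (x \<circ> \<alpha>) = u x"
  defines "B \<equiv> \<lambda>F x. F x - avg_proj D F x"
    and "t \<equiv> ((fact (card X) - fact (card X - card D)) / fact (card X))\<^sup>2"
  shows "\<And>x \<alpha>. x permutes X \<Longrightarrow> \<alpha> \<in> alts (X - Q) \<Longrightarrow> B u (x \<circ> \<alpha>) = B u x"
    and "ip (B u) (B u) \<le> t * ip u u"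
proof -
  fix x \<alpha> assume x: "x permutes X" and \<alpha>: "\<alpha> \<in> alts (X - Q)"
  note \<alpha>X = alts_perm[OF \<alpha>]
  have "avg_proj D u (x \<circ> \<alpha>) = avg P (\<lambda>z. proj D u (z \<circ> \<alpha>) (x \<circ> \<alpha>))"
    unfolding avg_proj_def by (rule avg_perms_right[OF \<alpha>X, symmetric])
  also have "\<dots> = avg P (\<lambda>z. proj D u z x)"
  proof (rule avg_cong)
    fix z assume "z \<in> P" then have z: "z permutes X" by simp
    have "u (x \<circ> inv' z \<circ> \<beta> \<circ> (z \<circ> \<alpha>)) = u (x \<circ> inv' z \<circ> \<beta> \<circ> z)" if "\<beta> \<in> alts (X - D)" for \<beta>
    proof -
      have "x \<circ> inv' z \<circ> \<beta> \<circ> z permutes X" by (intro permutes_compose permutes_inv x z alts_perm[OF that])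
      from u[OF this \<alpha>] show ?thesis by (simp add: comp_assoc)
    qed
    moreover have "x \<circ> \<alpha> \<circ> inv' (z \<circ> \<alpha>) = x \<circ> inv' z"
      unfolding inverse_comp[OF z \<alpha>X] by (simp add: comp_assoc comp_inv_cancel[OF \<alpha>X])
    ultimately show "proj D u (z \<circ> \<alpha>) (x \<circ> \<alpha>) = proj D u z x"
      unfolding proj_def alt_avg_def by (intro avg_cong) simp
  qed
  finally show "B u (x \<circ> \<alpha>) = B u x" unfolding B_def avg_proj_def using u[OF x \<alpha>] by simp
next
  have finQ: "finite Q" and finD: "finite D" using Q(1) D finX finite_subset by blast+
  obtain z0 where z0: "z0 permutes X" "z0 ` Q = D" using ex_permutes_image[OF finX Q(1) D Q(2)] by blast
  define Z where "Z = (\<lambda>\<rho>. \<rho> \<circ> z0) ` perms (X - D)"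
  have ZP: "Z \<subseteq> P" unfolding Z_def using z0(1) permutes_subset[of _ "X - D" X] by (auto intro!: permutes_compose)
  have "inj_on (\<lambda>\<rho>. \<rho> \<circ> z0) (perms (X - D))" by (rule inj_onI) (metis comp_inv_cancel(1)[OF z0(1)])
  then have cardZ: "real (card Z) = fact (card X - card D)"
    unfolding Z_def using finX D finD by (simp add: card_image card_permutations[OF refl] card_Diff_subset)
  have fixed: "proj D u z x = u x" if "z \<in> Z" "x permutes X" for z x
  proof -
    have z: "z permutes X" and zZ: "z \<in> Z" using that ZP by auto
    have "z ` Q = D"
    proof -
      obtain \<rho> where \<rho>: "\<rho> permutes X - D" "z = \<rho> \<circ> z0" using zZ unfolding Z_def by (elim imageE) auto
      have "\<rho> ` D = D" using permutes_not_in[OF \<rho>(1)] by force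
      then show ?thesis unfolding \<rho>(2) image_comp[symmetric] z0(2) by simp
    qed
    then have iz: "inv' z ` D = Q" using image_inv_f_f[OF permutes_inj[OF z], of Q] by simp
    have "u (x \<circ> inv' z \<circ> \<beta> \<circ> z) = u x" if \<beta>: "\<beta> \<in> alts (X - D)" for \<beta>
    proof -
      have "inv' z \<circ> \<beta> \<circ> inv' (inv' z) permutes X - inv' z ` D"
        using \<beta> permutes_conjugate[OF _ permutes_inv[OF z], of \<beta> D] by blast
      then have "inv' z \<circ> \<beta> \<circ> z permutes X - Q" by (simp add: permutes_inv_inv[OF z] iz)
      moreover have "evenperm (inv' z \<circ> \<beta> \<circ> z)"
        using \<beta> z permutes_inv[OF z] alts_perm[OF \<beta>]
        by (simp add: evenperm_comp evenperm_inv permutation_perm permutation_compose)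
      ultimately have "u (x \<circ> (inv' z \<circ> \<beta> \<circ> z)) = u x" using u[OF \<open>x permutes X\<close>] by blast
      then show ?thesis by (simp add: comp_assoc)
    qed
    then have "proj D u z x = avg (alts (X - D)) (\<lambda>_. u x)"
      unfolding proj_def alt_avg_def by (rule avg_cong)
    then show ?thesis by (simp only: avg_const[OF finite_alts alts_nonempty])
  qed
  let ?g = "fact (card X) :: real"
  let ?m = "card (P - Z)"
  have m: "real ?m = ?g - fact (card X - card D)"
    using card_Diff_subset[OF finite_subset[OF ZP finP] ZP] card_mono[OF finP ZP] cardZ cardP
    by (simp add: of_nat_diff)
  have pt: "(B u x)\<^sup>2 \<le> (\<Sum>z\<in>P - Z. (u x - proj D u z x)\<^sup>2) * ?m / ?g\<^sup>2" if x: "x permutes X" for x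
  proof -
    have "B u x = (\<Sum>z\<in>P. u x - proj D u z x) / ?g"
      unfolding B_def avg_proj_def avg_def cardP
      using cardP by (simp add: sum_subtractf diff_divide_distrib)
    also have "(\<Sum>z\<in>P. u x - proj D u z x) = (\<Sum>z\<in>P - Z. u x - proj D u z x)"
      by (rule sum.mono_neutral_right[OF finP]) (use fixed x in auto)
    finally have "(B u x)\<^sup>2 = (\<Sum>z\<in>P - Z. u x - proj D u z x)\<^sup>2 / ?g\<^sup>2" by (simp add: power_divide)
    then show ?thesis using sum_squared_le_sum_of_squares[of "\<lambda>z. u x - proj D u z x" "P - Z"] by (simp add: divide_right_mono)
  qed
  have "ip (B u) (B u) = (\<Sum>x\<in>P. (B u x)\<^sup>2)" by (simp add: ip_def power2_eq_square)
  also have "\<dots> \<le> (\<Sum>x\<in>P. (\<Sum>z\<in>P - Z. (u x - proj D u z x)\<^sup>2) * ?m / ?g\<^sup>2)" by (intro sum_mono pt) auto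
  also have "\<dots> = (\<Sum>z\<in>P - Z. ip (\<lambda>x. u x - proj D u z x) (\<lambda>x. u x - proj D u z x)) * ?m / ?g\<^sup>2"
    unfolding ip_def by (subst sum.swap) (simp add: sum_divide_distrib sum_distrib_right power2_eq_square)
  also have "\<dots> \<le> (\<Sum>z\<in>P - Z. ip u u) * ?m / ?g\<^sup>2"
    by (intro divide_right_mono mult_right_mono sum_mono proj_complement_norm) auto
  also have "\<dots> = t * ip u u" unfolding t_def by (simp add: m power_divide power2_eq_square)
  finally show "ip (B u) (B u) \<le> t * ip u u" .
qed

text \<open>The complement of the averaged projection contracts every coset indicator by the factor
  \<open>q = 1 - (n - d)!/n!\<close>, hence all low functions, by the growth argument.\<close>

theorem low_norm_le:
  assumes D: "D \<subseteq> X" and F: "low (card D) F"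
  shows "ip F F \<le> (\<Sum>z\<in>P. \<Sum>w\<in>P. (alt_avg D F z w)\<^sup>2) / fact (card X - card D)"
proof -
  define B where "B F x = F x - avg_proj D F x" for F x
  let ?g = "fact (card X) :: real" and ?m = "fact (card X - card D) :: real"
  define q where "q = (?g - ?m) / ?g"
  have mg: "?m \<le> ?g" by (intro fact_mono) simp
  then have q0: "0 \<le> q" unfolding q_def by simp
  have linB: "linop B" unfolding B_def[abs_def] by (rule linop_avg_proj_complement)
  have saB: "ip (B u) v = ip u (B v)" for u v
    unfolding B_def by (simp add: ip_diff_left ip_avg_proj ip_commute[of u] mult.commute)
  obtain c where c: "\<And>x. x permutes X \<Longrightarrow> F x = (\<Sum>i\<in>cosets (card D). c i * coset_ind (fst i) (snd i) x)"
    using low_representation[OF F] by blast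
  have "power_bounded B (q\<^sup>2) (coset_ind (fst i) (snd i))" if i: "i \<in> cosets (card D)" for i
  proof -
    have Q: "fst i \<subseteq> X" "card (fst i) \<le> card D" "snd i permutes X" using i by (auto simp: cosets_def)
    have "card D \<le> card X" using D finX by (intro card_mono)
    \<comment> \<open>The contraction is stated for stabilisers of exactly \<open>card D\<close>
      points, so smaller sets are enlarged; invariance only weakens.\<close>
    then obtain Q' where Q': "fst i \<subseteq> Q'" "Q' \<subseteq> X" "card Q' = card D"
      using exists_subset_between[OF Q(2) _ Q(1) finX] by blast
    define S where "S u \<longleftrightarrow> (\<forall>x \<alpha>. x permutes X \<longrightarrow> \<alpha> \<in> alts (X - Q') \<longrightarrow> u (x \<circ> \<alpha>) = u x)" for u :: "('a \<Rightarrow> 'a) \<Rightarrow> real"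
    have "S (B u) \<and> ip (B u) (B u) \<le> q\<^sup>2 * ip u u" if "S u" for u
      using avg_proj_complement_bound[OF D Q'(2,3), of u] that unfolding S_def B_def[abs_def] q_def by blast
    moreover have "S (coset_ind (fst i) (snd i))"
      unfolding S_def
    proof (intro allI impI)
      fix x \<alpha> assume x: "x permutes X" and \<alpha>: "\<alpha> \<in> alts (X - Q')"
      have \<alpha>': "\<alpha> \<in> alts (X - fst i)" using \<alpha> Q'(1) permutes_subset[of \<alpha> "X - Q'" "X - fst i"] by auto
      have "x \<circ> \<alpha> \<in> (\<lambda>\<alpha>. snd i \<circ> \<alpha>) ` alts (X - fst i) \<longleftrightarrow> x \<in> (\<lambda>\<alpha>. snd i \<circ> \<alpha>) ` alts (X - fst i)"
      proof
        assume "x \<circ> \<alpha> \<in> (\<lambda>\<alpha>. snd i \<circ> \<alpha>) ` alts (X - fst i)"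
        then obtain \<beta> where \<beta>: "\<beta> \<in> alts (X - fst i)" "x \<circ> \<alpha> = snd i \<circ> \<beta>" by (elim imageE)
        have "x = x \<circ> \<alpha> \<circ> inv' \<alpha>" by (simp only: comp_inv_cancel(1)[OF alts_perm[OF \<alpha>']])
        also have "\<dots> = snd i \<circ> (\<beta> \<circ> inv' \<alpha>)" by (simp only: \<beta>(2) comp_assoc)
        finally show "x \<in> (\<lambda>\<alpha>. snd i \<circ> \<alpha>) ` alts (X - fst i)"
          using alts_comp[OF \<beta>(1) alts_inv[OF \<alpha>']] by (rule image_eqI)
      next
        assume "x \<in> (\<lambda>\<alpha>. snd i \<circ> \<alpha>) ` alts (X - fst i)"
        then obtain \<beta> where \<beta>: "\<beta> \<in> alts (X - fst i)" "x = snd i \<circ> \<beta>" by (elim imageE)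
        have "x \<circ> \<alpha> = snd i \<circ> (\<beta> \<circ> \<alpha>)" by (simp only: \<beta>(2) comp_assoc)
        then show "x \<circ> \<alpha> \<in> (\<lambda>\<alpha>. snd i \<circ> \<alpha>) ` alts (X - fst i)"
          using alts_comp[OF \<beta>(1) \<alpha>'] by (rule image_eqI)
      qed
      then show "coset_ind (fst i) (snd i) (x \<circ> \<alpha>) = coset_ind (fst i) (snd i) x"
        unfolding coset_ind_def indicator_def by simp
    qed
    ultimately show ?thesis by (intro power_bounded_invariant[where S = S]) auto
  qed
  then have "power_bounded B (q\<^sup>2) (\<lambda>x. \<Sum>i\<in>cosets (card D). c i * coset_ind (fst i) (snd i) x)"
    by (intro power_bounded_sum[OF linB finite_cosets]) auto
  then have "power_bounded B (q\<^sup>2) F" by (rule power_bounded_cong[OF linB]) (simp add: c)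
  then have "ip (B F) (B F) \<le> q\<^sup>2 * ip F F" by (intro power_bounded_norm saB) auto
  \<comment> \<open>Cauchy-Schwarz turns the norm bound for \<open>B\<close> into a bound for its
    quadratic form, whose complement in \<open>ip F F\<close> is the form of the averaged
    projection.\<close>
  then have "(ip (B F) F)\<^sup>2 \<le> (q\<^sup>2 * ip F F) * ip F F"
    by (intro order_trans[OF ip_Cauchy_Schwarz] mult_right_mono ip_nonneg)
  then have "(ip (B F) F)\<^sup>2 \<le> (q * ip F F)\<^sup>2"
    by (simp add: power_mult_distrib power2_eq_square[of "ip F F"] mult.assoc)
  then have "ip (B F) F \<le> q * ip F F"
    by (rule power2_le_imp_le[OF _ mult_nonneg_nonneg[OF q0 ip_nonneg]])
  moreover have "ip (B F) F = ip F F - ip (avg_proj D F) F" unfolding B_def by (simp add: ip_diff_left)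
  moreover have "q * ip F F = ip F F - ?m / ?g * ip F F" unfolding q_def by (simp add: diff_divide_distrib left_diff_distrib)
  ultimately have "?m / ?g * ip F F \<le> ip (avg_proj D F) F" by linarith
  also have "\<dots> = (\<Sum>z\<in>P. \<Sum>w\<in>P. (alt_avg D F z w)\<^sup>2) / ?g" unfolding ip_avg_proj by (simp add: power2_eq_square)
  finally have "?m * ip F F / ?g \<le> (\<Sum>z\<in>P. \<Sum>w\<in>P. (alt_avg D F z w)\<^sup>2) / ?g" by simp
  then have "?m * ip F F \<le> (\<Sum>z\<in>P. \<Sum>w\<in>P. (alt_avg D F z w)\<^sup>2)"
    by (subst (asm) divide_le_cancel) simp
  then show ?thesis by (subst pos_le_divide_eq) (simp_all add: mult.commute)
qed

section \<open>Convolution, levels and kernels\<close>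

lemma conv_alt:
  assumes x: "x permutes X"
  shows "conv f F x = (\<Sum>v\<in>P. f v * F (inv' v \<circ> x))"
  unfolding conv_def
proof (rule sum.reindex_bij_witness[where i = "\<lambda>v. inv' v \<circ> x" and j = "\<lambda>y. x \<circ> inv' y"])
  fix y assume "y \<in> P" then have y: "y permutes X" by simp
  have iy: "inv' y permutes X" "inv' (inv' y) = y" using permutes_inv[OF y] permutes_inv_inv[OF y] by auto
  show "inv' (x \<circ> inv' y) \<circ> x = y" "x \<circ> inv' (inv' y \<circ> x) = y"
    by (simp_all add: inverse_comp x iy comp_assoc comp_inv_cancel[OF x] permutes_inv_o[OF x])
  show "x \<circ> inv' y \<in> P" "inv' y \<circ> x \<in> P" using x iy permutes_compose by auto
  show "f (x \<circ> inv' y) * F (inv' (x \<circ> inv' y) \<circ> x) = f (x \<circ> inv' y) * F y"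
    by (simp add: inverse_comp x iy comp_assoc comp_inv_cancel[OF x] permutes_inv_o[OF x])
qed

text \<open>A convolution is a linear combination of right translates of its first factor and, by
  \<open>conv_alt\<close>, of left translates of its second; so it inherits the level of either
  one.\<close>

lemma conv_orth_left: "orth d f \<Longrightarrow> orth d (conv f F)"
  unfolding conv_def[abs_def] mult.commute[of "f _"] by (intro orth_lincomb orth_right permutes_inv) auto

lemma conv_low_left: "low d f \<Longrightarrow> low d (conv f F)"
  unfolding conv_def[abs_def] mult.commute[of "f _"] by (intro low_lincomb low_right permutes_inv) auto

lemma conv_orth_right: "orth d F \<Longrightarrow> orth d (conv f F)"
  by (rule orth_cong[of d "\<lambda>x. \<Sum>v\<in>P. f v * F (inv' v \<circ> x)"]) (auto simp: conv_alt intro!: orth_lincomb orth_left permutes_inv)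

lemma conv_low_right: "low d F \<Longrightarrow> low d (conv f F)"
  by (rule low_cong[of d "\<lambda>x. \<Sum>v\<in>P. f v * F (inv' v \<circ> x)"]) (auto simp: conv_alt intro!: low_lincomb low_left permutes_inv)

text \<open>In the variables \<open>z\<close>, \<open>w\<close> the averages form a matrix, and
  convolution becomes the matrix product; the stabiliser average can be inserted in the middle by
  \<open>sum_alt_avg\<close>.\<close>

lemma alt_avg_conv:
  assumes z: "z permutes X"
  shows "alt_avg D (conv f F) z w = (\<Sum>u\<in>P. alt_avg D f (inv' u) w * alt_avg D F z u)"
proof -
  have "conv f F (w \<circ> \<alpha> \<circ> z) = (\<Sum>u\<in>P. f (w \<circ> \<alpha> \<circ> inv' u) * F (u \<circ> z))" for \<alpha>
  proof -
    have "conv f F (w \<circ> \<alpha> \<circ> z) = (\<Sum>u\<in>P. f (w \<circ> \<alpha> \<circ> z \<circ> inv' (u \<circ> z)) * F (u \<circ> z))"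
      unfolding conv_def by (rule sum_permutations_compose_right[OF z])
    then show ?thesis by (simp add: inverse_comp z comp_assoc comp_inv_cancel[OF z])
  qed
  then have "alt_avg D (conv f F) z w = (\<Sum>u\<in>P. alt_avg D f (inv' u) w * F (u \<circ> z))"
    unfolding alt_avg_def by (simp add: avg_sum avg_cmult_right)
  also have "\<dots> = (\<Sum>u\<in>P. alt_avg D f (inv' u) w * alt_avg D F z u)"
  proof (rule sum_alt_avg)
    fix u \<alpha> assume u: "u permutes X" and \<alpha>: "\<alpha> \<in> alts (X - D)"
    show "alt_avg D f (inv' (u \<circ> \<alpha>)) w = alt_avg D f (inv' u) w"
      unfolding inverse_comp[OF u alts_perm[OF \<alpha>]] by (rule alt_avg_left[OF alts_inv[OF \<alpha>]])
  qed
  finally show ?thesis .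
qed

text \<open>Submultiplicativity of the Hilbert-Schmidt norm for the matrix product in
  \<open>alt_avg_conv\<close>.\<close>

lemma alt_avg_conv_norm:
  "(\<Sum>z\<in>P. \<Sum>w\<in>P. (alt_avg D (conv f F) z w)\<^sup>2)
    \<le> (\<Sum>z\<in>P. \<Sum>w\<in>P. (alt_avg D f z w)\<^sup>2) * (\<Sum>z\<in>P. \<Sum>w\<in>P. (alt_avg D F z w)\<^sup>2)"
proof -
  have "(\<Sum>z\<in>P. \<Sum>w\<in>P. (alt_avg D (conv f F) z w)\<^sup>2)
     \<le> (\<Sum>z\<in>P. \<Sum>w\<in>P. (\<Sum>u\<in>P. (alt_avg D f (inv' u) w)\<^sup>2) * (\<Sum>u\<in>P. (alt_avg D F z u)\<^sup>2))"
    by (intro sum_mono) (simp add: alt_avg_conv Cauchy_Schwarz_ineq_sum)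
  also have "\<dots> = (\<Sum>w\<in>P. \<Sum>u\<in>P. (alt_avg D f (inv' u) w)\<^sup>2) * (\<Sum>z\<in>P. \<Sum>w\<in>P. (alt_avg D F z w)\<^sup>2)"
    by (subst sum.swap) (simp add: sum_product)
  also have "(\<Sum>w\<in>P. \<Sum>u\<in>P. (alt_avg D f (inv' u) w)\<^sup>2) = (\<Sum>u\<in>P. \<Sum>w\<in>P. (alt_avg D f (inv' u) w)\<^sup>2)"
    by (rule sum.swap)
  also have "\<dots> = (\<Sum>z\<in>P. \<Sum>w\<in>P. (alt_avg D f z w)\<^sup>2)"
    by (rule sum_permutations_inverse[of "\<lambda>z. \<Sum>w\<in>P. (alt_avg D f z w)\<^sup>2", symmetric])
  finally show ?thesis .
qed

end

section \<open>Lower bounds for signed differences\<close>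

abbreviation tswap :: "'a \<Rightarrow> 'a \<Rightarrow> 'a \<Rightarrow> 'a" where
  "tswap \<equiv> Transposition.transpose"

locale paired_space = pairing \<theta> + sym_space X for \<theta> :: "'a \<Rightarrow> 'a" and X :: "'a set"
begin

text \<open>Such a function depends only on the values of \<open>x\<close> on \<open>K\<close> and
  averages to zero as soon as one point of \<open>K\<close> is released: the analogue of a
  homogeneous polynomial of degree \<open>card K\<close>.\<close>

definition pure :: "'a set \<Rightarrow> (('a \<Rightarrow> 'a) \<Rightarrow> real) \<Rightarrow> bool" where
  "pure K u \<longleftrightarrow> (\<forall>x \<alpha>. x permutes X \<longrightarrow> \<alpha> permutes X - K \<longrightarrow> u (x \<circ> \<alpha>) = u x) \<and>
     (\<forall>s x. s \<in> K \<longrightarrow> x permutes X \<longrightarrow> (\<Sum>\<alpha>\<in>perms (X - (K - {s})). u (x \<circ> \<alpha>)) = 0)"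

lemma pure_invariant: "pure K u \<Longrightarrow> x permutes X \<Longrightarrow> \<alpha> permutes X - K \<Longrightarrow> u (x \<circ> \<alpha>) = u x"
  unfolding pure_def by blast

lemma pure_lincomb: "(\<And>i. i \<in> I \<Longrightarrow> pure K (u i)) \<Longrightarrow> pure K (\<lambda>x. \<Sum>i\<in>I. c i * u i x)"
  unfolding pure_def by (subst sum.swap) (simp flip: sum_distrib_left)

text \<open>The swaps of \<open>s\<close> with itself and with the points outside \<open>K\<close>
  represent the cosets of the stabiliser of \<open>K\<close> in that of \<open>K - {s}\<close>, and
  \<open>u\<close> is constant on each.\<close>

lemma pure_swap_sum:
  assumes u: "pure K u" and s: "s \<in> K" "K \<subseteq> X" and y: "y permutes X"
  shows "(\<Sum>b\<in>insert s (X - K). u (y \<circ> tswap s b)) = 0"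
proof -
  let ?C = "X - K"
  have finC: "finite ?C" using finX by simp
  have "X - (K - {s}) = insert s ?C" using s by auto
  then have "0 = (\<Sum>\<alpha>\<in>perms (insert s ?C). u (y \<circ> \<alpha>))" using u s y unfolding pure_def by metis
  also have "\<dots> = (\<Sum>b\<in>insert s ?C. \<Sum>q\<in>perms ?C. u (y \<circ> (tswap s b \<circ> q)))"
    using s finC by (intro sum_over_permutations_insert) auto
  also have "\<dots> = (\<Sum>b\<in>insert s ?C. \<Sum>q\<in>perms ?C. u (y \<circ> tswap s b))"
  proof (intro sum.cong refl)
    fix b q assume b: "b \<in> insert s ?C" and q: "q \<in> perms ?C"
    have "y \<circ> tswap s b permutes X" using b s y by (intro permutes_compose permutes_swap_id) auto
    from pure_invariant[OF u this] q show "u (y \<circ> (tswap s b \<circ> q)) = u (y \<circ> tswap s b)"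
      by (simp add: comp_assoc)
  qed
  also have "\<dots> = fact (card ?C) * (\<Sum>b\<in>insert s ?C. u (y \<circ> tswap s b))"
    using finC by (simp add: card_permutations[OF refl] sum_distrib_left)
  finally show ?thesis by simp
qed

text \<open>Expanding along the swaps of one new coordinate \<open>s\<close> produces the sums
  \<open>1 + (s i\<^sub>1) + (s i\<^sub>2) + \<dots>\<close>, whose product over all coordinates (as for Jucys--Murphy elements)
  is the sum over the full symmetric group on \<open>T\<close>; the latter is positive semidefinite.\<close>

lemma pure_tau_correlation:
  assumes K: "paired X K" and u: "pure K u"
  shows "finite T \<Longrightarrow> T \<subseteq> K \<Longrightarrow> \<exists>c>0. \<forall>v. (\<forall>x \<alpha>. x permutes X \<longrightarrow> \<alpha> permutes X - K \<longrightarrow> v (x \<circ> \<alpha>) = v x) \<longrightarrow>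
    ip v (\<lambda>x. u (x \<circ> tau T)) = (-1) ^ card T * c * (\<Sum>\<beta>\<in>perms T. ip v (\<lambda>x. u (x \<circ> \<beta>)))"
proof (induction T rule: finite_induct)
  case empty
  have "tau {} = id" by (auto simp: tau_def)
  then show ?case by (intro exI[of _ 1]) simp
next
  case (insert s T)
  let ?C = "X - K"
  let ?inv = "\<lambda>v::('a \<Rightarrow> 'a) \<Rightarrow> real. \<forall>x \<alpha>. x permutes X \<longrightarrow> \<alpha> permutes X - K \<longrightarrow> v (x \<circ> \<alpha>) = v x"
  have finC: "finite ?C" using finX by simp
  have KX: "K \<subseteq> X" using K unfolding paired_def by blast
  have s: "s \<in> K" "s \<notin> T" "T \<subseteq> K" using insert by auto
  obtain c where c: "c > 0" and IH: "\<And>v. ?inv v \<Longrightarrow> ip v (\<lambda>x. u (x \<circ> tau T)) = (-1) ^ card T * c * (\<Sum>\<beta>\<in>perms T. ip v (\<lambda>x. u (x \<circ> \<beta>)))"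
    using insert.IH[OF s(3)] by blast
  have nK: "\<theta> i \<in> ?C" if "i \<in> K" for i using paired_not_both[OF K that] paired_mem[OF K that] by simp
  have inj: "inj \<theta>" by (rule injI) (metis \<theta>\<theta>)
  \<comment> \<open>The number of \<open>b\<close> whose swap with \<open>s\<close> is disjoint from
    \<open>tau T\<close>. They all give the wanted term, so solving the zero sum for it divides by
    \<open>k\<close>.\<close>
  define k where "k = card (?C - \<theta> ` T)"
  have "\<theta> s \<in> ?C - \<theta> ` T" using nK[OF s(1)] s(2) by simp
  then have "?C - \<theta> ` T \<noteq> {}" by blast
  then have k: "0 < k" unfolding k_def using finC by (subst card_gt_0_iff) (intro conjI finite_Diff finX)
  have tauT: "tau T permutes X" using paired_tau_permutes[OF K s(3)] .
  show ?case
  proof (intro exI[of _ "c / k"] conjI allI impI)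
    show "0 < c / k" using c k by simp
    fix v :: "('a \<Rightarrow> 'a) \<Rightarrow> real" assume v: "?inv v"
    define Z where "Z = ip v (\<lambda>x. u (x \<circ> tau (insert s T)))"
    let ?h = "\<lambda>b. ip v (\<lambda>x. u (x \<circ> tau T \<circ> tswap s b))"
    have zero: "(\<Sum>b\<in>insert s ?C. ?h b) = 0"
    proof -
      have "(\<Sum>b\<in>insert s ?C. ?h b) = ip v (\<lambda>x. \<Sum>b\<in>insert s ?C. u (x \<circ> tau T \<circ> tswap s b))"
        by (simp add: ip_commute[of v] ip_sum_left)
      also have "\<dots> = ip v (\<lambda>x. 0)"
        by (rule ip_cong) (simp_all add: pure_swap_sum[OF u s(1) KX permutes_compose[OF tauT]])
      finally show ?thesis by (simp add: ip_def)
    qed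
    \<comment> \<open>The transposition of \<open>b\<close> and \<open>\<theta> s\<close> lies
      outside \<open>K\<close> and commutes with \<open>tau T\<close>; it is absorbed by
      \<open>u\<close> and \<open>v\<close> and moves \<open>b\<close> to
      \<open>\<theta> s\<close>.\<close>
    have outer: "?h b = Z" if b: "b \<in> ?C - \<theta> ` T" for b
    proof -
      define \<eta> where "\<eta> = tswap b (\<theta> s)"
      have \<eta>C: "\<eta> permutes X - K" unfolding \<eta>_def using b nK[OF s(1)] by (intro permutes_swap_id) auto
      have \<eta>X: "\<eta> permutes X" using permutes_subset[OF \<eta>C] by blast
      have \<eta>b: "\<eta> permutes {b, \<theta> s}" unfolding \<eta>_def by (intro permutes_swap_id) auto
      have "{b, \<theta> s} \<inter> (T \<union> \<theta> ` T) = {}" using b nK[OF s(1)] s by auto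
      then have com: "\<eta> \<circ> tau T = tau T \<circ> \<eta>" by (rule tau_commute[OF \<eta>b])
      have "s \<noteq> b" "s \<noteq> \<theta> s" using b s nK[OF s(1)] by auto
      then have "tswap s b = \<eta> \<circ> tswap s (\<theta> s) \<circ> \<eta>"
        unfolding \<eta>_def by (auto simp: fun_eq_iff Transposition.transpose_def)
      then have "tau T \<circ> tswap s b = \<eta> \<circ> (tau T \<circ> tswap s (\<theta> s)) \<circ> \<eta>"
        using com by (metis comp_assoc)
      moreover have tau_ins: "tau T \<circ> tswap s (\<theta> s) = tau (insert s T)"
      proof
        fix x
        have "\<theta> x \<in> T \<Longrightarrow> x \<notin> T" "\<theta> s \<notin> T" "s \<notin> T"
          using nK s by (metis DiffD2 \<theta>\<theta> subsetD)+
        moreover have "\<theta> x = s \<longleftrightarrow> x = \<theta> s" by auto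
        ultimately show "(tau T \<circ> tswap s (\<theta> s)) x = tau (insert s T) x"
          using \<open>s \<noteq> \<theta> s\<close> by (auto simp: tau_def Transposition.transpose_def)
      qed
      ultimately have e: "x \<circ> tau T \<circ> tswap s b = (x \<circ> \<eta>) \<circ> tau (insert s T) \<circ> \<eta>" for x :: "'a \<Rightarrow> 'a"
        by (metis comp_assoc)
      have tauS: "tau (insert s T) permutes X" using paired_tau_permutes[OF K, of "insert s T"] s by simp
      have "?h b = ip v (\<lambda>x. u ((x \<circ> \<eta>) \<circ> tau (insert s T)))"
        unfolding e by (rule ip_cong[OF refl], rule pure_invariant[OF u _ \<eta>C]) (intro permutes_compose \<eta>X tauS)
      also have "\<dots> = ip (\<lambda>x. v (x \<circ> \<eta>)) (\<lambda>x. u ((x \<circ> \<eta>) \<circ> tau (insert s T)))"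
        by (rule ip_cong) (use v \<eta>C in auto)
      also have "\<dots> = Z" unfolding Z_def by (rule ip_right_translate[OF \<eta>X, of v "\<lambda>x. u (x \<circ> tau (insert s T))"])
      finally show ?thesis .
    qed
    let ?S = "\<lambda>i. (-1) ^ card T * c * (\<Sum>\<beta>\<in>perms T. ip v (\<lambda>x. u (x \<circ> (tswap s i \<circ> \<beta>))))"
    \<comment> \<open>The swap of \<open>s\<close> and \<open>i\<close> lies inside \<open>K\<close>
      and is transferred to \<open>v\<close>, which keeps its invariance. This is why the induction
      hypothesis is stated for every invariant \<open>v\<close>.\<close>
    have moved: "ip v (\<lambda>x. u (x \<circ> tswap s i \<circ> tau T)) = ?S i" if i: "i \<in> insert s T" for i
    proof -
      let ?g = "tswap s i"
      have gK: "?g permutes K" using i s by (intro permutes_swap_id) auto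
      have gX: "?g permutes X" by (rule permutes_subset[OF gK KX])
      define v' where "v' x = v (x \<circ> inv' ?g)" for x
      have move: "ip v (\<lambda>x. U (x \<circ> ?g)) = ip v' U" for U
        unfolding v'_def using ip_right_move[OF gX, of U v] by (simp add: ip_commute)
      have "?inv v'"
      proof (intro allI impI)
        fix x \<alpha> assume x: "x permutes X" and \<alpha>: "\<alpha> permutes X - K"
        have "\<alpha> \<circ> inv' ?g = inv' ?g \<circ> \<alpha>" by (rule permutes_disjoint_commute[OF \<alpha> permutes_inv[OF gK]]) blast
        then have "x \<circ> \<alpha> \<circ> inv' ?g = (x \<circ> inv' ?g) \<circ> \<alpha>" by (simp only: comp_assoc)
        then show "v' (x \<circ> \<alpha>) = v' x"
          unfolding v'_def using v \<alpha> permutes_compose[OF permutes_inv[OF gX] x] by simp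
      qed
      from IH[OF this] show ?thesis
        using move[of "\<lambda>x. u (x \<circ> tau T)"] move[of "\<lambda>x. u (x \<circ> _)"] by (simp add: comp_assoc)
    qed
    \<comment> \<open>Moving \<open>tau T\<close> past the swap turns the partner
      \<open>\<theta> i\<close> into \<open>i\<close> itself.\<close>
    have "?h (\<theta> i) = ?S i" if i: "i \<in> T" for i
    proof -
      have "tau T \<circ> tswap s (\<theta> i) = tswap s i \<circ> tau T"
      proof
        fix x
        have iK: "i \<in> K" using i s by auto
        have ne: "s \<noteq> i" "s \<noteq> \<theta> i" "i \<noteq> \<theta> i" "\<theta> s \<notin> T" using s i nK[OF s(1)] nK[OF iK] by auto
        have "\<theta> x = i \<longleftrightarrow> x = \<theta> i" "\<theta> x = s \<longleftrightarrow> x = \<theta> s" by auto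
        moreover have "\<theta> x \<notin> K" if "x \<in> T" using nK[of x] s(3) that by auto
        moreover have "x \<notin> K" if "\<theta> x \<in> T" using nK[of "\<theta> x"] s(3) that by auto
        ultimately show "(tau T \<circ> tswap s (\<theta> i)) x = (tswap s i \<circ> tau T) x"
          using ne i s by (auto simp: tau_def Transposition.transpose_def)
      qed
      then have "x \<circ> tau T \<circ> tswap s (\<theta> i) = x \<circ> tswap s i \<circ> tau T" for x :: "'a \<Rightarrow> 'a" by (metis comp_assoc)
      then show ?thesis using moved[of i] i by simp
    qed
    moreover have "?h s = ?S s" using moved[of s] by simp
    moreover have "(\<Sum>b\<in>insert s ?C. ?h b) = ?h s + ((\<Sum>i\<in>T. ?h (\<theta> i)) + k * Z)"
    proof -
      have "\<theta> ` T \<subseteq> ?C" using nK s by auto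
      then have "(\<Sum>b\<in>?C. ?h b) = (\<Sum>b\<in>?C - \<theta> ` T. ?h b) + (\<Sum>b\<in>\<theta> ` T. ?h b)"
        by (rule sum.subset_diff[OF _ finC])
      also have "(\<Sum>b\<in>\<theta> ` T. ?h b) = (\<Sum>i\<in>T. ?h (\<theta> i))"
        by (rule sum.reindex_cong[OF inj_on_subset[OF inj]]) auto
      also have "(\<Sum>b\<in>?C - \<theta> ` T. ?h b) = (\<Sum>b\<in>?C - \<theta> ` T. Z)"
        by (rule sum.cong[OF refl outer])
      also have "(\<Sum>b\<in>?C - \<theta> ` T. Z) = k * Z" by (simp add: k_def)
      finally have "(\<Sum>b\<in>?C. ?h b) = k * Z + (\<Sum>i\<in>T. ?h (\<theta> i))" .
      moreover have "(\<Sum>b\<in>insert s ?C. ?h b) = ?h s + (\<Sum>b\<in>?C. ?h b)"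
        by (rule sum.insert[OF finC]) (use s in simp)
      ultimately show ?thesis by linarith
    qed
    ultimately have "k * Z = - (\<Sum>i\<in>insert s T. ?S i)" using zero insert.hyps by simp
    also have "(\<Sum>i\<in>insert s T. ?S i) = (-1) ^ card T * c * (\<Sum>\<beta>\<in>perms (insert s T). ip v (\<lambda>x. u (x \<circ> \<beta>)))"
      unfolding sum_over_permutations_insert[OF insert.hyps] by (simp add: sum_distrib_left)
    finally have "Z = - ((-1) ^ card T * c * (\<Sum>\<beta>\<in>perms (insert s T). ip v (\<lambda>x. u (x \<circ> \<beta>)))) / k"
      using k by (simp add: field_simps)
    then show "ip v (\<lambda>x. u (x \<circ> tau (insert s T))) = (-1) ^ card (insert s T) * (c / k) * (\<Sum>\<beta>\<in>perms (insert s T). ip v (\<lambda>x. u (x \<circ> \<beta>)))"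
      unfolding Z_def using insert.hyps by simp
  qed
qed

text \<open>Each correlation, taken with its sign, is a positive multiple of the squared norm of the
  sum of \<open>u (x \<circ> \<beta>)\<close> over \<open>\<beta> \<in> perms T\<close>, hence
  nonnegative; the empty \<open>T\<close> alone contributes \<open>ip u u\<close>.\<close>

lemma pure_norm_le:
  assumes K: "paired X K" and u: "pure K u"
  shows "ip u u \<le> ip u (\<lambda>x. \<Sum>T\<in>Pow K. (-1) ^ card T * u (x \<circ> tau T))"
proof -
  have KX: "K \<subseteq> X" using K unfolding paired_def by blast
  have finK: "finite K" using KX finX finite_subset by blast
  have nn: "0 \<le> (-1) ^ card T * ip u (\<lambda>x. u (x \<circ> tau T))" if T: "T \<in> Pow K" for T
  proof -
    have finT: "finite T" using T finK finite_subset by auto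
    obtain c where c: "c > 0" and e: "ip u (\<lambda>x. u (x \<circ> tau T)) = (-1) ^ card T * c * (\<Sum>\<beta>\<in>perms T. ip u (\<lambda>x. u (x \<circ> \<beta>)))"
      using pure_tau_correlation[OF K u finT] T u unfolding pure_def by blast
    let ?s = "\<lambda>x. \<Sum>\<beta>\<in>perms T. u (x \<circ> \<beta>)"
    have pX: "\<beta> permutes X" if "\<beta> \<in> perms T" for \<beta> using that T KX permutes_subset[of \<beta> T X] by auto
    have "ip ?s ?s = (\<Sum>\<gamma>\<in>perms T. \<Sum>\<beta>\<in>perms T. ip (\<lambda>x. u (x \<circ> \<gamma>)) (\<lambda>x. u (x \<circ> \<beta>)))"
      by (subst ip_sum_left, intro sum.cong refl) (subst ip_commute, subst ip_sum_left, simp add: ip_commute)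
    also have "\<dots> = (\<Sum>\<gamma>\<in>perms T. \<Sum>\<beta>\<in>perms T. ip u (\<lambda>x. u (x \<circ> \<beta>)))"
    proof (rule sum.cong[OF refl])
      fix \<gamma> assume \<gamma>: "\<gamma> \<in> perms T"
      then have \<gamma>T: "\<gamma> permutes T" by simp
      have "(\<Sum>\<beta>\<in>perms T. ip (\<lambda>x. u (x \<circ> \<gamma>)) (\<lambda>x. u (x \<circ> \<beta>))) = (\<Sum>\<beta>\<in>perms T. ip (\<lambda>x. u (x \<circ> \<gamma>)) (\<lambda>x. u (x \<circ> (\<gamma> \<circ> \<beta>))))"
        by (rule setum_permutations_compose_left[OF \<gamma>T])
      also have "\<dots> = (\<Sum>\<beta>\<in>perms T. ip u (\<lambda>x. u (x \<circ> \<beta>)))"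
        using ip_right_translate[OF pX[OF \<gamma>], of u "\<lambda>x. u (x \<circ> _)"] by (simp add: comp_assoc)
      finally show "(\<Sum>\<beta>\<in>perms T. ip (\<lambda>x. u (x \<circ> \<gamma>)) (\<lambda>x. u (x \<circ> \<beta>))) = (\<Sum>\<beta>\<in>perms T. ip u (\<lambda>x. u (x \<circ> \<beta>)))" .
    qed
    also have "\<dots> = fact (card T) * (\<Sum>\<beta>\<in>perms T. ip u (\<lambda>x. u (x \<circ> \<beta>)))"
      using finT by (simp add: card_permutations[OF refl])
    finally have "0 \<le> fact (card T) * (\<Sum>\<beta>\<in>perms T. ip u (\<lambda>x. u (x \<circ> \<beta>)))" using ip_nonneg[of ?s] by simp
    then have "0 \<le> (\<Sum>\<beta>\<in>perms T. ip u (\<lambda>x. u (x \<circ> \<beta>)))" 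
      by (metis fact_gt_zero mult_le_cancel_left_pos mult_zero_right)
    moreover have "(-1) ^ card T * ip u (\<lambda>x. u (x \<circ> tau T)) = c * (\<Sum>\<beta>\<in>perms T. ip u (\<lambda>x. u (x \<circ> \<beta>)))"
      unfolding e by (simp flip: mult.assoc power_mult_distrib)
    ultimately show ?thesis using c by simp
  qed
  have "tau {} = id" by (auto simp: tau_def)
  then have "ip u u = (\<Sum>T\<in>{{}}. (-1) ^ card T * ip u (\<lambda>x. u (x \<circ> tau T)))" by simp
  also have "\<dots> \<le> (\<Sum>T\<in>Pow K. (-1) ^ card T * ip u (\<lambda>x. u (x \<circ> tau T)))"
    by (rule sum_mono2) (use finK nn in auto)
  also have "\<dots> = ip u (\<lambda>x. \<Sum>T\<in>Pow K. (-1) ^ card T * u (x \<circ> tau T))"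
    by (simp add: ip_commute[of u] ip_sum_left ip_cmult_left)
  finally show ?thesis .
qed

text \<open>The symmetric group on \<open>X - Q\<close> is a union of cosets of its even part, so
  orthogonality in the alternating sense implies it in the symmetric sense.\<close>

lemma orth_perms_sum:
  assumes F: "orth e F" and Q: "Q \<subseteq> X" "card Q \<le> e" and wz: "w permutes X" "z permutes X"
  shows "(\<Sum>\<alpha>\<in>perms (X - Q). F (w \<circ> \<alpha> \<circ> z)) = 0"
proof -
  let ?F = "\<lambda>x. F (x \<circ> z)"
  have F': "orth e ?F" by (rule orth_right[OF F wz(2)])
  have "(\<Sum>\<alpha>\<in>perms (X - Q). \<Sum>\<gamma>\<in>alts (X - Q). ?F (w \<circ> (\<alpha> \<circ> \<gamma>))) = 0"
  proof (rule sum.neutral, rule ballI)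
    fix \<alpha> assume "\<alpha> \<in> perms (X - Q)"
    then have "w \<circ> \<alpha> permutes X" using permutes_subset[of \<alpha> "X - Q" X] wz by (auto intro: permutes_compose)
    then have "(\<Sum>\<gamma>\<in>alts (X - Q). ?F ((w \<circ> \<alpha>) \<circ> \<gamma>)) = 0" using F' Q unfolding orth_def by blast
    then show "(\<Sum>\<gamma>\<in>alts (X - Q). ?F (w \<circ> (\<alpha> \<circ> \<gamma>))) = 0" by (simp only: comp_assoc)
  qed
  moreover have "(\<Sum>\<alpha>\<in>perms (X - Q). \<Sum>\<gamma>\<in>alts (X - Q). ?F (w \<circ> (\<alpha> \<circ> \<gamma>)))
     = (\<Sum>\<gamma>\<in>alts (X - Q). \<Sum>\<alpha>\<in>perms (X - Q). ?F (w \<circ> \<alpha>))"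
    by (subst sum.swap, rule sum.cong[OF refl], rule sum_permutations_compose_right[symmetric]) simp
  ultimately have "real (card (alts (X - Q))) * (\<Sum>\<alpha>\<in>perms (X - Q). ?F (w \<circ> \<alpha>)) = 0" by simp
  moreover have "card (alts (X - Q)) \<noteq> 0" using finite_alts alts_nonempty by (subst card_0_eq)
  ultimately show ?thesis by simp
qed

text \<open>In the second claim \<open>z\<close> enters through its inverse, because the stabiliser
  acts on it from the left.\<close>

lemma pure_coset_avg:
  assumes F: "orth (card K - 1) F" and K: "K \<subseteq> X" "K \<noteq> {}"
  shows "z permutes X \<Longrightarrow> pure K (\<lambda>w. coset_avg X K F z w)"
    and "w permutes X \<Longrightarrow> pure K (\<lambda>z. coset_avg X K F (inv' z) w)"
proof -
  have finK: "finite K" using K(1) finX finite_subset by blast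
  have c: "card (K - {s}) \<le> card K - 1" if "s \<in> K" for s using that finK by simp
  have sub: "K - {s} \<subseteq> X" for s using K by auto
  have zero: "(\<Sum>\<alpha>\<in>perms (X - (K - {s})). F (w \<circ> \<alpha> \<circ> z)) = 0"
    if "s \<in> K" "w permutes X" "z permutes X" for s w z
    by (rule orth_perms_sum[OF F sub c[OF that(1)] that(2,3)])
  have \<beta>X: "\<beta> permutes X" if "\<beta> \<in> perms (X - K)" for \<beta> using that permutes_subset[of \<beta> "X - K" X] by auto
  show "pure K (\<lambda>w. coset_avg X K F z w)" if z: "z permutes X"
    unfolding pure_def
  proof (intro conjI allI impI)
    fix s x assume s: "s \<in> K" and x: "x permutes X"
    have "(\<Sum>\<alpha>\<in>perms (X - (K - {s})). F (x \<circ> \<alpha> \<circ> \<beta> \<circ> z)) = 0" if "\<beta> \<in> perms (X - K)" for \<beta>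
      using zero[OF s x permutes_compose[OF z \<beta>X[OF that]]] by (simp add: comp_assoc)
    then show "(\<Sum>\<alpha>\<in>perms (X - (K - {s})). coset_avg X K F z (x \<circ> \<alpha>)) = 0"
      unfolding coset_avg_def avg_sum[symmetric] by (simp add: avg_def)
  qed (rule coset_avg_right)
  show "pure K (\<lambda>z. coset_avg X K F (inv' z) w)" if w: "w permutes X"
    unfolding pure_def
  proof (intro conjI allI impI)
    fix x \<alpha> assume x: "x permutes X" and \<alpha>: "\<alpha> permutes X - K"
    show "coset_avg X K F (inv' (x \<circ> \<alpha>)) w = coset_avg X K F (inv' x) w"
      using \<beta>X[of \<alpha>] \<alpha> by (simp add: inverse_comp[OF x] coset_avg_left permutes_inv)
  next
    fix s x assume s: "s \<in> K" and x: "x permutes X"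
    have "(\<Sum>\<alpha>\<in>perms (X - (K - {s})). F (w \<circ> \<beta> \<circ> inv' (x \<circ> \<alpha>))) = 0" if \<beta>: "\<beta> \<in> perms (X - K)" for \<beta>
    proof -
      have "(\<Sum>\<alpha>\<in>perms (X - (K - {s})). F (w \<circ> \<beta> \<circ> inv' (x \<circ> \<alpha>))) = (\<Sum>\<alpha>\<in>perms (X - (K - {s})). F ((w \<circ> \<beta>) \<circ> inv' \<alpha> \<circ> inv' x))"
      proof (rule sum.cong[OF refl])
        fix \<alpha> assume "\<alpha> \<in> perms (X - (K - {s}))"
        then have "\<alpha> permutes X" using permutes_subset[of \<alpha> "X - (K - {s})" X] by auto
        then show "F (w \<circ> \<beta> \<circ> inv' (x \<circ> \<alpha>)) = F ((w \<circ> \<beta>) \<circ> inv' \<alpha> \<circ> inv' x)"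
          by (simp add: inverse_comp[OF x] comp_assoc)
      qed
      also have "\<dots> = (\<Sum>\<alpha>\<in>perms (X - (K - {s})). F ((w \<circ> \<beta>) \<circ> \<alpha> \<circ> inv' x))"
        by (rule sum_permutations_inverse[of "\<lambda>\<alpha>. F ((w \<circ> \<beta>) \<circ> \<alpha> \<circ> inv' x)", symmetric])
      also have "\<dots> = 0" by (rule zero[OF s permutes_compose[OF \<beta>X[OF \<beta>] w] permutes_inv[OF x]])
      finally show ?thesis .
    qed
    then show "(\<Sum>\<alpha>\<in>perms (X - (K - {s})). coset_avg X K F (inv' (x \<circ> \<alpha>)) w) = 0"
      unfolding coset_avg_def avg_sum[symmetric] by (simp add: avg_def)
  qed
qed

end

section \<open>Two-sided differences dominate coset averages\<close>

context paired_space
begin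

lemma diff_eq_iterated:
  "diff X K F z w = (\<Sum>T\<in>Pow K. (-1) ^ card T * (\<Sum>U\<in>Pow K. (-1) ^ card U * coset_avg X K F (tau T \<circ> z) (w \<circ> tau U)))"
  unfolding diff_def by (simp add: sum_distrib_left mult.assoc)

text \<open>\<open>pure_norm_le\<close> is used twice: in \<open>w\<close> for the coset average M,
  and in \<open>z\<close> for its one-sided difference \<open>V\<close>. Up to 2 ^ card K, signed
  summation over \<open>Pow K\<close> is a projection; so, with inner products over both variables
  and k = card K, M.M \<le> M.V = 2^-k V.V \<le> 2^-k V.diff = M.diff.\<close>

lemma coset_avg_norm_le_diff:
  assumes K: "paired X K" "K \<noteq> {}" and F: "orth (card K - 1) F"
  shows "(\<Sum>z\<in>P. \<Sum>w\<in>P. (coset_avg X K F z w)\<^sup>2) \<le> (\<Sum>z\<in>P. \<Sum>w\<in>P. coset_avg X K F z w * diff X K F z w)"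
proof -
  let ?M = "coset_avg X K F"
  define V where "V z w = (\<Sum>U\<in>Pow K. (-1) ^ card U * ?M z (w \<circ> tau U))" for z w
  have KX: "K \<subseteq> X" using K unfolding paired_def by blast
  have finK: "finite K" using KX finX finite_subset by blast
  have tp: "tau U permutes X" if "U \<in> Pow K" for U using paired_tau_permutes[OF K(1)] that by auto
  have inv_tau: "inv' (tau T) = tau T" for T by (rule inv_unique_comp) (rule tau_self)+
  have a: "(\<Sum>w\<in>P. (?M z w)\<^sup>2) \<le> (\<Sum>w\<in>P. ?M z w * V z w)" if z: "z permutes X" for z
    using pure_norm_le[OF K(1) pure_coset_avg(1)[OF F KX K(2) z]] by (simp add: ip_def V_def power2_eq_square)
  have b: "(\<Sum>w\<in>P. (V z w)\<^sup>2) = 2 ^ card K * (\<Sum>w\<in>P. ?M z w * V z w)" for z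
  proof -
    define g where "g U = (\<Sum>w\<in>P. ?M z w * ?M z (w \<circ> tau U))" for U
    have e: "(\<Sum>w\<in>P. ?M z (w \<circ> tau T) * ?M z (w \<circ> tau U)) = g (sd T U)" if "T \<in> Pow K" "U \<in> Pow K" for T U
    proof -
      have "sd T U = sd U T" by (auto simp: sd_def)
      then have "tau U \<circ> tau T = tau (sd T U)" using tau_comp[OF K(1), of U T] that by auto
      moreover have "(\<Sum>w\<in>P. ?M z (w \<circ> tau T) * ?M z (w \<circ> tau U)) = (\<Sum>w\<in>P. ?M z (w \<circ> tau U \<circ> tau T) * ?M z (w \<circ> tau U \<circ> tau U))"
        by (rule sum_permutations_compose_right[OF tp[OF that(2)]])
      ultimately show ?thesis by (simp add: g_def comp_assoc tau_self mult.commute)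
    qed
    have "(\<Sum>w\<in>P. (V z w)\<^sup>2) = (\<Sum>w\<in>P. \<Sum>U\<in>Pow K. \<Sum>T\<in>Pow K. (-1) ^ card T * (-1) ^ card U * (?M z (w \<circ> tau T) * ?M z (w \<circ> tau U)))"
      unfolding V_def power2_eq_square sum_product by (intro sum.cong refl) (simp add: mult_ac)
    also have "\<dots> = (\<Sum>U\<in>Pow K. \<Sum>T\<in>Pow K. (-1) ^ card T * (-1) ^ card U * g (sd T U))"
    proof (subst sum.swap, rule sum.cong[OF refl], subst sum.swap, rule sum.cong[OF refl])
      fix U T assume "U \<in> Pow K" "T \<in> Pow K"
      then show "(\<Sum>w\<in>P. (-1) ^ card T * (-1) ^ card U * (?M z (w \<circ> tau T) * ?M z (w \<circ> tau U))) = (-1) ^ card T * (-1) ^ card U * g (sd T U)"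
        by (simp only: e flip: sum_distrib_left)
    qed
    also have "\<dots> = 2 ^ card K * (\<Sum>T\<in>Pow K. (-1) ^ card T * g T)" by (rule sum_Pow_sd_parity[OF finK])
    also have "(\<Sum>T\<in>Pow K. (-1) ^ card T * g T) = (\<Sum>w\<in>P. ?M z w * V z w)"
      unfolding g_def V_def sum_distrib_left by (subst sum.swap) (simp add: mult.left_commute)
    finally show ?thesis .
  qed
  have c: "(\<Sum>z\<in>P. (V z w)\<^sup>2) \<le> (\<Sum>z\<in>P. V z w * diff X K F z w)" if w: "w permutes X" for w
  proof -
    have pV: "pure K (\<lambda>z. V (inv' z) w)"
      unfolding V_def by (intro pure_lincomb pure_coset_avg(2)[OF F KX K(2)] permutes_compose[OF tp w])
    have "(\<Sum>z\<in>P. (V z w)\<^sup>2) = ip (\<lambda>z. V (inv' z) w) (\<lambda>z. V (inv' z) w)"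
      unfolding ip_def using sum_permutations_inverse[of "\<lambda>z. (V z w)\<^sup>2" X] by (simp add: power2_eq_square)
    also have "\<dots> \<le> ip (\<lambda>z. V (inv' z) w) (\<lambda>z. \<Sum>T\<in>Pow K. (-1) ^ card T * V (inv' (z \<circ> tau T)) w)"
      by (rule pure_norm_le[OF K(1) pV])
    also have "\<dots> = (\<Sum>z\<in>P. V (inv' z) w * diff X K F (inv' z) w)"
      unfolding ip_def diff_eq_iterated V_def
      by (intro sum.cong refl arg_cong2[where f = "(*)"]) (auto simp: inverse_comp tp inv_tau)
    also have "\<dots> = (\<Sum>z\<in>P. V z w * diff X K F z w)"
      by (rule sum_permutations_inverse[of "\<lambda>z. V z w * diff X K F z w", symmetric])
    finally show ?thesis .
  qed
  have d: "(\<Sum>w\<in>P. V z w * diff X K F z w) = 2 ^ card K * (\<Sum>w\<in>P. ?M z w * diff X K F z w)" for z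
  proof -
    have "(\<Sum>w\<in>P. V z w * diff X K F z w) = (\<Sum>U\<in>Pow K. (-1) ^ card U * (\<Sum>w\<in>P. ?M z (w \<circ> tau U) * diff X K F z w))"
      unfolding V_def sum_distrib_right by (subst sum.swap) (simp add: sum_distrib_left mult.assoc)
    also have "\<dots> = (\<Sum>U\<in>Pow K. \<Sum>w\<in>P. ?M z w * diff X K F z w)"
    proof (rule sum.cong[OF refl])
      fix U assume U: "U \<in> Pow K"
      have "(\<Sum>w\<in>P. ?M z (w \<circ> tau U) * diff X K F z w) = (\<Sum>w\<in>P. ?M z (w \<circ> tau U \<circ> tau U) * diff X K F z (w \<circ> tau U))"
        by (rule sum_permutations_compose_right[OF tp[OF U]])
      also have "\<dots> = (-1) ^ card U * (\<Sum>w\<in>P. ?M z w * diff X K F z w)"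
      proof -
        have "U \<inter> K = U" using U by auto
        then have "diff X K F z (w \<circ> tau U) = (-1) ^ card U * diff X K F z w" for w
          using diff_tau[OF K(1) finK, of U K] U by simp
        then show ?thesis by (simp add: comp_assoc tau_self sum_distrib_left mult.left_commute)
      qed
      finally show "(-1) ^ card U * (\<Sum>w\<in>P. ?M z (w \<circ> tau U) * diff X K F z w) = (\<Sum>w\<in>P. ?M z w * diff X K F z w)"
        by (simp flip: mult.assoc power_mult_distrib)
    qed
    finally show ?thesis using finK by (simp add: card_Pow)
  qed
  have "2 ^ card K * (\<Sum>z\<in>P. \<Sum>w\<in>P. (?M z w)\<^sup>2) \<le> 2 ^ card K * (\<Sum>z\<in>P. \<Sum>w\<in>P. ?M z w * V z w)"
    by (rule mult_left_mono[OF sum_mono]) (use a in auto)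
  also have "\<dots> = (\<Sum>z\<in>P. \<Sum>w\<in>P. (V z w)\<^sup>2)" by (simp add: b sum_distrib_left)
  also have "\<dots> = (\<Sum>w\<in>P. \<Sum>z\<in>P. (V z w)\<^sup>2)" by (rule sum.swap)
  also have "\<dots> \<le> (\<Sum>w\<in>P. \<Sum>z\<in>P. V z w * diff X K F z w)" by (rule sum_mono) (use c in auto)
  also have "\<dots> = (\<Sum>z\<in>P. \<Sum>w\<in>P. V z w * diff X K F z w)" by (rule sum.swap)
  also have "\<dots> = 2 ^ card K * (\<Sum>z\<in>P. \<Sum>w\<in>P. ?M z w * diff X K F z w)" by (simp add: d sum_distrib_left)
  finally show ?thesis by (subst (asm) mult_le_cancel_left_pos) auto
qed

lemma coset_avg_orth:
  assumes "orth (card K) h" "K \<subseteq> X" "z permutes X" "w permutes X"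
  shows "coset_avg X K h z w = 0"
  unfolding coset_avg_def avg_def using orth_perms_sum[OF assms(1,2) _ assms(4,3)] by simp

text \<open>For fixed \<open>z\<close> the sum over \<open>w\<close> is a mean of inner products of
  right translates of \<open>F\<close> and \<open>v\<close>.\<close>

lemma coset_avg_low_orthogonal:
  assumes F: "orth e F" and v: "low e v" and ab: "a permutes X" "b permutes X"
  shows "(\<Sum>z\<in>P. \<Sum>w\<in>P. coset_avg X K F z w * coset_avg X K v (a \<circ> z) (w \<circ> b)) = 0"
proof -
  have "(\<Sum>w\<in>P. coset_avg X K F z w * coset_avg X K v (a \<circ> z) (w \<circ> b)) = 0" if z: "z permutes X" for z
  proof -
    have "(\<Sum>w\<in>P. coset_avg X K F z w * coset_avg X K v (a \<circ> z) (w \<circ> b))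
       = avg (perms (X - K)) (\<lambda>\<beta>. avg (perms (X - K)) (\<lambda>\<alpha>. \<Sum>w\<in>P. F (w \<circ> (\<alpha> \<circ> z)) * v (w \<circ> (b \<circ> \<beta> \<circ> (a \<circ> z)))))"
      unfolding coset_avg_def avg_cmult_right[symmetric] avg_cmult[symmetric] avg_sum[symmetric] by (simp add: comp_assoc avg_sum)
    also have "\<dots> = avg (perms (X - K)) (\<lambda>\<beta>. avg (perms (X - K)) (\<lambda>\<alpha>. 0))"
    proof (intro avg_cong)
      fix \<beta> \<alpha> assume "\<alpha> \<in> perms (X - K)" "\<beta> \<in> perms (X - K)"
      then have p: "\<alpha> permutes X" "\<beta> permutes X" using permutes_subset[of _ "X - K" X] by auto
      have "orth e (\<lambda>x. F (x \<circ> (\<alpha> \<circ> z)))" "low e (\<lambda>x. v (x \<circ> (b \<circ> \<beta> \<circ> (a \<circ> z))))"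
        by (intro orth_right[OF F] low_right[OF v] permutes_compose p z ab)+
      then have "ip (\<lambda>x. v (x \<circ> (b \<circ> \<beta> \<circ> (a \<circ> z)))) (\<lambda>x. F (x \<circ> (\<alpha> \<circ> z))) = 0" unfolding low_def by blast
      then show "(\<Sum>w\<in>P. F (w \<circ> (\<alpha> \<circ> z)) * v (w \<circ> (b \<circ> \<beta> \<circ> (a \<circ> z)))) = 0" by (simp add: ip_def mult.commute)
    qed
    finally show ?thesis by (simp add: avg_def)
  qed
  then show ?thesis by simp
qed

lemma sum2_Cauchy_Schwarz:
  fixes f g :: "'b \<Rightarrow> 'c \<Rightarrow> real"
  shows "(\<Sum>z\<in>A. \<Sum>w\<in>B. f z w * g z w)\<^sup>2 \<le> (\<Sum>z\<in>A. \<Sum>w\<in>B. (f z w)\<^sup>2) * (\<Sum>z\<in>A. \<Sum>w\<in>B. (g z w)\<^sup>2)"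
  using Cauchy_Schwarz_ineq_sum[of "\<lambda>x. f (fst x) (snd x)" "\<lambda>x. g (fst x) (snd x)" "A \<times> B"]
  by (simp add: sum.cartesian_product split_def)

text \<open>The coset averages of \<open>h\<close> vanish and those of \<open>v\<close> are
  orthogonal to those of \<open>F\<close>; paired with the averages of \<open>F\<close>, the
  difference of \<open>f\<close> therefore acts like that of \<open>F\<close>. Cauchy-Schwarz then
  removes one factor from \<open>coset_avg_norm_le_diff\<close>.\<close>

lemma level_part_le_diff:
  assumes K: "paired X K" "K \<noteq> {}" and F: "orth (card K - 1) F"
    and v: "low (card K - 1) v" and h: "orth (card K) h"
    and f: "\<And>x. x permutes X \<Longrightarrow> f x = v x + F x + h x"
  shows "(\<Sum>z\<in>P. \<Sum>w\<in>P. (coset_avg X K F z w)\<^sup>2) \<le> (\<Sum>z\<in>P. \<Sum>w\<in>P. (diff X K f z w)\<^sup>2)"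
proof -
  let ?M = "coset_avg X K F"
  have KX: "K \<subseteq> X" using K unfolding paired_def by blast
  have tp: "tau U permutes X" if "U \<in> Pow K" for U using paired_tau_permutes[OF K(1)] that by auto
  have split: "coset_avg X K f z w = coset_avg X K v z w + ?M z w" if zw: "z permutes X" "w permutes X" for z w
  proof -
    have "coset_avg X K f z w = avg (perms (X - K)) (\<lambda>\<alpha>. v (w \<circ> \<alpha> \<circ> z) + F (w \<circ> \<alpha> \<circ> z) + h (w \<circ> \<alpha> \<circ> z))"
      unfolding coset_avg_def
    proof (rule avg_cong)
      fix \<alpha> assume "\<alpha> \<in> perms (X - K)"
      then have "w \<circ> \<alpha> \<circ> z permutes X" using permutes_subset[of \<alpha> "X - K" X] zw by (auto intro: permutes_compose)
      then show "f (w \<circ> \<alpha> \<circ> z) = v (w \<circ> \<alpha> \<circ> z) + F (w \<circ> \<alpha> \<circ> z) + h (w \<circ> \<alpha> \<circ> z)" by (rule f)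
    qed
    then show ?thesis using coset_avg_orth[OF h KX zw] unfolding coset_avg_def by (simp add: avg_add)
  qed
  have "(\<Sum>z\<in>P. \<Sum>w\<in>P. ?M z w * diff X K f z w) = (\<Sum>z\<in>P. \<Sum>w\<in>P. ?M z w * diff X K v z w) + (\<Sum>z\<in>P. \<Sum>w\<in>P. ?M z w * diff X K F z w)"
  proof -
    have "diff X K f z w = diff X K v z w + diff X K F z w" if "z \<in> P" "w \<in> P" for z w
    proof -
      have "coset_avg X K f (tau T \<circ> z) (w \<circ> tau U) = coset_avg X K v (tau T \<circ> z) (w \<circ> tau U) + ?M (tau T \<circ> z) (w \<circ> tau U)"
        if "T \<in> Pow K" "U \<in> Pow K" for T U
        using \<open>z \<in> P\<close> \<open>w \<in> P\<close> tp that by (intro split permutes_compose) auto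
      then show ?thesis unfolding diff_def by (simp add: distrib_left sum.distrib)
    qed
    then show ?thesis by (simp add: distrib_left sum.distrib)
  qed
  also have "(\<Sum>z\<in>P. \<Sum>w\<in>P. ?M z w * diff X K v z w) = 0"
  proof -
    have "(\<Sum>z\<in>P. \<Sum>w\<in>P. ?M z w * diff X K v z w)
       = (\<Sum>z\<in>P. \<Sum>w\<in>P. \<Sum>T\<in>Pow K. \<Sum>U\<in>Pow K. ((-1) ^ card T * (-1) ^ card U) * (?M z w * coset_avg X K v (tau T \<circ> z) (w \<circ> tau U)))"
      unfolding diff_def by (simp add: sum_distrib_left mult_ac)
    also have "\<dots> = (\<Sum>T\<in>Pow K. \<Sum>U\<in>Pow K. ((-1) ^ card T * (-1) ^ card U) * (\<Sum>z\<in>P. \<Sum>w\<in>P. ?M z w * coset_avg X K v (tau T \<circ> z) (w \<circ> tau U)))"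
      unfolding sum_distrib_left
      by (subst (2) sum.swap, subst sum.swap, rule sum.cong[OF refl], subst (2) sum.swap, subst sum.swap, rule refl)
    also have "\<dots> = 0" using coset_avg_low_orthogonal[OF F v tp tp] by simp
    finally show ?thesis .
  qed
  finally have eq: "(\<Sum>z\<in>P. \<Sum>w\<in>P. ?M z w * diff X K f z w) = (\<Sum>z\<in>P. \<Sum>w\<in>P. ?M z w * diff X K F z w)" by simp
  let ?A = "\<Sum>z\<in>P. \<Sum>w\<in>P. (?M z w)\<^sup>2" and ?B = "\<Sum>z\<in>P. \<Sum>w\<in>P. (diff X K f z w)\<^sup>2"
  have A0: "0 \<le> ?A" and B0: "0 \<le> ?B" by (intro sum_nonneg; simp)+
  have "?A \<le> (\<Sum>z\<in>P. \<Sum>w\<in>P. ?M z w * diff X K f z w)" unfolding eq by (rule coset_avg_norm_le_diff[OF K F])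
  then have "?A\<^sup>2 \<le> (\<Sum>z\<in>P. \<Sum>w\<in>P. ?M z w * diff X K f z w)\<^sup>2" using A0 by (intro power_mono)
  also have "\<dots> \<le> ?A * ?B" by (rule sum2_Cauchy_Schwarz)
  finally have "?A * ?A \<le> ?A * ?B" by (simp add: power2_eq_square)
  then show ?thesis
  proof (cases "?A = 0")
    case False
    then have "0 < ?A" using A0 by linarith
    then show ?thesis using \<open>?A * ?A \<le> ?A * ?B\<close> by (simp only: mult_le_cancel_left_pos)
  qed (use B0 in linarith)
qed

text \<open>A symmetric average is half the sum of the alternating averages at \<open>w\<close> and
  at \<open>w \<circ> t\<close>, for a transposition \<open>t\<close> of two points outside
  \<open>K\<close>. Since \<open>F\<close> vanishes on odd permutations, one of the two is
  zero.\<close>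

lemma alt_avg_norm_le:
  assumes K: "2 \<le> card (X - K)" and F: "\<And>x. x permutes X \<Longrightarrow> \<not> evenperm x \<Longrightarrow> F x = 0"
  shows "(\<Sum>z\<in>P. \<Sum>w\<in>P. (alt_avg K F z w)\<^sup>2) \<le> 2 * (\<Sum>z\<in>P. \<Sum>w\<in>P. (coset_avg X K F z w)\<^sup>2)"
proof -
  obtain Y where Y: "Y \<subseteq> X - K" "card Y = 2" by (rule obtain_subset_with_card_n[OF K])
  then obtain a b where "Y = {a, b}" "a \<noteq> b" by (auto simp: card_2_iff)
  then have ab: "a \<in> X - K" "b \<in> X - K" "a \<noteq> b" using Y by auto
  define t where "t = tswap a b"
  have t: "t permutes X - K" unfolding t_def using ab by (intro permutes_swap_id) auto
  have tX: "t permutes X" using permutes_subset[OF t] by blast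
  have odd_t: "\<not> evenperm t" unfolding t_def using ab by (simp add: evenperm_swap)
  have tt: "t \<circ> t = id" unfolding t_def by simp
  have ev: "evenperm (t \<circ> \<alpha>) \<longleftrightarrow> \<not> evenperm \<alpha>" if "\<alpha> permutes X - K" for \<alpha>
    using odd_t tX permutes_subset[OF that, of X] by (auto simp: evenperm_comp permutation_perm)
  have split: "(\<Sum>\<alpha>\<in>perms (X - K). H \<alpha>) = (\<Sum>\<alpha>\<in>alts (X - K). H \<alpha>) + (\<Sum>\<alpha>\<in>alts (X - K). H (t \<circ> \<alpha>))" for H :: "('a \<Rightarrow> 'a) \<Rightarrow> real"
  proof -
    let ?O = "{p. p permutes X - K \<and> \<not> evenperm p}"
    have un: "perms (X - K) = alts (X - K) \<union> ?O" by blast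
    have finO: "finite ?O" by (rule finite_subset[OF _ finite_permutations[OF finite_Diff[OF finX]]]) blast
    have "(\<Sum>\<alpha>\<in>perms (X - K). H \<alpha>) = (\<Sum>\<alpha>\<in>alts (X - K). H \<alpha>) + (\<Sum>\<alpha>\<in>?O. H \<alpha>)"
      unfolding un by (rule sum.union_disjoint[OF finite_alts finO]) blast
    moreover have "(\<Sum>\<alpha>\<in>?O. H \<alpha>) = (\<Sum>\<alpha>\<in>alts (X - K). H (t \<circ> \<alpha>))"
      by (rule sum.reindex_bij_witness[where i = "\<lambda>\<alpha>. t \<circ> \<alpha>" and j = "\<lambda>\<alpha>. t \<circ> \<alpha>"])
         (use ev t permutes_compose in \<open>auto simp: comp_assoc[symmetric] tt\<close>)
    ultimately show ?thesis by simp
  qed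
  have card: "real (card (perms (X - K))) = 2 * real (card (alts (X - K)))" using split[of "\<lambda>_. 1"] by simp
  have half: "coset_avg X K F z w = (alt_avg K F z w + alt_avg K F z (w \<circ> t)) / 2" for z w
    unfolding coset_avg_def alt_avg_def avg_def card
    using split[of "\<lambda>\<alpha>. F (w \<circ> \<alpha> \<circ> z)"] by (simp add: comp_assoc add_divide_distrib)
  have disj: "alt_avg K F z w * alt_avg K F z (w \<circ> t) = 0" if zw: "z permutes X" "w permutes X" for z w
  proof (cases "evenperm w = evenperm z")
    case True
    have "F (w \<circ> t \<circ> \<alpha> \<circ> z) = 0" if "\<alpha> \<in> alts (X - K)" for \<alpha>
    proof (rule F)
      show "w \<circ> t \<circ> \<alpha> \<circ> z permutes X" by (intro permutes_compose zw tX alts_perm[OF that])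
      show "\<not> evenperm (w \<circ> t \<circ> \<alpha> \<circ> z)"
        using True zw tX alts_perm[OF that] that odd_t
        by (simp add: evenperm_comp permutation_perm permutation_compose)
    qed
    then have "alt_avg K F z (w \<circ> t) = 0" unfolding alt_avg_def avg_def by simp
    then show ?thesis by simp
  next
    case False
    have "F (w \<circ> \<alpha> \<circ> z) = 0" if "\<alpha> \<in> alts (X - K)" for \<alpha>
    proof (rule F)
      show "w \<circ> \<alpha> \<circ> z permutes X" by (intro permutes_compose zw alts_perm[OF that])
      show "\<not> evenperm (w \<circ> \<alpha> \<circ> z)"
        using False zw alts_perm[OF that] that
        by (simp add: evenperm_comp permutation_perm permutation_compose)
    qed
    then have "alt_avg K F z w = 0" unfolding alt_avg_def avg_def by simp
    then show ?thesis by simp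
  qed
  have "(\<Sum>w\<in>P. (alt_avg K F z w)\<^sup>2) = 2 * (\<Sum>w\<in>P. (coset_avg X K F z w)\<^sup>2)" if z: "z permutes X" for z
  proof -
    have "(coset_avg X K F z w)\<^sup>2 = ((alt_avg K F z w)\<^sup>2 + (alt_avg K F z (w \<circ> t))\<^sup>2) / 4" if "w \<in> P" for w
      using disj[OF z, of w] that unfolding half by (simp add: power_divide power2_sum)
    then have "(\<Sum>w\<in>P. (coset_avg X K F z w)\<^sup>2) = (\<Sum>w\<in>P. ((alt_avg K F z w)\<^sup>2 + (alt_avg K F z (w \<circ> t))\<^sup>2) / 4)"
      by (rule sum.cong[OF refl])
    also have "\<dots> = ((\<Sum>w\<in>P. (alt_avg K F z w)\<^sup>2) + (\<Sum>w\<in>P. (alt_avg K F z (w \<circ> t))\<^sup>2)) / 4"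
      by (simp add: sum.distrib flip: sum_divide_distrib)
    also have "(\<Sum>w\<in>P. (alt_avg K F z (w \<circ> t))\<^sup>2) = (\<Sum>w\<in>P. (alt_avg K F z w)\<^sup>2)"
      by (rule sum_permutations_compose_right[OF tX, symmetric])
    finally show ?thesis by simp
  qed
  then show ?thesis by (simp add: sum_distrib_left)
qed

end

section \<open>High levels\<close>

text \<open>On five or more points the alternating group is generated by products of two disjoint
  transpositions: overlapping transpositions move at most three points, and a transposition of two
  of the others is inserted twice.\<close>

lemma invariant_alts_generated:
  fixes u :: "('a \<Rightarrow> 'a) \<Rightarrow> real"
  assumes Y: "finite Y" "5 \<le> card Y" "Y \<subseteq> X"
    and u: "\<And>x a b c d. x permutes X \<Longrightarrow> {a, b, c, d} \<subseteq> Y \<Longrightarrow> distinct [a, b, c, d] \<Longrightarrow> u (x \<circ> (tswap a b \<circ> tswap c d)) = u x"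
    and x: "x permutes X" and p: "p permutes Y" "evenperm p"
  shows "u (x \<circ> p) = u x"
proof -
  have swX: "tswap a b permutes X" if "a \<in> Y" "b \<in> Y" for a b using that Y(3) by (intro permutes_swap_id) auto
  have two: "u (x \<circ> (tswap a b \<circ> tswap c d)) = u x"
    if abcd: "{a, b, c, d} \<subseteq> Y" "a \<noteq> b" "c \<noteq> d" and x: "x permutes X" for a b c d x
  proof (cases "distinct [a, b, c, d]")
    case True
    then show ?thesis using u[OF x abcd(1)] by blast
  next
    case False
    then have "a = c \<or> a = d \<or> b = c \<or> b = d" using abcd(2,3) by auto
    then have "{a, b, c, d} \<subseteq> {a, b, c} \<or> {a, b, c, d} \<subseteq> {a, b, d}" by auto
    moreover have "card {a, b, e} \<le> 3" for e by (simp add: card_insert_if)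
    ultimately have "card {a, b, c, d} \<le> 3" by (meson card_mono finite.intros order_trans)
    then have "2 \<le> card (Y - {a, b, c, d})"
      using Y abcd(1) by (subst card_Diff_subset) auto
    then obtain E where E: "E \<subseteq> Y - {a, b, c, d}" "card E = 2" by (rule obtain_subset_with_card_n)
    then obtain e f where "E = {e, f}" "e \<noteq> f" by (auto simp: card_2_iff)
    then have ef: "e \<in> Y" "f \<in> Y" "e \<noteq> f" "e \<notin> {a, b, c, d}" "f \<notin> {a, b, c, d}" using E by auto
    have "tswap a b \<circ> tswap c d = (tswap a b \<circ> tswap e f) \<circ> (tswap e f \<circ> tswap c d)"
      by (simp add: fun_eq_iff)
    then have "u (x \<circ> (tswap a b \<circ> tswap c d)) = u ((x \<circ> (tswap a b \<circ> tswap e f)) \<circ> (tswap e f \<circ> tswap c d))"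
      by (simp only: comp_assoc)
    also have "\<dots> = u (x \<circ> (tswap a b \<circ> tswap e f))"
      by (rule u) (use abcd ef x swX in \<open>auto intro!: permutes_compose\<close>)
    also have "\<dots> = u x" by (rule u) (use abcd ef x in auto)
    finally show ?thesis .
  qed
  have "2 \<le> card Y" using Y by simp
  then obtain E where E: "E \<subseteq> Y" "card E = 2" by (rule obtain_subset_with_card_n)
  then obtain a0 b0 where "E = {a0, b0}" "a0 \<noteq> b0" by (auto simp: card_2_iff)
  then have 0: "a0 \<in> Y" "b0 \<in> Y" "a0 \<noteq> b0" using E by auto
  let ?t = "tswap a0 b0"
  \<comment> \<open>The induction adds one transposition at a time, so odd permutations have to be
    covered; they are compared with the fixed transposition \<open>?t\<close>.\<close>
  have "\<forall>x. x permutes X \<longrightarrow> u (x \<circ> p) = (if evenperm p then u x else u (x \<circ> ?t))"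
    using p(1) Y(1)
  proof (induction p rule: permutes_induct)
    case id
    then show ?case by simp
  next
    case (swap a b p)
    have par: "evenperm (tswap a b \<circ> p) \<longleftrightarrow> \<not> evenperm p"
      using swap Y(1) by (simp add: evenperm_comp permutation_swap_id permutes_imp_permutation evenperm_swap)
    show ?case
    proof (intro allI impI)
      fix x assume x: "x permutes X"
      have y: "x \<circ> tswap a b permutes X" by (intro permutes_compose x swX swap.hyps)
      have "u (x \<circ> (tswap a b \<circ> p)) = (if evenperm p then u (x \<circ> tswap a b) else u (x \<circ> tswap a b \<circ> ?t))"
        unfolding comp_assoc[symmetric] using swap.IH[rule_format, OF y] unfolding comp_assoc .
      moreover have "u (x \<circ> tswap a b \<circ> ?t) = u x"
        using two[of a b a0 b0 x] swap.hyps 0 x by (simp add: comp_assoc)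
      moreover have "u (x \<circ> tswap a b) = u (x \<circ> ?t)"
      proof -
        have "u (x \<circ> ?t \<circ> (?t \<circ> tswap a b)) = u (x \<circ> ?t)"
          using two[of a0 b0 a b "x \<circ> ?t"] swap.hyps 0 permutes_compose[OF swX[OF 0(1,2)] x] by simp
        moreover have "x \<circ> ?t \<circ> (?t \<circ> tswap a b) = x \<circ> tswap a b" by (simp add: fun_eq_iff)
        ultimately show ?thesis by simp
      qed
      ultimately show "u (x \<circ> (tswap a b \<circ> p)) = (if evenperm (tswap a b \<circ> p) then u x else u (x \<circ> ?t))"
        using par by simp
    qed
  qed
  then show ?thesis using x p(2) by simp
qed

section \<open>Klein four-groups on disjoint quadruples\<close>

type_synonym 'a quad = "'a \<times> 'a \<times> 'a \<times> 'a"

fun supp :: "'a quad \<Rightarrow> 'a set" where "supp (a, b, c, d) = {a, b, c, d}"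
fun quad :: "'a quad \<Rightarrow> bool" where "quad (a, b, c, d) \<longleftrightarrow> distinct [a, b, c, d]"
text \<open>\<open>klein1\<close> and \<open>klein2\<close> generate the Klein four-group of double
  transpositions on the quadruple; conjugation by \<open>mid_swap\<close> exchanges them.\<close>

fun klein1 :: "'a quad \<Rightarrow> 'a \<Rightarrow> 'a" where "klein1 (a, b, c, d) = tswap a b \<circ> tswap c d"
fun klein2 :: "'a quad \<Rightarrow> 'a \<Rightarrow> 'a" where "klein2 (a, b, c, d) = tswap a c \<circ> tswap b d"
fun mid_swap :: "'a quad \<Rightarrow> 'a \<Rightarrow> 'a" where "mid_swap (a, b, c, d) = tswap b c"

lemma quad_permutes: "klein1 q permutes supp q" "klein2 q permutes supp q" "mid_swap q permutes supp q"
  by (cases q; auto intro!: permutes_compose permutes_swap_id)+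

lemma quad_relations:
  assumes "quad q"
  shows "klein1 q \<circ> klein1 q = id" "klein2 q \<circ> klein2 q = id" "klein2 q \<circ> klein1 q = klein1 q \<circ> klein2 q" "klein1 q \<circ> mid_swap q = mid_swap q \<circ> klein2 q" "mid_swap q \<circ> mid_swap q = id"
  by (cases q; use assms in \<open>auto simp: fun_eq_iff Transposition.transpose_def\<close>)+

fun disjoint_quads :: "'a set \<Rightarrow> 'a quad list \<Rightarrow> bool" where
  "disjoint_quads X [] \<longleftrightarrow> True"
| "disjoint_quads X (q # qs) \<longleftrightarrow> quad q \<and> supp q \<subseteq> X \<and> supp q \<inter> \<Union> (supp ` set qs) = {} \<and> disjoint_quads X qs"

lemma disjoint_quads_mem: "disjoint_quads X qs \<Longrightarrow> q \<in> set qs \<Longrightarrow> quad q \<and> supp q \<subseteq> X"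
  by (induction qs) auto

lemma disjoint_quads_append:
  "disjoint_quads X qs \<Longrightarrow> quad q \<Longrightarrow> supp q \<subseteq> X \<Longrightarrow> supp q \<inter> \<Union> (supp ` set qs) = {} \<Longrightarrow> disjoint_quads X (qs @ [q])"
  by (induction qs) auto

lemma card_supp_le: "card (\<Union> (supp ` set qs)) \<le> 4 * length qs" "finite (\<Union> (supp ` set qs))"
proof -
  have four: "card (supp q) \<le> 4 \<and> finite (supp q)" for q :: "'a quad"
    by (cases q) (auto simp: card_insert_if)
  have "finite (\<Union> (supp ` set qs)) \<and> card (\<Union> (supp ` set qs)) \<le> 4 * length qs"
  proof (induction qs)
    case (Cons q qs)
    have "card (supp q \<union> \<Union> (supp ` set qs)) \<le> 4 + 4 * length qs"
      using Cons.IH four[of q] by (intro order_trans[OF card_Un_le] add_mono) auto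
    then show ?case using Cons.IH four[of q] by (simp del: supp.simps)
  qed simp
  then show "card (\<Union> (supp ` set qs)) \<le> 4 * length qs" "finite (\<Union> (supp ` set qs))" by auto
qed

context sym_space
begin

text \<open>The character with value -1 on \<open>klein1\<close> and 1 on \<open>klein2\<close>;
  conjugation by \<open>mid_swap\<close> yields a different one. \<open>qproj\<close> is the
  orthogonal projection onto it.\<close>

definition eig :: "'a quad \<Rightarrow> (('a \<Rightarrow> 'a) \<Rightarrow> real) \<Rightarrow> bool" where
  "eig q u \<longleftrightarrow> (\<forall>x. x permutes X \<longrightarrow> u (x \<circ> klein1 q) = - u x \<and> u (x \<circ> klein2 q) = u x)"

definition qproj :: "'a quad \<Rightarrow> (('a \<Rightarrow> 'a) \<Rightarrow> real) \<Rightarrow> ('a \<Rightarrow> 'a) \<Rightarrow> real" where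
  "qproj q F x = (F x - F (x \<circ> klein1 q) + F (x \<circ> klein2 q) - F (x \<circ> klein1 q \<circ> klein2 q)) / 4"

lemma quad_permutes_X:
  assumes "supp q \<subseteq> X"
  shows "klein1 q permutes X" "klein2 q permutes X" "mid_swap q permutes X"
  using quad_permutes[of q] permutes_subset[OF _ assms] by auto

lemma eig_qproj:
  assumes q: "quad q"
  shows "eig q (qproj q F)"
proof -
  note r = quad_relations[OF q]
  have e: "x \<circ> klein1 q \<circ> klein1 q = x" "x \<circ> klein2 q \<circ> klein2 q = x" "x \<circ> klein2 q \<circ> klein1 q = x \<circ> klein1 q \<circ> klein2 q"
    "x \<circ> klein1 q \<circ> klein2 q \<circ> klein2 q = x \<circ> klein1 q" for x :: "'a \<Rightarrow> 'a"
    using r by (simp_all add: comp_assoc)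
  show ?thesis unfolding eig_def
  proof (intro allI impI conjI)
    show "qproj q F (x \<circ> klein1 q) = - qproj q F x" for x unfolding qproj_def e minus_divide_left by (rule arg_cong[where f = "\<lambda>t. t / 4"]) linarith
    show "qproj q F (x \<circ> klein2 q) = qproj q F x" for x unfolding qproj_def e by (rule arg_cong[where f = "\<lambda>t. t / 4"]) linarith
  qed
qed

lemma eig_translate:
  assumes "eig q u" "g permutes Z" "Z \<subseteq> X" "supp q \<inter> Z = {}"
  shows "eig q (\<lambda>x. u (x \<circ> g))"
proof -
  have "klein1 q \<circ> g = g \<circ> klein1 q" "klein2 q \<circ> g = g \<circ> klein2 q"
    using permutes_disjoint_commute[OF quad_permutes(1) assms(2,4)] permutes_disjoint_commute[OF quad_permutes(2) assms(2,4)] by auto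
  then have e: "x \<circ> klein1 q \<circ> g = (x \<circ> g) \<circ> klein1 q" "x \<circ> klein2 q \<circ> g = (x \<circ> g) \<circ> klein2 q" for x :: "'a \<Rightarrow> 'a"
    by (simp_all add: comp_assoc)
  have "x \<circ> g permutes X" if "x permutes X" for x
    using that permutes_subset[OF assms(2,3)] by (intro permutes_compose)
  then show ?thesis using assms(1) unfolding eig_def e by blast
qed

lemma eig_qproj_other:
  assumes "eig q u" "supp q' \<subseteq> X" "supp q \<inter> supp q' = {}"
  shows "eig q (qproj q' u)"
proof -
  note t = eig_translate[OF assms(1) _ assms(2,3)]
  have "eig q (\<lambda>x. u (x \<circ> klein1 q'))" "eig q (\<lambda>x. u (x \<circ> klein2 q'))" "eig q (\<lambda>x. u (x \<circ> (klein1 q' \<circ> klein2 q')))"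
    using t[OF quad_permutes(1)] t[OF quad_permutes(2)] t[OF permutes_compose[OF quad_permutes(2,1)]] by blast+
  then have e: "v \<in> {u, (\<lambda>x. u (x \<circ> klein1 q')), (\<lambda>x. u (x \<circ> klein2 q')), (\<lambda>x. u (x \<circ> (klein1 q' \<circ> klein2 q')))} \<Longrightarrow> eig q v" for v
    using assms(1) by blast
  have "qproj q' u (x \<circ> klein1 q) = - qproj q' u x \<and> qproj q' u (x \<circ> klein2 q) = qproj q' u x" if "x permutes X" for x
    using e[unfolded eig_def, of u] e[unfolded eig_def, of "\<lambda>x. u (x \<circ> klein1 q')"] e[unfolded eig_def, of "\<lambda>x. u (x \<circ> klein2 q')"]
      e[unfolded eig_def, of "\<lambda>x. u (x \<circ> (klein1 q' \<circ> klein2 q'))"] that unfolding qproj_def comp_assoc by (simp add: field_simps)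
  then show ?thesis unfolding eig_def by blast
qed

fun quads_proj :: "'a quad list \<Rightarrow> (('a \<Rightarrow> 'a) \<Rightarrow> real) \<Rightarrow> ('a \<Rightarrow> 'a) \<Rightarrow> real" where
  "quads_proj [] F = F"
| "quads_proj (q # qs) F = qproj q (quads_proj qs F)"

text \<open>The adjoint of \<open>quads_proj\<close>: the projections in reverse order, which spares
  proving that they commute.\<close>

fun quads_adj :: "'a quad list \<Rightarrow> (('a \<Rightarrow> 'a) \<Rightarrow> real) \<Rightarrow> ('a \<Rightarrow> 'a) \<Rightarrow> real" where
  "quads_adj [] F = F"
| "quads_adj (q # qs) F = quads_adj qs (qproj q F)"

lemma quads_adj_snoc: "quads_adj (qs @ [q]) F = qproj q (quads_adj qs F)"
  by (induction qs arbitrary: F) auto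

lemma eig_quads_proj: "disjoint_quads X qs \<Longrightarrow> q \<in> set qs \<Longrightarrow> eig q (quads_proj qs F)"
proof (induction qs)
  case (Cons q' qs)
  show ?case
  proof (cases "q = q'")
    case True
    then show ?thesis using Cons.prems by (simp add: eig_qproj)
  next
    case False
    then show ?thesis using Cons by (auto intro!: eig_qproj_other)
  qed
qed simp

lemma inv_involution: "g \<circ> g = id \<Longrightarrow> inv' g = g"
  by (rule inv_unique_comp)

lemma ip_qproj:
  assumes q: "quad q" "supp q \<subseteq> X"
  shows "ip (qproj q F) G = ip F (qproj q G)"
proof -
  note r = quad_relations[OF q(1)] and p = quad_permutes_X[OF q(2)]
  have i: "inv' (klein1 q) = klein1 q" "inv' (klein2 q) = klein2 q" using r by (auto intro: inv_involution)
  have i12: "inv' (klein1 q \<circ> klein2 q) = klein1 q \<circ> klein2 q" using r(3) by (simp add: inverse_comp[OF p(1,2)] i)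
  have m: "ip (\<lambda>x. F (x \<circ> g)) G = ip (\<lambda>x. G (x \<circ> g)) F" if "g permutes X" "inv' g = g" for g
    using ip_right_move[OF that(1), of F G] that(2) ip_commute[of F] by simp
  have lin: "ip (qproj q F) G = (ip F G - ip (\<lambda>x. F (x \<circ> klein1 q)) G + ip (\<lambda>x. F (x \<circ> klein2 q)) G - ip (\<lambda>x. F (x \<circ> (klein1 q \<circ> klein2 q))) G) / 4" for F G
    unfolding ip_def qproj_def
    by (simp add: sum.distrib[symmetric] sum_subtractf[symmetric] sum_divide_distrib algebra_simps add_divide_distrib diff_divide_distrib comp_assoc)
  show ?thesis
    unfolding ip_commute[of F "qproj q G"] lin
      m[OF p(1) i(1)] m[OF p(2) i(2)] m[OF permutes_compose[OF p(2,1)] i12] ip_commute[of F G] ..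
qed

lemma ip_quads_proj: "disjoint_quads X qs \<Longrightarrow> ip (quads_proj qs F) G = ip F (quads_adj qs G)"
  by (induction qs arbitrary: G) (auto simp: ip_qproj)

lemma orth_qproj: "orth d F \<Longrightarrow> supp q \<subseteq> X \<Longrightarrow> orth d (qproj q F)"
  using orth_right[of d F "klein1 q"] orth_right[of d F "klein2 q"] orth_right[of d F "klein1 q \<circ> klein2 q"]
    quad_permutes_X[of q] permutes_compose[of "klein2 q" X "klein1 q"]
  unfolding orth_def qproj_def
  by (simp add: comp_assoc sum.distrib sum_subtractf flip: sum_divide_distrib)

lemma low_qproj: "low d F \<Longrightarrow> quad q \<Longrightarrow> supp q \<subseteq> X \<Longrightarrow> low d (qproj q F)"
  unfolding low_def by (simp add: ip_qproj orth_qproj)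

lemma orth_quads_adj: "disjoint_quads X qs \<Longrightarrow> orth d F \<Longrightarrow> orth d (quads_adj qs F)"
  by (induction qs arbitrary: F) (auto simp: orth_qproj)

lemma low_quads_adj: "disjoint_quads X qs \<Longrightarrow> low d F \<Longrightarrow> low d (quads_adj qs F)"
  by (induction qs arbitrary: F) (auto simp: low_qproj)

text \<open>The recursion runs over the 2 ^ length qs translates of \<open>u\<close> by products of
  middle swaps.\<close>

fun translates_sq :: "'a quad list \<Rightarrow> (('a \<Rightarrow> 'a) \<Rightarrow> real) \<Rightarrow> (('a \<Rightarrow> 'a) \<Rightarrow> real) \<Rightarrow> real" where
  "translates_sq [] \<phi> u = (ip \<phi> u)\<^sup>2"
| "translates_sq (q # qs) \<phi> u = translates_sq qs \<phi> u + translates_sq qs \<phi> (\<lambda>x. u (x \<circ> mid_swap q))"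

text \<open>Translations by the other quadruples keep the eigenvalue \<open>s\<close> of
  \<open>klein1 q\<close>, so only the component of \<open>\<phi>\<close> with that eigenvalue is
  seen.\<close>

lemma translates_sq_split:
  assumes q: "quad q" "supp q \<subseteq> X" and s: "s * s = 1"
  shows "disjoint_quads X qs \<Longrightarrow> supp q \<inter> \<Union> (supp ` set qs) = {} \<Longrightarrow> (\<And>x. x permutes X \<Longrightarrow> u (x \<circ> klein1 q) = s * u x) \<Longrightarrow>
    translates_sq qs \<phi> u = translates_sq qs (\<lambda>x. (\<phi> x + s * \<phi> (x \<circ> klein1 q)) / 2) u"
proof (induction qs arbitrary: u)
  case Nil
  note p = quad_permutes_X(1)[OF q(2)]
  have i: "inv' (klein1 q) = klein1 q" using quad_relations[OF q(1)] by (auto intro: inv_involution)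
  have "ip (\<lambda>x. \<phi> (x \<circ> klein1 q)) u = ip \<phi> (\<lambda>x. u (x \<circ> klein1 q))" using ip_right_move[OF p, of \<phi> u] i by simp
  also have "\<dots> = ip \<phi> (\<lambda>x. s * u x)" by (rule ip_cong[OF refl]) (rule Nil(3))
  finally have "ip (\<lambda>x. \<phi> (x \<circ> klein1 q)) u = s * ip \<phi> u" by (simp add: ip_commute[of \<phi>] ip_cmult_left)
  then have "ip (\<lambda>x. (\<phi> x + s * \<phi> (x \<circ> klein1 q)) / 2) u = (ip \<phi> u + s * (s * ip \<phi> u)) / 2"
    using ip_cmult_left[of "1/2" "\<lambda>x. \<phi> x + s * \<phi> (x \<circ> klein1 q)" u] by (simp add: ip_add_left ip_cmult_left)
  also have "s * (s * ip \<phi> u) = ip \<phi> u" using s by (simp flip: mult.assoc)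
  finally show ?case by simp
next
  case (Cons q' qs)
  have sub: "supp q' \<subseteq> X" using Cons.prems by simp
  have "klein1 q \<circ> mid_swap q' = mid_swap q' \<circ> klein1 q"
    using Cons.prems(2) by (intro permutes_disjoint_commute[OF quad_permutes(1) quad_permutes(3)]) auto
  then have e: "x \<circ> klein1 q \<circ> mid_swap q' = (x \<circ> mid_swap q') \<circ> klein1 q" for x :: "'a \<Rightarrow> 'a" by (simp add: comp_assoc)
  have "u (x \<circ> klein1 q \<circ> mid_swap q') = s * u (x \<circ> mid_swap q')" if "x permutes X" for x
    unfolding e by (rule Cons.prems(3)[OF permutes_compose[OF quad_permutes_X(3)[OF sub] that]])
  moreover have "disjoint_quads X qs" "supp q \<inter> \<Union> (supp ` set qs) = {}" using Cons.prems by auto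
  ultimately show ?case
    unfolding translates_sq.simps using Cons.prems(3) by (intro arg_cong2[where f = "(+)"] Cons.IH)
qed

text \<open>Bessel's inequality: the translate of \<open>u\<close> by \<open>mid_swap q\<close> is fixed by \<open>klein1 q\<close> while \<open>u\<close> changes sign,
  so the \<open>2\<^sup>m\<close> translates are pairwise orthogonal.\<close>

lemma translates_sq_le:
  "disjoint_quads X qs \<Longrightarrow> (\<And>q. q \<in> set qs \<Longrightarrow> eig q u) \<Longrightarrow> translates_sq qs \<phi> u \<le> ip \<phi> \<phi> * ip u u"
proof (induction qs arbitrary: u \<phi>)
  case Nil
  then show ?case using ip_Cauchy_Schwarz by simp
next
  case (Cons q qs)
  have q: "quad q" "supp q \<subseteq> X" "supp q \<inter> \<Union> (supp ` set qs) = {}" and qs: "disjoint_quads X qs" using Cons.prems by auto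
  note p = quad_permutes_X[OF q(2)]
  define \<phi>1 where "\<phi>1 x = (\<phi> x + (-1) * \<phi> (x \<circ> klein1 q)) / 2" for x
  define \<phi>2 where "\<phi>2 x = (\<phi> x + 1 * \<phi> (x \<circ> klein1 q)) / 2" for x
  let ?u = "\<lambda>x. u (x \<circ> mid_swap q)"
  have eq: "eig q u" using Cons.prems by simp
  have 1: "translates_sq qs \<phi> u = translates_sq qs \<phi>1 u"
    unfolding \<phi>1_def[abs_def] by (rule translates_sq_split[OF q(1,2) _ qs q(3)]) (use eq in \<open>auto simp: eig_def\<close>)
  have "u (x \<circ> klein1 q \<circ> mid_swap q) = u (x \<circ> mid_swap q)" if x: "x permutes X" for x
  proof -
    have "x \<circ> klein1 q \<circ> mid_swap q = (x \<circ> mid_swap q) \<circ> klein2 q" using quad_relations(4)[OF q(1)] by (simp add: comp_assoc)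
    then show ?thesis using eq permutes_compose[OF p(3) x] unfolding eig_def by simp
  qed
  then have 2: "translates_sq qs \<phi> ?u = translates_sq qs \<phi>2 ?u"
    unfolding \<phi>2_def[abs_def] by (intro translates_sq_split[OF q(1,2) _ qs q(3)]) auto
  have e1: "eig q' u" if "q' \<in> set qs" for q' using Cons.prems that by simp
  have e2: "eig q' ?u" if "q' \<in> set qs" for q'
    by (rule eig_translate[OF e1[OF that] quad_permutes(3) q(2)]) (use q(3) that in auto)
  have "translates_sq (q # qs) \<phi> u \<le> ip \<phi>1 \<phi>1 * ip u u + ip \<phi>2 \<phi>2 * ip ?u ?u"
    unfolding translates_sq.simps 1 2 by (intro add_mono Cons.IH[OF qs] e1 e2)
  also have "ip ?u ?u = ip u u" by (rule ip_right_translate[OF p(3)])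
  also have "ip \<phi>1 \<phi>1 * ip u u + ip \<phi>2 \<phi>2 * ip u u = (ip \<phi>1 \<phi>1 + ip \<phi>2 \<phi>2) * ip u u" by (simp add: distrib_right)
  also have "ip \<phi>1 \<phi>1 + ip \<phi>2 \<phi>2 = (ip \<phi> \<phi> + ip (\<lambda>x. \<phi> (x \<circ> klein1 q)) (\<lambda>x. \<phi> (x \<circ> klein1 q))) / 2"
    unfolding ip_def \<phi>1_def \<phi>2_def
    unfolding sum.distrib[symmetric] sum_divide_distrib
    by (intro sum.cong refl) (simp add: power2_eq_square[symmetric] power_divide power2_sum power2_diff flip: add_divide_distrib)
  also have "\<dots> = ip \<phi> \<phi>" by (simp add: ip_right_translate[OF p(1)])
  finally show ?case .
qed

section \<open>Convolution with functions of Klein type\<close>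

lemma conv_right_translate:
  assumes "g permutes X"
  shows "conv f (\<lambda>y. u (y \<circ> g)) x = conv f u (x \<circ> g)"
proof -
  have "conv f u (x \<circ> g) = (\<Sum>y\<in>P. f (x \<circ> g \<circ> inv' (y \<circ> g)) * u (y \<circ> g))"
    unfolding conv_def by (rule sum_permutations_compose_right[OF assms])
  also have "\<dots> = (\<Sum>y\<in>P. f (x \<circ> inv' y) * u (y \<circ> g))"
    by (intro sum.cong refl) (simp add: inverse_comp assms comp_assoc comp_inv_cancel[OF assms])
  finally show ?thesis by (simp add: conv_def)
qed

text \<open>Right translation commutes with convolution, so every translate of \<open>u\<close>
  contributes the same norm.\<close>

lemma sum_translates_sq:
  "disjoint_quads X qs \<Longrightarrow> (\<Sum>x\<in>P. translates_sq qs (\<lambda>y. f (x \<circ> inv' y)) u) = 2 ^ length qs * ip (conv f u) (conv f u)"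
proof (induction qs arbitrary: u)
  case Nil
  show ?case unfolding translates_sq.simps ip_def conv_def power2_eq_square by simp
next
  case (Cons q qs)
  then have g: "mid_swap q permutes X" using quad_permutes_X by simp
  have "ip (conv f (\<lambda>x. u (x \<circ> mid_swap q))) (conv f (\<lambda>x. u (x \<circ> mid_swap q))) = ip (conv f u) (conv f u)"
    unfolding conv_right_translate[OF g, abs_def] by (rule ip_right_translate[OF g])
  then show ?case using Cons by (simp add: sum.distrib)
qed

text \<open>Bessel's inequality at each \<open>x\<close>, applied to the function taking
  \<open>y\<close> to \<open>f (x \<circ> inv' y)\<close>, whose norm is that of \<open>f\<close>;
  the sum over all \<open>x\<close> produces the factorial.\<close>

lemma conv_eig_bound:
  assumes "disjoint_quads X qs" "\<And>q. q \<in> set qs \<Longrightarrow> eig q u"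
  shows "2 ^ length qs * ip (conv f u) (conv f u) \<le> fact (card X) * ip f f * ip u u"
proof -
  have "2 ^ length qs * ip (conv f u) (conv f u) = (\<Sum>x\<in>P. translates_sq qs (\<lambda>y. f (x \<circ> inv' y)) u)"
    using sum_translates_sq[OF assms(1)] by simp
  also have "\<dots> \<le> (\<Sum>x\<in>P. ip (\<lambda>y. f (x \<circ> inv' y)) (\<lambda>y. f (x \<circ> inv' y)) * ip u u)"
    by (intro sum_mono translates_sq_le assms)
  also have "\<dots> = (\<Sum>x\<in>P. ip f f * ip u u)"
  proof (rule sum.cong[OF refl])
    fix x assume "x \<in> P" then have x: "x permutes X" by simp
    have "ip (\<lambda>y. f (x \<circ> inv' y)) (\<lambda>y. f (x \<circ> inv' y)) = ip (\<lambda>y. f (x \<circ> y)) (\<lambda>y. f (x \<circ> y))"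
      unfolding ip_def using sum_permutations_inverse[of "\<lambda>y. f (x \<circ> y) * f (x \<circ> y)" X] by simp
    then show "ip (\<lambda>y. f (x \<circ> inv' y)) (\<lambda>y. f (x \<circ> inv' y)) * ip u u = ip f f * ip u u"
      by (simp add: ip_left_translate[OF x])
  qed
  finally show ?thesis by (simp add: cardP mult.assoc)
qed

lemma eig_conv:
  assumes "eig q u" "supp q \<subseteq> X"
  shows "eig q (conv f u)"
proof -
  note p = quad_permutes_X[OF assms(2)]
  have "conv f u (x \<circ> klein1 q) = - conv f u x" "conv f u (x \<circ> klein2 q) = conv f u x" for x
    unfolding conv_right_translate[OF p(1), symmetric] conv_right_translate[OF p(2), symmetric] unfolding conv_def
    using assms(1) by (simp_all add: eig_def sum_negf[symmetric])
  then show ?thesis unfolding eig_def by blast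
qed

lemma ip_conv_adjoint: "ip (conv f u) v = ip u (conv (\<lambda>y. f (inv' y)) v)"
proof -
  have "ip u (conv (\<lambda>y. f (inv' y)) v) = (\<Sum>y\<in>P. \<Sum>x\<in>P. f (x \<circ> inv' y) * u y * v x)"
    unfolding ip_def conv_def sum_distrib_left
    by (intro sum.cong refl) (simp add: inverse_comp permutes_inv permutes_inv_inv mult_ac)
  also have "\<dots> = (\<Sum>x\<in>P. \<Sum>y\<in>P. f (x \<circ> inv' y) * u y * v x)" by (rule sum.swap)
  finally show ?thesis unfolding ip_def conv_def sum_distrib_right by simp
qed

text \<open>Pairing \<open>u\<close> with \<open>G\<close> only sees the averages of
  \<open>G\<close> over cosets of the stabiliser of \<open>Q\<close>, and these vanish.\<close>

lemma invariant_low: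
  assumes Q: "Q \<subseteq> X" "card Q \<le> d" and u: "\<And>x \<alpha>. x permutes X \<Longrightarrow> \<alpha> \<in> alts (X - Q) \<Longrightarrow> u (x \<circ> \<alpha>) = u x"
  shows "low d u"
  unfolding low_def
proof (intro allI impI)
  fix G assume G: "orth d G"
  have "ip u G = (\<Sum>x\<in>P. u x * alt_avg Q G id x)"
    unfolding ip_def using sum_alt_avg[OF u, of Q G id] by simp
  also have "\<dots> = 0"
    using G Q unfolding orth_def alt_avg_def avg_def by simp
  finally show "ip u G = 0" .
qed

text \<open>Descending induction on the number of quadruples: once all further quadruples annihilate \<open>u\<close>, it is
  invariant under double transpositions outside the used points, hence a function of low level.\<close>

lemma quads_adj_zero:
  assumes n: "4 * m + 5 \<le> card X" and r: "orth (4 * m) r"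
    and top: "\<And>qs x. disjoint_quads X qs \<Longrightarrow> length qs = m \<Longrightarrow> x permutes X \<Longrightarrow> quads_adj qs r x = 0"
  shows "j \<le> m \<Longrightarrow> disjoint_quads X qs \<Longrightarrow> length qs = m - j \<Longrightarrow> x permutes X \<Longrightarrow> quads_adj qs r x = 0"
proof (induction j arbitrary: qs x)
  case 0
  then show ?case using top by simp
next
  case (Suc j)
  define Q where "Q = \<Union> (supp ` set qs)"
  define u where "u = quads_adj qs r"
  have QX: "Q \<subseteq> X" unfolding Q_def using disjoint_quads_mem[OF Suc.prems(2)] by blast
  have cQ: "card Q \<le> 4 * m" and finQ: "finite Q"
    using card_supp_le[of qs] Suc.prems unfolding Q_def by auto
  have Y: "finite (X - Q)" "5 \<le> card (X - Q)" "X - Q \<subseteq> X"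
    using n cQ finX finQ QX by (auto simp: card_Diff_subset)
  have zero: "qproj q u x = 0" if "quad q" "supp q \<subseteq> X - Q" "x permutes X" for q x
  proof -
    have "disjoint_quads X (qs @ [q])"
      using that Suc.prems(2) by (intro disjoint_quads_append) (auto simp: Q_def)
    then show ?thesis using Suc.IH[of "qs @ [q]" x] Suc.prems that by (simp add: quads_adj_snoc u_def)
  qed
  \<comment> \<open>The quadruples (a,b,c,d) and (a,b,d,c) give two relations in which the other two
    double transpositions carry opposite signs; their sum leaves the claim.\<close>
  have dbl: "u (x \<circ> (tswap a b \<circ> tswap c d)) = u x"
    if "x permutes X" "{a, b, c, d} \<subseteq> X - Q" "distinct [a, b, c, d]" for x a b c d
  proof -
    let ?A = "tswap a b \<circ> tswap c d" and ?B = "tswap a c \<circ> tswap b d" and ?C = "tswap a d \<circ> tswap b c"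
    have "?A \<circ> ?B = ?C" "tswap a b \<circ> tswap d c = ?A" "?A \<circ> ?C = ?B"
      using that(3) by (auto simp: fun_eq_iff Transposition.transpose_def)
    then have "u x - u (x \<circ> ?A) + u (x \<circ> ?B) - u (x \<circ> ?C) = 0" "u x - u (x \<circ> ?A) + u (x \<circ> ?C) - u (x \<circ> ?B) = 0"
      using zero[of "(a, b, c, d)" x] zero[of "(a, b, d, c)" x] that by (auto simp: qproj_def comp_assoc)
    then show ?thesis by linarith
  qed
  have "low (4 * m) u"
  proof (rule invariant_low[OF QX cQ])
    fix x \<alpha> assume "x permutes X" "\<alpha> \<in> alts (X - Q)"
    then show "u (x \<circ> \<alpha>) = u x"
      using invariant_alts_generated[OF Y, of u x \<alpha>] dbl by blast
  qed
  moreover have "orth (4 * m) u" unfolding u_def by (rule orth_quads_adj[OF Suc.prems(2) r])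
  ultimately show ?case using low_orth_zero Suc.prems(4) unfolding u_def by blast
qed

text \<open>\<open>conv_eig_bound\<close> treats one list of quadruples, but \<open>h\<close> is a
  combination over all lists, and different lists need not be orthogonal. The growth argument for a
  self-adjoint operator transfers the bound to the combination.\<close>

theorem conv_high_bound:
  assumes n: "4 * m + 5 \<le> card X" and h: "orth (4 * m) h"
  shows "2 ^ m * ip (conv f h) (conv f h) \<le> fact (card X) * ip f f * ip h h"
proof -
  define I where "I = {qs. disjoint_quads X qs \<and> length qs = m} \<times> P"
  \<comment> \<open>Projected point masses suffice, because pairing \<open>r\<close> with them reads
    off the values of \<open>quads_adj qs r\<close>.\<close>
  define b where "b i = quads_proj (fst i) (indicator {snd i})" for i :: "'a quad list \<times> ('a \<Rightarrow> 'a)"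
  have "q \<in> X \<times> X \<times> X \<times> X" if "disjoint_quads X qs" "q \<in> set qs" for qs q
    using disjoint_quads_mem[OF that] by (cases q) simp
  then have "{qs. disjoint_quads X qs \<and> length qs = m} \<subseteq> {qs. set qs \<subseteq> X \<times> X \<times> X \<times> X \<and> length qs = m}"
    by blast
  from finite_subset[OF this finite_lists_length_eq] have finI: "finite I"
    unfolding I_def using finX finP by (intro finite_cartesian_product) simp_all
  obtain c where c: "\<forall>k\<in>I. (\<Sum>x\<in>P. (h x - (\<Sum>i\<in>I. c i * b i x)) * b k x) = 0"
    using orthogonal_projection[OF finI finP, of h b] by blast
  define r where "r x = h x - (\<Sum>i\<in>I. c i * b i x)" for x
  have rb: "ip r (b k) = 0" if "k \<in> I" for k using c that unfolding r_def ip_def by blast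
  have adj: "quads_adj qs r x = 0" if "disjoint_quads X qs" "length qs = m" "x permutes X" for qs x
  proof -
    have "ip (b (qs, x)) r = (\<Sum>y\<in>P. indicator {x} y * quads_adj qs r y)"
      unfolding b_def using ip_quads_proj[OF that(1), of "indicator {x}" r] by (simp add: ip_def)
    also have "\<dots> = quads_adj qs r x" using that(3) finP by (simp add: indicator_def if_distrib[of "\<lambda>t. t * _"] cong: if_cong)
    finally show ?thesis using rb[of "(qs, x)"] that by (simp add: I_def ip_commute)
  qed
  obtain e where e: "orth (4 * m) (\<lambda>x. r x - (\<Sum>i\<in>cosets (4 * m). e i * coset_ind (fst i) (snd i) x))"
    using level_decomposition_coset by blast
  define rL where "rL x = (\<Sum>i\<in>cosets (4 * m). e i * coset_ind (fst i) (snd i) x)" for x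
  \<comment> \<open>The low part of \<open>r\<close> is orthogonal to \<open>h\<close> anyway. The
    rest is annihilated by all lists of length \<open>m\<close>, hence zero by
    \<open>quads_adj_zero\<close>; so \<open>r\<close> is low and \<open>h\<close> has no component
    along it.\<close>
  define rO where "rO x = r x - rL x" for x
  have rL: "low (4 * m) rL" unfolding rL_def[abs_def] by (rule low_coset_comb)
  have rO: "orth (4 * m) rO" unfolding rO_def[abs_def] rL_def by (rule e)
  have adj_diff: "quads_adj qs (\<lambda>x. F x - G x) x = quads_adj qs F x - quads_adj qs G x" for qs F G x
  proof (induction qs arbitrary: F G)
    case (Cons q qs)
    have "qproj q (\<lambda>x. F x - G x) = (\<lambda>x. qproj q F x - qproj q G x)"
      by (auto simp: qproj_def fun_eq_iff diff_divide_distrib add_divide_distrib)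
    then show ?case using Cons.IH by simp
  qed simp
  have "quads_adj qs rO x = 0" if "disjoint_quads X qs" "length qs = m" "x permutes X" for qs x
  proof (rule low_orth_zero[OF _ orth_quads_adj[OF that(1) rO] that(3)])
    show "low (4 * m) (quads_adj qs rO)"
    proof (rule low_cong)
      show "low (4 * m) (\<lambda>x. quads_adj qs (\<lambda>x. 0) x - quads_adj qs rL x)"
        by (intro low_diff low_quads_adj[OF that(1)] rL) (simp add: low_def ip_def)
      fix x assume x: "x permutes X"
      have "quads_adj qs (\<lambda>x. 0) x = 0" using adj_diff[of qs "\<lambda>x. 0" "\<lambda>x. 0" x] by simp
      then show "quads_adj qs (\<lambda>x. 0) x - quads_adj qs rL x = quads_adj qs rO x"
        using adj[OF that(1,2) x] unfolding rO_def[abs_def] adj_diff by simp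
    qed
  qed
  then have "rO x = 0" if "x permutes X" for x
    using quads_adj_zero[OF n rO, of m "[]" x] that by simp
  then have "low (4 * m) r" by (intro low_cong[OF rL]) (simp add: rO_def)
  then have "ip r h = 0" using h unfolding low_def by blast
  moreover have "ip r (\<lambda>x. \<Sum>i\<in>I. c i * b i x) = 0"
    by (simp add: ip_commute[of r] ip_sum_left ip_cmult_left) (simp add: ip_commute[of _ r] rb)
  moreover have rr: "(\<lambda>x. h x - (\<Sum>i\<in>I. c i * b i x)) = r" by (simp add: r_def fun_eq_iff)
  have "ip r r = ip h r - ip (\<lambda>x. \<Sum>i\<in>I. c i * b i x) r"
    using ip_diff_left[of h "\<lambda>x. \<Sum>i\<in>I. c i * b i x" r] unfolding rr .
  ultimately have "ip r r = 0"
    unfolding ip_commute[of r h] ip_commute[of r "\<lambda>x. \<Sum>i\<in>I. c i * b i x"] by (simp only: diff_zero)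
  then have hb: "(\<Sum>i\<in>I. c i * b i x) = h x" if "x permutes X" for x
    using ip_eq_0D[of r x] that unfolding r_def by simp
  let ?f = "\<lambda>y. f (inv' y)"
  \<comment> \<open>Convolution followed by its adjoint, so that \<open>ip (T h) h\<close> is the
    squared norm of \<open>conv f h\<close>.\<close>
  define T where "T u = conv ?f (conv f u)" for u
  define t where "t = fact (card X) * ip f f / 2 ^ m"
  have t0: "0 \<le> t" unfolding t_def using ip_nonneg[of f] by simp
  have ff: "ip ?f ?f = ip f f" unfolding ip_def using sum_permutations_inverse[of "\<lambda>y. f y * f y" X] by simp
  have adjT: "ip (conv ?f u) v = ip u (conv f v)" for u v
    using ip_conv_adjoint[of f v u] by (simp add: ip_commute)
  have saT: "ip (T u) v = ip u (T v)" for u v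
    unfolding T_def by (simp add: adjT ip_conv_adjoint)
  have linT: "linop T"
  proof -
    have cc: "conv g u x = conv g v x" if "\<forall>x. x permutes X \<longrightarrow> u x = v x" for g u v x
      unfolding conv_def using that by (intro sum.cong) auto
    have cl: "conv g (\<lambda>x. a * u x + b * v x) = (\<lambda>x. a * conv g u x + b * conv g v x)" for g a u b v
      unfolding conv_def by (auto simp: fun_eq_iff algebra_simps sum.distrib sum_distrib_left)
    show ?thesis unfolding linop_def T_def
    proof (intro conjI allI impI)
      fix u v :: "('a \<Rightarrow> 'a) \<Rightarrow> real" and x assume "\<forall>x. x permutes X \<longrightarrow> u x = v x"
      then show "conv ?f (conv f u) x = conv ?f (conv f v) x" by (intro cc) (simp add: cc)
    qed (simp only: cl)
  qed
  have "power_bounded T (t\<^sup>2) (b i)" if i: "i \<in> I" for i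
  proof -
    have qs: "disjoint_quads X (fst i)" "length (fst i) = m" using i by (auto simp: I_def)
    define S where "S u \<longleftrightarrow> (\<forall>q\<in>set (fst i). eig q u)" for u
    have Sconv: "S (conv g u)" if "S u" for g u
      using that disjoint_quads_mem[OF qs(1)] unfolding S_def by (blast intro: eig_conv)
    have bound: "ip (conv g u) (conv g u) \<le> t * ip u u" if "S u" "ip g g = ip f f" for g u
      using conv_eig_bound[OF qs(1), of u g] that qs(2) unfolding S_def t_def
      by (simp add: field_simps)
    have "S (T u) \<and> ip (T u) (T u) \<le> t\<^sup>2 * ip u u" if "S u" for u
    proof
      show "S (T u)" unfolding T_def by (intro Sconv that)
      have "ip (T u) (T u) \<le> t * ip (conv f u) (conv f u)" unfolding T_def by (intro bound Sconv that ff)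
      also have "\<dots> \<le> t * (t * ip u u)" using t0 by (intro mult_left_mono bound that refl)
      finally show "ip (T u) (T u) \<le> t\<^sup>2 * ip u u" by (simp add: power2_eq_square mult.assoc)
    qed
    moreover have "S (b i)" unfolding S_def b_def using eig_quads_proj[OF qs(1)] by blast
    ultimately show ?thesis by (intro power_bounded_invariant[where S = S]) auto
  qed
  then have "power_bounded T (t\<^sup>2) (\<lambda>x. \<Sum>i\<in>I. c i * b i x)" by (intro power_bounded_sum[OF linT finI]) auto
  then have "power_bounded T (t\<^sup>2) h" by (rule power_bounded_cong[OF linT]) (rule hb)
  then have "ip (T h) (T h) \<le> t\<^sup>2 * ip h h" by (intro power_bounded_norm saT) auto
  then have "(ip (T h) h)\<^sup>2 \<le> (t\<^sup>2 * ip h h) * ip h h"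
    by (intro order_trans[OF ip_Cauchy_Schwarz] mult_right_mono ip_nonneg)
  then have "(ip (T h) h)\<^sup>2 \<le> (t * ip h h)\<^sup>2"
    by (simp add: power_mult_distrib power2_eq_square[of "ip h h"] mult.assoc)
  then have "ip (T h) h \<le> t * ip h h"
    by (rule power2_le_imp_le[OF _ mult_nonneg_nonneg[OF t0 ip_nonneg]])
  moreover have "ip (T h) h = ip (conv f h) (conv f h)" unfolding T_def by (rule adjT)
  ultimately show ?thesis unfolding t_def by (simp add: field_simps)
qed

end

section \<open>Product-free sets\<close>

context sym_space
begin

lemma conv_add_right:
  assumes "\<And>x. x permutes X \<Longrightarrow> w x = u x + v x"
  shows "conv f w x = conv f u x + conv f v x"
  unfolding conv_def sum.distrib[symmetric] by (intro sum.cong) (simp_all add: assms distrib_left)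

lemma conv_add_left:
  assumes "\<And>x. x permutes X \<Longrightarrow> f x = u x + F x + h x" "x permutes X"
  shows "conv f w x = conv u w x + conv F w x + conv h w x"
  unfolding conv_def sum.distrib[symmetric]
  by (intro sum.cong) (simp_all add: assms permutes_compose permutes_inv distrib_right)

text \<open>The cross terms vanish because convolution with \<open>f\<close> keeps \<open>u\<close>
  low and \<open>v\<close> orthogonal.\<close>

lemma ip_conv_split:
  assumes u: "low e u" and v: "orth e v" and w: "\<And>x. x permutes X \<Longrightarrow> w x = u x + v x"
  shows "ip (conv f w) w = ip (conv f u) u + ip (conv f v) v"
proof -
  have "ip (conv f u) v = 0" using conv_low_right[OF u] v unfolding low_def by blast
  moreover have "ip (conv f v) u = 0"
    using conv_orth_right[OF v] u unfolding low_def ip_commute[of _ u] by blast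
  moreover have "ip (conv f w) w = ip (\<lambda>x. conv f u x + conv f v x) (\<lambda>x. u x + v x)"
    by (rule ip_cong) (simp_all add: w conv_add_right[OF w])
  moreover have "\<dots> = ip (conv f u) (\<lambda>x. u x + v x) + ip (conv f v) (\<lambda>x. u x + v x)"
    by (rule ip_add_left)
  moreover have "ip H (\<lambda>x. u x + v x) = ip H u + ip H v" for H
    unfolding ip_commute[of H] by (rule ip_add_left)
  ultimately show ?thesis by simp
qed

text \<open>Each of the other two terms is low because of one factor and orthogonal to that level
  because of the other, hence zero.\<close>

lemma conv_level:
  assumes F: "orth (d - 1) F" "low d F" and v: "low (d - 1) v" and h: "orth d h"
    and f: "\<And>x. x permutes X \<Longrightarrow> f x = v x + F x + h x" and x: "x permutes X"
  shows "conv f F x = conv F F x"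
proof -
  have "conv v F x = 0" by (rule low_orth_zero[OF conv_low_left[OF v] conv_orth_right[OF F(1)] x])
  moreover have "conv h F x = 0" by (rule low_orth_zero[OF conv_low_right[OF F(2)] conv_orth_left[OF h] x])
  ultimately show ?thesis using conv_add_left[OF f x, where w = F] by simp
qed

text \<open>\<open>low_norm_le\<close> controls the norms of \<open>F\<close> and of
  \<open>conv F F\<close> by their kernels, and the kernel of the latter by submultiplicativity.
  Each use divides by (n-d)!, which is the source of the loss n^(2d).\<close>

lemma triple_bound:
  assumes D: "D \<subseteq> X" and F: "low (card D) F"
    and E: "(\<Sum>z\<in>P. \<Sum>w\<in>P. (alt_avg D F z w)\<^sup>2) \<le> E"
  shows "(ip (conv F F) F)\<^sup>2 \<le> E ^ 3 / (fact (card X - card D))\<^sup>2"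
proof -
  let ?k = "fact (card X - card D) :: real"
  let ?G = "\<Sum>z\<in>P. \<Sum>w\<in>P. (alt_avg D F z w)\<^sup>2"
  have G0: "0 \<le> ?G" by (intro sum_nonneg) auto
  have "ip F F \<le> ?G / ?k" by (rule low_norm_le[OF D F])
  also have "\<dots> \<le> E / ?k" by (intro divide_right_mono E) simp
  finally have 1: "ip F F \<le> E / ?k" .
  have "ip (conv F F) (conv F F) \<le> (\<Sum>z\<in>P. \<Sum>w\<in>P. (alt_avg D (conv F F) z w)\<^sup>2) / ?k"
    by (rule low_norm_le[OF D conv_low_right[OF F]])
  also have "\<dots> \<le> (?G * ?G) / ?k" by (intro divide_right_mono alt_avg_conv_norm) simp
  also have "\<dots> \<le> (E * E) / ?k" using G0 E by (intro divide_right_mono mult_mono) auto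
  finally have 2: "ip (conv F F) (conv F F) \<le> E * E / ?k" .
  have "(ip (conv F F) F)\<^sup>2 \<le> ip (conv F F) (conv F F) * ip F F" by (rule ip_Cauchy_Schwarz)
  also have "\<dots> \<le> (E * E / ?k) * (E / ?k)"
    using G0 E by (intro mult_mono 1 2 ip_nonneg) auto
  finally show ?thesis by (simp add: power3_eq_cube power2_eq_square mult.assoc)
qed

lemma orth_norm_le:
  assumes "low d G" "orth d (\<lambda>x. f x - G x)"
  shows "ip (\<lambda>x. f x - G x) (\<lambda>x. f x - G x) \<le> ip f f"
proof -
  let ?h = "\<lambda>x. f x - G x"
  have "ip G ?h = 0" using assms unfolding low_def by blast
  moreover have "ip ?h H = ip f H - ip G H" for H by (rule ip_diff_left)
  moreover have "ip G ?h = ip G f - ip G G" unfolding ip_commute[of G ?h] ip_diff_left by (simp add: ip_commute[of f G])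
  moreover have "ip f ?h = ip f f - ip G f" unfolding ip_commute[of f ?h] ip_diff_left by (simp add: ip_commute[of f G])
  ultimately show ?thesis using ip_nonneg[of G] by simp
qed

lemma high_term_bound:
  assumes n: "4 * m + 5 \<le> card X" and G: "low (4 * m) G" "orth (4 * m) (\<lambda>x. f x - G x)"
  defines "h \<equiv> \<lambda>x. f x - G x"
  shows "2 ^ m * (ip (conv f h) h)\<^sup>2 \<le> fact (card X) * (ip f f) ^ 3"
proof -
  have h: "orth (4 * m) h" "ip h h \<le> ip f f"
    using G orth_norm_le[OF G] unfolding h_def by auto
  have "2 ^ m * (ip (conv f h) h)\<^sup>2 \<le> (2 ^ m * ip (conv f h) (conv f h)) * ip h h"
    using ip_Cauchy_Schwarz[of "conv f h" h] by (simp add: mult.assoc)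
  also have "\<dots> \<le> (fact (card X) * ip f f * ip h h) * ip h h"
    by (intro mult_right_mono conv_high_bound n h ip_nonneg)
  also have "\<dots> \<le> (fact (card X) * ip f f * ip f f) * ip f f"
    by (intro mult_mono h mult_nonneg_nonneg ip_nonneg) auto
  finally show ?thesis by (simp add: power3_eq_cube mult.assoc)
qed

text \<open>With mean \<open>\<mu>\<close> over all permutations and support in the even half,
  \<open>f\<close> has mean \<open>2 * \<mu>\<close> on that half, which is its level-0
  part.\<close>

lemma main_level:
  assumes f: "\<And>x. x permutes X \<Longrightarrow> \<not> evenperm x \<Longrightarrow> f x = 0" and c: "2 * real (card (alts X)) = fact (card X)"
    and \<mu>: "avg P f = \<mu>"
  defines "E \<equiv> \<lambda>x. if evenperm x then 2 * \<mu> else 0"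
  shows "low 0 E" "orth 0 (\<lambda>x. f x - E x)" "ip (conv f E) E = 2 * \<mu> ^ 3 * (fact (card X))\<^sup>2"
proof -
  let ?g = "fact (card X) :: real"
  have par: "evenperm (x \<circ> y) \<longleftrightarrow> (evenperm x \<longleftrightarrow> evenperm y)" if "x permutes X" "y permutes X" for x y
    using that by (simp add: evenperm_comp permutation_perm)
  have sum_f: "(\<Sum>x\<in>P. f x) = \<mu> * ?g" using \<mu> unfolding avg_def cardP by (simp add: field_simps)
  show "low 0 E"
    by (rule invariant_low[of "{}"]) (auto simp: E_def par)
  show "orth 0 (\<lambda>x. f x - E x)"
    unfolding orth_def
  proof (intro allI impI)
    fix Q x assume "Q \<subseteq> X" "card Q \<le> 0" and x: "x permutes X"
    then have Q: "Q = {}" using finite_subset[OF _ finX] by simp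
    show "(\<Sum>\<alpha>\<in>alts (X - Q). f (x \<circ> \<alpha>) - E (x \<circ> \<alpha>)) = 0"
    proof (cases "evenperm x")
      case True
      have "(\<Sum>\<alpha>\<in>alts X. f (x \<circ> \<alpha>)) = (\<Sum>\<alpha>\<in>P. f (x \<circ> \<alpha>))"
        using True f[OF permutes_compose[OF _ x]] par[OF x] by (intro sum.mono_neutral_left finP) auto
      also have "\<dots> = \<mu> * ?g" using setum_permutations_compose_left[OF x, of f] sum_f by simp
      finally have "(\<Sum>\<alpha>\<in>alts X. f (x \<circ> \<alpha>)) = \<mu> * ?g" .
      moreover have "(\<Sum>\<alpha>\<in>alts X. E (x \<circ> \<alpha>)) = (\<Sum>\<alpha>\<in>alts X. 2 * \<mu>)"
        using True par[OF x] by (intro sum.cong) (auto simp: E_def)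
      ultimately show ?thesis using c by (simp add: Q sum_subtractf)
    next
      case False
      then show ?thesis using f[OF permutes_compose[OF _ x]] par[OF x] by (intro sum.neutral) (auto simp: Q E_def)
    qed
  qed
  have e: "conv f E x = 2 * \<mu> * (\<mu> * ?g)" if x: "x permutes X" "evenperm x" for x
  proof -
    have "conv f E x = (\<Sum>y\<in>P. 2 * \<mu> * f (x \<circ> inv' y))"
      unfolding conv_def
    proof (rule sum.cong[OF refl])
      fix y assume "y \<in> P"
      then have y: "y permutes X" by simp
      have "f (x \<circ> inv' y) = 0" if "\<not> evenperm y"
        using f[OF permutes_compose[OF permutes_inv[OF y] x(1)]] that x par[OF x(1) permutes_inv[OF y]]
        by (simp add: evenperm_inv[OF permutation_perm[OF y]])
      then show "f (x \<circ> inv' y) * E y = 2 * \<mu> * f (x \<circ> inv' y)" by (auto simp: E_def)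
    qed
    also have "\<dots> = 2 * \<mu> * (\<Sum>y\<in>P. f (x \<circ> y))"
      unfolding sum_distrib_left using sum_permutations_inverse[of "\<lambda>y. 2 * \<mu> * f (x \<circ> y)" X] by simp
    finally show ?thesis using setum_permutations_compose_left[OF x(1), of f] sum_f by simp
  qed
  have "ip (conv f E) E = (\<Sum>x\<in>alts X. conv f E x * E x)"
    unfolding ip_def by (intro sum.mono_neutral_right finP) (auto simp: E_def)
  also have "\<dots> = (\<Sum>x\<in>alts X. 2 * \<mu> * (\<mu> * ?g) * (2 * \<mu>))"
    by (intro sum.cong refl) (simp add: e, simp add: E_def)
  also have "\<dots> = (2 * real (card (alts X))) * (2 * \<mu> ^ 3 * ?g)" by (simp add: power3_eq_cube)
  finally show "ip (conv f E) E = 2 * \<mu> ^ 3 * ?g\<^sup>2" unfolding c by (simp add: power2_eq_square)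
qed

end

section \<open>Level terms against the main term\<close>

lemma fact_le_power_diff: "d \<le> n \<Longrightarrow> fact n \<le> real n ^ d * fact (n - d)"
proof (induction d)
  case (Suc d)
  have "(fact (n - d) :: real) = real (n - d) * fact (n - Suc d)"
    using Suc.prems fact_reduce[of "n - d"] by (simp del: of_nat_diff)
  also have "\<dots> \<le> real n * fact (n - Suc d)" by (intro mult_right_mono) auto
  finally have "real n ^ d * fact (n - d) \<le> real n ^ d * (real n * fact (n - Suc d))" by (intro mult_left_mono) auto
  from order_trans[OF Suc.IH this] Suc.prems show ?case by (simp add: mult_ac)
qed simp

context paired_space
begin

text \<open>The bound on the kernels enters cubed and contributes 8 and \<kappa>^(3d), the
  factorials lose n^(2d). By the smallness condition the squared ratio to \<open>\<mu>\<close> ^ 3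
  n!^2 is at most 8 / 64^d, and the square root of 8 is below 3.\<close>

lemma level_term_bound:
  assumes K: "paired X K" "K \<noteq> {}" "card K = d" "2 \<le> card (X - K)"
    and F: "orth (d - 1) F" "low d F" and Fe: "\<And>x. x permutes X \<Longrightarrow> \<not> evenperm x \<Longrightarrow> F x = 0"
    and v: "low (d - 1) v" and h: "orth d h" and f: "\<And>x. x permutes X \<Longrightarrow> f x = v x + F x + h x"
    and bound: "avg2 X (\<lambda>z w. (diff X K f z w)\<^sup>2) \<le> \<mu>\<^sup>2 * \<kappa> ^ d" and \<mu>: "0 \<le> \<mu>" and \<kappa>: "0 \<le> \<kappa>"
    and small: "64 * ((real (card X))\<^sup>2 * \<kappa> ^ 3) \<le> 1"
  shows "\<bar>ip (conv f F) F\<bar> \<le> 3 * (1 / 8) ^ d * (\<mu> ^ 3 * (fact (card X))\<^sup>2)"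
proof -
  let ?n = "card X"
  let ?g = "fact ?n :: real" and ?k = "fact (?n - d) :: real"
  define E where "E = 2 * (?g\<^sup>2 * (\<mu>\<^sup>2 * \<kappa> ^ d))"
  have KX: "K \<subseteq> X" using K(1) unfolding paired_def by blast
  have dn: "d \<le> ?n" using card_mono[OF finX KX] K(3) by simp
  have "(\<Sum>z\<in>P. \<Sum>w\<in>P. (alt_avg K F z w)\<^sup>2) \<le> 2 * (\<Sum>z\<in>P. \<Sum>w\<in>P. (coset_avg X K F z w)\<^sup>2)"
    by (rule alt_avg_norm_le[OF K(4) Fe])
  also have "\<dots> \<le> 2 * (\<Sum>z\<in>P. \<Sum>w\<in>P. (diff X K f z w)\<^sup>2)"
    using level_part_le_diff[OF K(1,2), of F v h f] F(1) v h f K(3) by simp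
  also have "(\<Sum>z\<in>P. \<Sum>w\<in>P. (diff X K f z w)\<^sup>2) = ?g\<^sup>2 * avg2 X (\<lambda>z w. (diff X K f z w)\<^sup>2)"
    unfolding avg2_def avg_def cardP by (simp add: power2_eq_square flip: sum_divide_distrib)
  also have "2 * (?g\<^sup>2 * avg2 X (\<lambda>z w. (diff X K f z w)\<^sup>2)) \<le> E"
    unfolding E_def by (intro mult_left_mono bound) auto
  finally have "(ip (conv F F) F)\<^sup>2 \<le> E ^ 3 / ?k\<^sup>2"
    using triple_bound[OF KX, of F E] F(2) K(3) by simp
  moreover have "ip (conv F F) F = ip (conv f F) F"
    by (rule ip_cong) (simp_all add: conv_level[OF F v h f])
  ultimately have "(ip (conv f F) F)\<^sup>2 \<le> E ^ 3 / ?k\<^sup>2" by simp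
  also have "\<dots> \<le> (real ?n ^ d)\<^sup>2 * (8 * ?g ^ 4 * \<mu> ^ 6 * (\<kappa> ^ d) ^ 3)"
  proof -
    have "E ^ 3 = ?g\<^sup>2 * (8 * ?g ^ 4 * \<mu> ^ 6 * (\<kappa> ^ d) ^ 3)" unfolding E_def by algebra
    also have "\<dots> \<le> (real ?n ^ d * ?k)\<^sup>2 * (8 * ?g ^ 4 * \<mu> ^ 6 * (\<kappa> ^ d) ^ 3)"
      using \<mu> \<kappa> by (intro mult_right_mono power_mono fact_le_power_diff dn) auto
    finally show ?thesis by (simp add: field_simps)
  qed
  also have "\<dots> = ((real ?n)\<^sup>2 * \<kappa> ^ 3) ^ d * (8 * (\<mu> ^ 3 * ?g\<^sup>2)\<^sup>2)"
  proof -
    have e: "((real ?n)\<^sup>2 * \<kappa> ^ 3) ^ d = (real ?n ^ d)\<^sup>2 * (\<kappa> ^ d) ^ 3"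
      by (simp only: power_mult_distrib power_mult[symmetric] mult.commute[of d])
    show ?thesis unfolding e by algebra
  qed
  also have "\<dots> \<le> (1 / 64) ^ d * (9 * (\<mu> ^ 3 * ?g\<^sup>2)\<^sup>2)"
    using small \<kappa> \<mu> by (intro mult_mono power_mono) auto
  also have "\<dots> = (3 * (1 / 8) ^ d * (\<mu> ^ 3 * ?g\<^sup>2))\<^sup>2"
  proof -
    have "(1 / 64 :: real) ^ d = ((1 / 8)\<^sup>2) ^ d" by (simp add: power2_eq_square)
    also have "\<dots> = ((1 / 8) ^ d)\<^sup>2" by (simp only: power_mult[symmetric] mult.commute[of d])
    finally show ?thesis by (simp only: power_mult_distrib) simp
  qed
  finally have "\<bar>ip (conv f F) F\<bar> \<le> \<bar>3 * (1 / 8) ^ d * (\<mu> ^ 3 * ?g\<^sup>2)\<bar>" by (simp only: abs_le_square_iff)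
  moreover have "0 \<le> 3 * (1 / 8) ^ d * (\<mu> ^ 3 * ?g\<^sup>2)" using \<mu> by simp
  ultimately show ?thesis by (simp only: abs_of_nonneg)
qed

text \<open>With \<open>M\<close> = \<open>\<mu>\<close> ^ 3 n!^2 the main term is 2M, the levels up
  to 32a subtract at most the geometric series 3 (1/8 + 1/64 + ...) M = 3/7 M, and the high part at
  most M/2. The level inequality is used with \<open>l\<close> = 32a, whence 512 = 16 * 32.\<close>

theorem ip_conv_pos:
  assumes f: "\<And>x. 0 \<le> f x \<and> f x \<le> 1" "\<And>x. f x * f x = f x" "\<And>x. x permutes X \<Longrightarrow> \<not> evenperm x \<Longrightarrow> f x = 0"
    and c: "2 * real (card (alts X)) = fact (card X)"
    and glob: "globally_bounded X R \<mu> f" and \<mu>: "avg P f = \<mu>" and R: "11 \<le> R"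
    and a: "0 < a" "exp (- real a) \<le> \<mu>"
    and B: "paired X B" "m0 + 32 * a \<le> card B" and m0: "512 * a \<le> m0"
    and small: "64 * ((real (card X))\<^sup>2 * (512 * R\<^sup>2 * a / m0) ^ 3) \<le> 1"
  shows "0 < ip (conv f f) f"
proof -
  define \<kappa> where "\<kappa> = 512 * R\<^sup>2 * a / m0"
  define M where "M = \<mu> ^ 3 * (fact (card X))\<^sup>2"
  define E where "E x = (if evenperm x then 2 * \<mu> else 0)" for x :: "'a \<Rightarrow> 'a"
  have \<mu>0: "0 < \<mu>" using a(2) exp_gt_zero[of "- real a"] by linarith
  have M0: "0 < M" unfolding M_def using \<mu>0 by simp
  have E: "low 0 E" "orth 0 (\<lambda>x. f x - E x)" "ip (conv f E) E = 2 * M"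
    using main_level[OF f(3) c \<mu>] unfolding E_def[abs_def] M_def by simp_all
  have BX: "B \<subseteq> X" "\<theta> ` B \<subseteq> X" "B \<inter> \<theta> ` B = {}" using B(1) unfolding paired_def by auto
  have finB: "finite B" using finite_subset[OF BX(1) finX] .
  have "card (\<theta> ` B) = card B" by (rule card_image) (metis inj_onI \<theta>\<theta>)
  then have "2 * card B = card (B \<union> \<theta> ` B)" using finB BX(3) by (simp add: card_Un_disjoint)
  also have "\<dots> \<le> card X" using BX by (intro card_mono finX) auto
  finally have cX: "2 * card B \<le> card X" .
  \<comment> \<open>\<open>G 0\<close> is pinned to \<open>E\<close>, so that the induction over the
    levels starts from the explicit main term.\<close>
  have "\<exists>G. low d G \<and> orth d (\<lambda>x. f x - G x) \<and> (\<forall>x. x permutes X \<longrightarrow> \<not> evenperm x \<longrightarrow> G x = 0) \<and> (d = 0 \<longrightarrow> G = E)" for d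
  proof (cases "d = 0")
    case True
    then show ?thesis using E(1,2) by (intro exI[of _ E]) (auto simp: E_def)
  next
    case False
    then show ?thesis using level_decomposition[where F = f and d = d] f(3) by auto
  qed
  then obtain G where G: "\<And>d. low d (G d)" "\<And>d. orth d (\<lambda>x. f x - G d x)"
      "\<And>d x. x permutes X \<Longrightarrow> \<not> evenperm x \<Longrightarrow> G d x = 0" "G 0 = E"
    by metis
  have levels: "(2 - 3 / 7 * (1 - (1 / 8) ^ d)) * M \<le> ip (conv f (G d)) (G d)" if "d \<le> 32 * a" for d
    using that
  proof (induction d)
    case 0
    then show ?case using E(3) by (simp add: G(4))
  next
    case (Suc d)
    define F where "F x = G (Suc d) x - G d x" for x
    define h where "h x = f x - G (Suc d) x" for x
    have "Suc d \<le> card B" using Suc.prems B(2) by simp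
    then obtain K where K: "K \<subseteq> B" "card K = Suc d" by (meson obtain_subset_with_card_n)
    have pK: "paired X K" by (rule paired_mono[OF B(1) K(1)])
    have Kn: "K \<noteq> {}" using K(2) by auto
    have cK: "2 \<le> card (X - K)"
      using cX K Suc.prems B(2) m0 a(1) BX(1) card_Diff_subset[OF finite_subset[OF K(1) finB], of X] by auto
    have "orth d (\<lambda>x. (f x - G d x) - h x)"
      unfolding h_def by (intro orth_diff G(2) orth_mono[OF G(2)]) simp
    then have Fo: "orth d F" by (simp add: F_def[abs_def] h_def)
    have Fl: "low (Suc d) F" unfolding F_def[abs_def] by (intro low_diff G(1) low_mono[OF G(1)]) simp
    have ho: "orth (Suc d) h" unfolding h_def[abs_def] by (rule G(2))
    have "avg2 X (\<lambda>z w. (diff X K f z w)\<^sup>2) \<le> \<mu>\<^sup>2 * (16 * R\<^sup>2 * real (32 * a) / m0) ^ Suc d"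
    proof (rule level_inequality[OF _ _ R _ finX B(1) K(1) K(2) _ f(1) glob])
      show "exp (- real (32 * a)) \<le> \<mu>" using a by (intro order_trans[OF _ a(2)]) simp
    qed (use a m0 B(2) Suc.prems in auto)
    then have bd: "avg2 X (\<lambda>z w. (diff X K f z w)\<^sup>2) \<le> \<mu>\<^sup>2 * \<kappa> ^ Suc d"
      by (simp add: \<kappa>_def mult_ac)
    have "\<bar>ip (conv f F) F\<bar> \<le> 3 * (1 / 8) ^ Suc d * (\<mu> ^ 3 * (fact (card X))\<^sup>2)"
    proof (rule level_term_bound[OF pK Kn K(2) cK _ Fl _ _ ho _ bd])
      show "low (Suc d - 1) (G d)" "orth (Suc d - 1) F" using Fo G(1) by auto
      show "64 * ((real (card X))\<^sup>2 * \<kappa> ^ 3) \<le> 1" unfolding \<kappa>_def by (rule small)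
      show "0 \<le> \<kappa>" unfolding \<kappa>_def by simp
    qed (use \<mu>0 G(3) in \<open>auto simp: F_def h_def\<close>)
    moreover have "ip (conv f (G (Suc d))) (G (Suc d)) = ip (conv f (G d)) (G d) + ip (conv f F) F"
      by (rule ip_conv_split[OF G(1) Fo]) (simp add: F_def)
    moreover have "(2 - 3 / 7 * (1 - (1 / 8) ^ Suc d)) * M = (2 - 3 / 7 * (1 - (1 / 8) ^ d)) * M - 3 * (1 / 8) ^ Suc d * M"
      by (simp add: algebra_simps)
    ultimately show ?case using Suc unfolding M_def by simp
  qed
  define h where "h x = f x - G (32 * a) x" for x
  have "ip f f = (\<Sum>x\<in>P. f x)" unfolding ip_def by (simp add: f(2))
  also have "\<dots> = \<mu> * fact (card X)" using \<mu> unfolding avg_def cardP by (simp add: field_simps)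
  finally have ff: "ip f f = \<mu> * fact (card X)" .
  have split: "ip (conv f f) f = ip (conv f (G (32 * a))) (G (32 * a)) + ip (conv f h) h"
    unfolding h_def by (rule ip_conv_split[OF G(1) G(2)]) simp
  \<comment> \<open>8a quadruples occupy 32a points, which matches the level down to which
    \<open>f\<close> has been stripped.\<close>
  have "2 ^ (8 * a) * (ip (conv f h) h)\<^sup>2 \<le> fact (card X) * (ip f f) ^ 3"
    unfolding h_def[abs_def]
    by (rule high_term_bound) (use G(1)[of "32 * a"] G(2)[of "32 * a"] cX B(2) a(1) m0 in \<open>auto simp: mult.assoc\<close>)
  also have "\<dots> = (fact (card X)) ^ 4 * \<mu> ^ 3" unfolding ff by algebra
  finally have high: "2 ^ (8 * a) * (ip (conv f h) h)\<^sup>2 \<le> (fact (card X)) ^ 4 * \<mu> ^ 3" .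
  \<comment> \<open>The reason for 8a: 256 e^-3 is at least 4 by the crude bound e^3 \<le> 64. The
    gain thus beats three factors of the density and leaves the 4 that brings the high term below
    M/2.\<close>
  have "4 \<le> 2 ^ (8 * a) * \<mu> ^ 3"
  proof -
    have "exp 3 = exp (1::real) ^ 3" by (simp flip: exp_of_nat_mult)
    also have "\<dots> \<le> 3 ^ 3" using exp_le by (intro power_mono) auto
    finally have e3: "exp 3 \<le> (64::real)" by simp
    have "(4::real) \<le> 4 ^ a" using power_increasing[of 1 a "4::real"] a(1) by simp
    also have "\<dots> \<le> (256 * exp (- 3)) ^ a"
      using e3 by (intro power_mono) (auto simp: exp_minus field_simps)
    also have "\<dots> = 2 ^ (8 * a) * exp (- real a) ^ 3"
      by (simp add: power_mult_distrib power_mult flip: exp_of_nat_mult)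
    also have "\<dots> \<le> 2 ^ (8 * a) * \<mu> ^ 3" using a(2) by (intro mult_left_mono power_mono) auto
    finally show ?thesis .
  qed
  from mult_mono[OF this high]
  have "4 * (2 ^ (8 * a) * (ip (conv f h) h)\<^sup>2) \<le> (2 ^ (8 * a) * \<mu> ^ 3) * (fact (card X) ^ 4 * \<mu> ^ 3)"
    using \<mu>0 by simp
  also have "\<dots> = 2 ^ (8 * a) * M\<^sup>2" unfolding M_def by algebra
  finally have "(2 * ip (conv f h) h)\<^sup>2 \<le> M\<^sup>2" by (simp add: power_mult_distrib)
  then have "\<bar>2 * ip (conv f h) h\<bar> \<le> M" using M0 abs_le_square_iff[of "2 * ip (conv f h) h" M] by simp
  moreover have "3 / 2 * M \<le> (2 - 3 / 7 * (1 - (1 / 8) ^ (32 * a))) * M"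
    using M0 zero_le_power[of "1 / 8 :: real" "32 * a"] by (intro mult_right_mono) (simp_all del: zero_le_power)
  ultimately show ?thesis using levels[of "32 * a"] M0 unfolding split by linarith
qed

end

section \<open>From the stated notions to averages over cosets\<close>

lemma umvirate_eq_coset:
  assumes "S \<subseteq> {1..n}" "a permutes {1..n}" "b permutes {1..n}" "set xs = S"
  shows "umvirate n (map (inv' b) xs) (map a xs) = (\<lambda>y. a \<circ> y \<circ> b) ` perms ({1..n} - S)"
proof (intro equalityI subsetI)
  fix \<sigma> assume "\<sigma> \<in> umvirate n (map (inv' b) xs) (map a xs)"
  then have nth: "\<sigma> (inv' b (xs ! i)) = a (xs ! i)" if "i < length xs" for i
    using that by (auto simp: umvirate_def sym_group_carrier)
  have eq: "\<sigma> (inv' b s) = a s" if "s \<in> S" for s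
    using that nth unfolding assms(4)[symmetric] in_set_conv_nth by blast
  have "\<sigma> permutes {1..n}" using \<open>\<sigma> \<in> umvirate _ _ _\<close> by (simp add: umvirate_def sym_group_carrier)
  then have y: "inv' a \<circ> \<sigma> \<circ> inv' b permutes {1..n}" by (intro permutes_compose permutes_inv assms)
  have "inv' a \<circ> \<sigma> \<circ> inv' b permutes {1..n} - S"
    by (rule permutes_superset[OF y]) (use eq permutes_inverses(2)[OF assms(2)] in auto)
  moreover have "\<sigma> = a \<circ> (inv' a \<circ> \<sigma> \<circ> inv' b) \<circ> b"
    using permutes_inverses[OF assms(2)] permutes_inverses[OF assms(3)] by (simp add: fun_eq_iff)
  ultimately show "\<sigma> \<in> (\<lambda>y. a \<circ> y \<circ> b) ` perms ({1..n} - S)" by blast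
next
  fix \<sigma> assume "\<sigma> \<in> (\<lambda>y. a \<circ> y \<circ> b) ` perms ({1..n} - S)"
  then obtain y where y: "y permutes {1..n} - S" "\<sigma> = a \<circ> y \<circ> b" by blast
  then have "\<sigma> permutes {1..n}"
    using permutes_subset[OF y(1)] assms(2,3) by (auto intro!: permutes_compose)
  moreover have "\<sigma> (inv' b s) = a s" if "s \<in> S" for s
    using y that permutes_inverses(1)[OF assms(3)] permutes_not_in[OF y(1), of s] by simp
  ultimately show "\<sigma> \<in> umvirate n (map (inv' b) xs) (map a xs)"
    using assms(4) by (auto simp: umvirate_def sym_group_carrier)
qed

lemma l2norm_on_indicator: "l2norm_on U (indicator A) = sqrt (avg U (indicator A))"
proof -
  have "\<bar>indicator A x\<bar>\<^sup>2 = (indicator A x :: real)" for x by (simp add: indicator_def)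
  then show ?thesis by (simp only: l2norm_on_def avg_def)
qed

text \<open>The 2-norm of an indicator is the square root of its mean, so squaring the inequality
  squares \<open>r\<close>. The tuples are an enumeration of \<open>S\<close> mapped by
  \<open>a\<close> and by the inverse of \<open>b\<close>.\<close>

lemma global_set_globally_bounded:
  assumes "global_set n r A"
  shows "globally_bounded {1..n} (r\<^sup>2) (avg (perms {1..n}) (indicator A)) (indicator A)"
  unfolding globally_bounded_def
proof (intro allI impI)
  fix S a b assume S: "S \<subseteq> {1..n}" and a: "a permutes {1..n}" and b: "b permutes {1..n}"
  define xs where "xs = sorted_list_of_set S"
  have xs: "set xs = S" "distinct xs" "length xs = card S"
    using finite_subset[OF S] by (auto simp: xs_def)
  let ?U = "umvirate n (map (inv' b) xs) (map a xs)"
  let ?v = "avg (perms ({1..n} - S)) (\<lambda>y. indicator A (a \<circ> y \<circ> b) :: real)"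
  let ?\<mu> = "avg (perms {1..n}) (indicator A) :: real"
  have tuples: "map p xs \<in> distinct_tuples n (card S)" if "p permutes {1..n}" for p
  proof -
    have "inj_on p (set xs)" using permutes_inj_on[OF that] .
    moreover have "p ` S \<subseteq> {1..n}" using image_mono[OF S, of p] unfolding permutes_image[OF that] .
    ultimately show ?thesis using xs unfolding distinct_tuples_def by (simp add: distinct_map)
  qed
  from assms[unfolded global_set_def, rule_format, OF tuples[OF permutes_inv[OF b]] tuples[OF a]]
  have "l2norm_on ?U (indicator A) \<le> r ^ card S * l2norm_on (carrier (sym_group n)) (indicator A)" .
  moreover have "carrier (sym_group n) = perms {1..n}" by (auto simp: sym_group_carrier)
  moreover have "avg ?U (indicator A) = ?v"
  proof -
    have "inj_on (\<lambda>y. a \<circ> y \<circ> b) (perms ({1..n} - S))"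
    proof (rule inj_onI)
      fix y y' assume "a \<circ> y \<circ> b = a \<circ> y' \<circ> b"
      then have "inv' a \<circ> (a \<circ> y \<circ> b) \<circ> inv' b = inv' a \<circ> (a \<circ> y' \<circ> b) \<circ> inv' b" by simp
      then show "y = y'"
        using permutes_inverses[OF a] permutes_inverses[OF b] by (simp add: fun_eq_iff)
    qed
    then show ?thesis
      unfolding avg_def umvirate_eq_coset[OF S a b xs(1)] by (simp add: sum.reindex card_image)
  qed
  ultimately have "sqrt ?v \<le> r ^ card S * sqrt ?\<mu>" by (simp add: l2norm_on_indicator)
  moreover have v: "0 \<le> ?v" "0 \<le> ?\<mu>" by (auto intro: avg_nonneg)
  ultimately have "(sqrt ?v)\<^sup>2 \<le> (r ^ card S * sqrt ?\<mu>)\<^sup>2" by (intro power_mono) auto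
  then show "?v \<le> (r\<^sup>2) ^ card S * ?\<mu>"
    using v by (simp add: power_mult_distrib power_mult[symmetric] mult.commute[of 2])
qed

lemma (in sym_space) product_free_ip:
  assumes "\<And>x y. x \<in> A \<Longrightarrow> y \<in> A \<Longrightarrow> x \<circ> y \<notin> A"
  shows "ip (conv (indicator A) (indicator A)) (indicator A) = 0"
proof -
  have "indicator A (x \<circ> inv' y) * indicator A y * indicator A x = (0 :: real)" if y: "y permutes X" for x y
  proof (rule ccontr)
    assume "indicator A (x \<circ> inv' y) * indicator A y * indicator A x \<noteq> (0 :: real)"
    then have "x \<circ> inv' y \<in> A" "y \<in> A" "x \<in> A" by (auto simp: indicator_def split: if_splits)
    moreover have "x \<circ> inv' y \<circ> y = x" by (rule comp_inv_cancel[OF y])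
    ultimately show False using assms[of "x \<circ> inv' y" y] by simp
  qed
  then show ?thesis unfolding ip_def conv_def sum_distrib_right by (intro sum.neutral ballI) simp
qed

text \<open>The translate of \<open>A\<close> by one of its elements is disjoint from
  \<open>A\<close>. This crude bound excludes small \<open>n\<close> in the final argument.\<close>

lemma product_free_card:
  assumes A: "A \<subseteq> carrier (alt_group n)" and pf: "product_free (alt_group n) A"
  shows "2 * card A \<le> card (carrier (alt_group n))"
proof (cases "A = {}")
  case False
  then obtain x where x: "x \<in> A" by blast
  have fin: "finite (carrier (alt_group n))"
    by (rule finite_subset[OF _ finite_permutations[of "{1..n}"]]) (auto simp: alt_group_carrier)
  have "inj_on ((\<circ>) x) A"
    using permutes_inj[of x "{1..n}"] A x by (auto simp: inj_on_def fun_eq_iff alt_group_carrier dest: injD)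
  then have "card ((\<circ>) x ` A) = card A" by (rule card_image)
  moreover have "(\<circ>) x ` A \<inter> A = {}" using pf x unfolding product_free_def alt_group_mult by blast
  moreover have "(\<circ>) x ` A \<subseteq> carrier (alt_group n)"
  proof
    fix y assume "y \<in> (\<circ>) x ` A"
    then obtain z where "z \<in> A" "y = x \<circ> z" by blast
    then show "y \<in> carrier (alt_group n)"
      using group.is_monoid[OF alt_group_is_group, of n] monoid.m_closed[of "alt_group n" x z] x A
      by (auto simp: alt_group_mult)
  qed
  ultimately have "card A + card A \<le> card (carrier (alt_group n))"
    using A card_mono[OF fin, of "(\<circ>) x ` A \<union> A"] finite_subset[OF A fin] by (simp add: card_Un_disjoint)
  then show ?thesis by simp
qed simp

text \<open>The identity elsewhere because \<open>pairing\<close> demands an involution of the whole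
  type; with \<open>h\<close> = n div 2 and odd \<open>n\<close> the last point stays
  unpaired.\<close>

definition half_shift :: "nat \<Rightarrow> nat \<Rightarrow> nat" where
  "half_shift h i = (if 1 \<le> i \<and> i \<le> h then i + h else if h < i \<and> i \<le> 2 * h then i - h else i)"

theorem theorem1p12:
  shows "\<exists>c::real. c > 0 \<and>
    (\<forall>n::nat. n > 0 \<longrightarrow>
      (\<forall>A. A \<subseteq> carrier (alt_group n) \<longrightarrow> product_free (alt_group n) A \<longrightarrow> global_set n 100 A \<longrightarrow>
        alt_density n A < exp (- c * real n powr (1/3))))"
\<comment> \<open>For R = 10^4 the smallness condition is ensured by 163840 * 10^8 * a \<le> t. The
  constant 1/10^14 yields 2 * 10^13 * a \<le> t even after \<open>a\<close> is rounded up.\<close>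
proof (intro exI[of _ "1 / 10 ^ 14"] conjI allI impI)
  fix n :: nat and A
  assume n: "0 < n" and A: "A \<subseteq> carrier (alt_group n)" and pf: "product_free (alt_group n) A"
    and glob: "global_set n 100 A"
  define t where "t = real n powr (1/3)"
  have "alt_density n A < exp (- (1 / 10 ^ 14) * t)"
  proof (rule ccontr)
    assume "\<not> alt_density n A < exp (- (1 / 10 ^ 14) * t)"
    then have dense: "exp (- (t / 10 ^ 14)) \<le> alt_density n A" by simp
    have "2 * real (card A) \<le> real (card (carrier (alt_group n)))"
      using product_free_card[OF A pf] by simp
    then have "alt_density n A \<le> 1 / 2"
      unfolding alt_density_def by (cases "card (carrier (alt_group n)) = 0") (auto simp: field_simps)
    \<comment> \<open>From 1 - t/10^14 \<le> 1/2; only large \<open>n\<close> remain.\<close>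
    then have t: "5 * 10 ^ 13 \<le> t" using dense exp_ge_add_one_self[of "- (t / 10 ^ 14)"] by simp
    have tn: "real n = t ^ 3" unfolding t_def using n by (simp add: powr_power)
    have "t * 1 \<le> t * t\<^sup>2" using t by (intro mult_left_mono one_le_power) auto
    then have nt: "t \<le> real n" unfolding tn by (simp add: power3_eq_cube power2_eq_square)
    then have "8 \<le> real n" using t by simp
    then have nbig: "8 \<le> n" by simp
    define X where "X = {1..n}"
    define f where "f = (indicator A :: _ \<Rightarrow> real)"
    define \<mu> where "\<mu> = avg (perms X) f"
    \<comment> \<open>The extra 1 absorbs the factor 2 between the densities in the alternating and
      the symmetric group, as e is at least 2.\<close>
    define a where "a = nat \<lceil>t / 10 ^ 14 + 1\<rceil>"
    \<comment> \<open>About half of the n div 2 available pairs; the other half leaves room for the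
      32a levels.\<close>
    define m0 where "m0 = n div 4"
    have "0 \<le> t / 10 ^ 14 + 1" using t by simp
    from order_trans[OF this le_of_int_ceiling]
    have "0 \<le> \<lceil>t / 10 ^ 14 + 1\<rceil>" by (simp only: of_int_0_le_iff)
    then have "real a = of_int \<lceil>t / 10 ^ 14 + 1\<rceil>" unfolding a_def by (rule of_nat_nat)
    then have a: "t / 10 ^ 14 + 1 \<le> a" "real a \<le> t / 10 ^ 14 + 2"
      using of_int_ceiling_le_add_one[of "t / 10 ^ 14 + 1"] le_of_int_ceiling[of "t / 10 ^ 14 + 1"] by linarith+
    then have at: "20 * 10 ^ 12 * real a \<le> t" and a0: "0 < a" using t by (auto simp: field_simps)
    have m0: "n \<le> 8 * m0" using nbig unfolding m0_def by linarith
    have card_alt: "2 * card (carrier (alt_group n)) = fact n" using nbig by (intro alt_group_card_carrier) simp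
    have alts_eq: "alts X = carrier (alt_group n)" by (auto simp: X_def alt_group_carrier)
    have AP: "A \<subseteq> perms X" using A by (auto simp: X_def alt_group_carrier)
    have "(\<Sum>x\<in>perms X. f x) = (\<Sum>x\<in>A. 1)"
      using AP by (intro sum.mono_neutral_cong_right) (auto simp: f_def X_def finite_permutations)
    moreover have "real (card (perms X)) = fact n" by (simp add: X_def card_permutations)
    moreover have "(fact n :: real) = 2 * real (card (carrier (alt_group n)))"
      using card_alt by (metis of_nat_fact of_nat_mult of_nat_numeral)
    ultimately have "\<mu> = alt_density n A / 2" unfolding \<mu>_def avg_def alt_density_def by simp
    moreover have "exp (- real a) \<le> exp (- (t / 10 ^ 14)) / 2"
    proof -
      have "exp (- real a) \<le> exp (- (t / 10 ^ 14) - 1)" using a by simp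
      also have "\<dots> = exp (- (t / 10 ^ 14)) / exp 1" by (rule exp_diff)
      also have "\<dots> \<le> exp (- (t / 10 ^ 14)) / 2" using exp_ge_add_one_self[of 1] by (intro divide_left_mono) auto
      finally show ?thesis .
    qed
    ultimately have \<mu>a: "exp (- real a) \<le> \<mu>" using dense by simp
    have gb: "globally_bounded X (100\<^sup>2) \<mu> f"
      using global_set_globally_bounded[OF glob] unfolding X_def \<mu>_def f_def .
    interpret paired_space "half_shift (n div 2)" X
      by unfold_locales (auto simp: half_shift_def X_def)
    have "0 < ip (conv f f) f"
    proof (rule ip_conv_pos[OF _ _ _ _ gb \<mu>_def[symmetric] _ a0 \<mu>a])
      show "paired X {1..n div 2}"
        unfolding paired_def by (auto simp: half_shift_def X_def)
      have "4096 * real a \<le> t" using order_trans[OF _ at, of "4096 * real a"] by simp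
      moreover have "real n \<le> 8 * real m0" using m0 by linarith
      ultimately have "512 * real a \<le> real m0" using nt by linarith
      then show m0a: "512 * a \<le> m0" by simp
      show "m0 + 32 * a \<le> card {1..n div 2}" using m0a unfolding m0_def by simp
      \<comment> \<open>Since n = t^3, the cube of t/(40n) is 1/(64000 n^2), which cancels the n^2
        in the smallness condition.\<close>
      have "512 * (100\<^sup>2)\<^sup>2 * real a / real m0 \<le> t / (40 * real n)"
      proof -
        have "512 * (100\<^sup>2)\<^sup>2 * real a * (40 * real n) \<le> 512 * (100\<^sup>2)\<^sup>2 * real a * (40 * (8 * real m0))"
          using m0 by (intro mult_left_mono) auto
        also have "\<dots> = 163840 * (10 ^ 8 * real a) * real m0" by simp
        also have "\<dots> \<le> t * real m0" using at by (intro mult_right_mono) auto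
        finally show ?thesis using m0 nbig by (simp add: field_simps)
      qed
      then have "(512 * (100\<^sup>2)\<^sup>2 * real a / real m0) ^ 3 \<le> (t / (40 * real n)) ^ 3" by (intro power_mono) auto
      also have "\<dots> = 1 / (64000 * (real n)\<^sup>2)"
        using n by (simp add: power_divide power_mult_distrib flip: tn) (simp add: power3_eq_cube power2_eq_square)
      finally have "(real n)\<^sup>2 * (512 * (100\<^sup>2)\<^sup>2 * real a / real m0) ^ 3 \<le> (real n)\<^sup>2 * (1 / (64000 * (real n)\<^sup>2))"
        by (rule mult_left_mono) simp
      also have "\<dots> = 1 / 64000" using n by simp
      finally show "64 * ((real (card X))\<^sup>2 * (512 * (100\<^sup>2)\<^sup>2 * real a / real m0) ^ 3) \<le> 1"
        by (simp add: X_def)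
      show "2 * real (card (alts X)) = fact (card X)"
        using \<open>fact n = 2 * real (card (carrier (alt_group n)))\<close> unfolding alts_eq by (simp add: X_def)
    qed (use A in \<open>auto simp: f_def indicator_def alt_group_carrier\<close>)
    moreover have "x \<circ> y \<notin> A" if "x \<in> A" "y \<in> A" for x y
      using pf that unfolding product_free_def alt_group_mult by blast
    ultimately show False using product_free_ip[of A] unfolding f_def by simp
  qed
  then show "alt_density n A < exp (- (1 / 10 ^ 14) * real n powr (1/3))" unfolding t_def .
qed simp

end
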